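(* Let $\alpha$ be a set with an involution $\tau$. The formula $w\mapsto p(w)$, assigning to a nanoword $w$ over $\alpha$ its $\alpha$-pairing $p(w)=(\mathcal A\cup\{s\},s,e_w)$ with values in $\pi=\pi(\alpha,\tau)$, defines a group homomorphism $p:\mathcal N_c(\alpha,\tau)\to\mathcal P_{sk}(\alpha,\tau,\pi)$ from the group of cobordism classes of nanowords over $\alpha$ to the group of cobordism classes of skew-symmetric $\alpha$-pairings. (In particular, cobordant nanowords have cobordant $\alpha$-pairings.)
   Context: **Nanowords.** $\alpha$ is a set with an involution $\tau:\alpha\to\alpha$ ($\tau^2=\mathrm{id}$; fixed points allowed). An $\alpha$-alphabet is a set $\mathcal A$ with a map $\mathcal A\to\alpha$, $A\mapsto|A|$. A nanoword of length $n$ over $\alpha$ is a pair $(\mathcal A,w)$ with $\mathcal A$ an $\alpha$-alphabet and $w:\{1,\dots,n\}\to\mathcal A$ a map (written as the sequence $w(1)\cdots w(n)$) taking every value in $\mathcal A$ exactly twice; there is a unique empty nanoword $\emptyset$. Nanowords $(\mathcal A,w),(\mathcal A',w')$ are isomorphic if $w'=fw$ for a bijection $f:\mathcal A\to\mathcal A'$ with $|f(A)|=|A|$. The opposite word of $w$ is $w^-=w(n)\cdots w(1)$. The product of two nanowords is their concatenation, after making the alphabets disjoint by an isomorphism. **Homotopy moves.** (1) $(\mathcal A,xAAy)\mapsto(\mathcal A-\{A\},xy)$; (2) $(\mathcal A,xAByBAz)\mapsto(\mathcal A-\{A,B\},xyz)$ if $|B|=\tau(|A|)$; (3) $(\mathcal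 A,xAByACzBCt)\mapsto(\mathcal A,xBAyCAzCBt)$ for distinct $A,B,C$ with $|A|=|B|=|C|$. **Surgery.** A nanophrase $\nabla=(\mathcal B,(v_1|\cdots|v_k))$ is a sequence of words in an $\alpha$-alphabet $\mathcal B$ such that every letter of $\mathcal B$ appears exactly twice in $v_1v_2\cdots v_k$. Put $\varepsilon_\nabla(B)=0$ if both occurrences of $B$ are in the same $v_r$, and $\varepsilon_\nabla(B)=1$ otherwise. $\nabla$ is even if all $v_r$ have even length; it is symmetric if there is a bijection $\iota:\mathcal B\to\mathcal B$ with $\iota v_r=v_r^-$ for all $r$ and $|\iota(B)|=\tau^{\varepsilon_\nabla(B)}(|B|)$ for all $B$. $\nabla$ is a factor of a nanoword $(\mathcal A,w)$ if $\mathcal B\subset\mathcal A$ (with restricted projection to $\alpha$) and $w=x_1v_1x_2v_2\cdots x_kv_kx_{k+1}$ with $x_i$ words in $\mathcal A-\mathcal B$. A surgery replaces $(\mathcal A,w)$ by $(\mathcal A-\mathcal B,x_1x_2\cdots x_{k+1})$, where $\nabla$ is an even symmetric factor. **Cobordism of nanowords.** Two nanowords are cobordant if they are related by a finite sequence of isomorphisms, homotopy moves, surgeries and inverse moves. The cobordism classes form a group $\mathcal N_c=\mathcal N_c(\alpha,\tau)$ under concatenation, with unit the class of $\emptyset$ and inverse of $w$ given by $w^-$. **$\alpha$-pairings.** $\pi=\pi(\alpha,\tau)$ is the (additive) abelian group with generators $a\in\alpha$ and relations $a+\tau(a)=0$, $a\in\alpha$. An $\alpha$-pairing is a triple $p=(S,s,e)$: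 a finite set $S$, an element $s\in S$, a map $S^\circ=S-\{s\}\to\alpha$, $A\mapsto|A|$, and a map $e:S\times S\to\pi$, extended to a bilinear form $\tilde e:\mathbb ZS\times\mathbb ZS\to\pi$ on the free abelian group $\mathbb ZS$. It is skew-symmetric if $e(A,A)=0$ and $e(A,B)=-e(B,A)$ for all $A,B\in S$. The opposite is $p^-=(S,s,-e)$. The sum $p_1\oplus p_2$ of $p_i=(S_i,s_i,e_i)$ is $(S_1^\circ\sqcup S_2^\circ\sqcup\{s\},s,e)$ with inherited projections, $e=e_i$ on $S_i^\circ\times S_i^\circ$, $e(S_1^\circ,S_2^\circ)=e(S_2^\circ,S_1^\circ)=0$, $e(A,s)=e_i(A,s_i)$, $e(s,A)=e_i(s_i,A)$ for $A\in S_i^\circ$, and $e(s,s)=e_1(s_1,s_1)+e_2(s_2,s_2)$. A vector $x\in\mathbb ZS$ is short if $x=A\in S^\circ$, or $x=A+B$ with $A\ne B\in S^\circ$, $|A|=|B|$, or $x=A-B$ with $A\neq B\in S^\circ$, $|A|=\tau(|B|)$. A filling of $p$ is a finite family $\{\lambda_i\}$ in $\mathbb ZS$ such that one $\lambda_i$ equals $s$, all others are short, and every element of $S^\circ$ occurs with non-zero coefficient in exactly one $\lambda_i$. It is annihilating if $\tilde e(\lambda_i,\lambda_j)=0$ for all $i,j$. $p$ is hyperbolic if it has an annihilating filling. $p_1,p_2$ are cobordant if $p_1\oplus p_2^-$ is hyperbolic; this is an equivalence relation, and the cobordism classes of $\alpha$-pairings form an abelian group $\mathcal P=\mathcal P(\alpha,\tau,\pi)$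 under $\oplus$. The classes of skew-symmetric $\alpha$-pairings form a subgroup $\mathcal P_{sk}=\mathcal P_{sk}(\alpha,\tau,\pi)$. **The $\alpha$-pairing $p(w)$ of a nanoword $(\mathcal A,w)$.** $p(w)=(S=\mathcal A\cup\{s\},s,e_w)$ with $S^\circ=\mathcal A\to\alpha$ the given projection. For $A,B\in\mathcal A$ let $n_w(A,B)=1$ if $w=\cdots A\cdots B\cdots A\cdots B\cdots$, $n_w(A,B)=-1$ if $w=\cdots B\cdots A\cdots B\cdots A\cdots$, and $0$ otherwise. Let $i_A<j_A$ be the two elements of $w^{-1}(A)$, and $A\circ_wB=\sum|D|\in\pi$, the sum over $D\in\mathcal A$ with $i_A<i_D<j_A$ and $i_B<j_D<j_B$. Then $e_w(A,B)=2(A\circ_wB-B\circ_wA)+n_w(A,B)(|A|+|B|)$, $e_w(A,s)=-e_w(s,A)=\sum_{D\in\mathcal A}n_w(A,D)|D|$, $e_w(s,s)=0$. This is skew-symmetric. *)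

theory Defs
  imports "HOL-Algebra.Free_Abelian_Groups" "HOL-Library.Infinite_Typeclass"
begin

text \<open>The set with involution is a carrier \<open>al :: 'a set\<close> with \<open>tau :: 'a \<Rightarrow> 'a\<close>; values of
  \<open>tau\<close> outside \<open>al\<close> are irrelevant.\<close>

definition involution_on :: "'a set \<Rightarrow> ('a \<Rightarrow> 'a) \<Rightarrow> bool" where
  "involution_on al tau \<longleftrightarrow> (\<forall>a\<in>al. tau a \<in> al \<and> tau (tau a) = a)"


section \<open>Nanowords\<close>

text \<open>The values of \<open>proj\<close> outside \<open>letters\<close> are irrelevant: changing them is an isomorphism.\<close>

record ('l, 'a) nanoword =
  letters :: "'l set"
  proj :: "'l \<Rightarrow> 'a"
  word :: "'l list"

definition is_nanoword :: "'a set \<Rightarrow> ('l, 'a) nanoword \<Rightarrow> bool" where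
  "is_nanoword al W \<longleftrightarrow>
     proj W ` letters W \<subseteq> al \<and> set (word W) \<subseteq> letters W \<and>
     (\<forall>A\<in>letters W. count_list (word W) A = 2)"

definition empty_nanoword :: "('l, 'a) nanoword" where
  "empty_nanoword = \<lparr>letters = {}, proj = (\<lambda>_. undefined), word = []\<rparr>"

definition nw_isomorphic :: "('l, 'a) nanoword \<Rightarrow> ('l, 'a) nanoword \<Rightarrow> bool" where
  "nw_isomorphic W W' \<longleftrightarrow>
     (\<exists>f. bij_betw f (letters W) (letters W') \<and>
          (\<forall>A\<in>letters W. proj W' (f A) = proj W A) \<and>
          word W' = map f (word W))"

definition move1 :: "('l, 'a) nanoword \<Rightarrow> ('l, 'a) nanoword \<Rightarrow> bool" where
  "move1 W W' \<longleftrightarrow>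
     (\<exists>x y A. word W = x @ [A, A] @ y \<and>
        W' = \<lparr>letters = letters W - {A}, proj = proj W, word = x @ y\<rparr>)"

definition move2 :: "('a \<Rightarrow> 'a) \<Rightarrow> ('l, 'a) nanoword \<Rightarrow> ('l, 'a) nanoword \<Rightarrow> bool" where
  "move2 tau W W' \<longleftrightarrow>
     (\<exists>x y z A B. word W = x @ [A, B] @ y @ [B, A] @ z \<and> proj W B = tau (proj W A) \<and>
        W' = \<lparr>letters = letters W - {A, B}, proj = proj W, word = x @ y @ z\<rparr>)"

definition move3 :: "('l, 'a) nanoword \<Rightarrow> ('l, 'a) nanoword \<Rightarrow> bool" where
  "move3 W W' \<longleftrightarrow>
     (\<exists>x y z t A B C. distinct [A, B, C] \<and> proj W A = proj W B \<and> proj W B = proj W C \<and>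
        word W = x @ [A, B] @ y @ [A, C] @ z @ [B, C] @ t \<and>
        W' = \<lparr>letters = letters W, proj = proj W,
              word = x @ [B, A] @ y @ [C, A] @ z @ [C, B] @ t\<rparr>)"


section \<open>Surgery\<close>

text \<open>A nanophrase is given by its letters \<open>B\<close>, a projection \<open>f\<close> (relevant on \<open>B\<close> only) and the
  list of words \<open>vs\<close>.\<close>

definition is_nanophrase :: "'a set \<Rightarrow> ('l \<Rightarrow> 'a) \<Rightarrow> 'l set \<Rightarrow> 'l list list \<Rightarrow> bool" where
  "is_nanophrase al f B vs \<longleftrightarrow>
     f ` B \<subseteq> al \<and> set (concat vs) \<subseteq> B \<and> (\<forall>b\<in>B. count_list (concat vs) b = 2)"

definition phrase_eps :: "'l list list \<Rightarrow> 'l \<Rightarrow> nat" where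
  "phrase_eps vs b = (if \<exists>v\<in>set vs. count_list v b = 2 then 0 else 1)"

definition even_phrase :: "'l list list \<Rightarrow> bool" where
  "even_phrase vs \<longleftrightarrow> (\<forall>v\<in>set vs. even (length v))"

definition symmetric_phrase ::
    "('a \<Rightarrow> 'a) \<Rightarrow> ('l \<Rightarrow> 'a) \<Rightarrow> 'l set \<Rightarrow> 'l list list \<Rightarrow> bool" where
  "symmetric_phrase tau f B vs \<longleftrightarrow>
     (\<exists>\<iota>. bij_betw \<iota> B B \<and> (\<forall>v\<in>set vs. map \<iota> v = rev v) \<and>
          (\<forall>b\<in>B. f (\<iota> b) = (tau ^^ phrase_eps vs b) (f b)))"

text \<open>Here \<open>xs\<close> lists \<open>x\<^sub>1, \<dots>, x\<^sub>k\<close> and \<open>y\<close> is \<open>x\<^sub>k\<^sub>+\<^sub>1\<close>.\<close>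

definition surgery ::
    "'a set \<Rightarrow> ('a \<Rightarrow> 'a) \<Rightarrow> ('l, 'a) nanoword \<Rightarrow> ('l, 'a) nanoword \<Rightarrow> bool" where
  "surgery al tau W W' \<longleftrightarrow>
     (\<exists>B vs xs y.
        B \<subseteq> letters W \<and> is_nanophrase al (proj W) B vs \<and>
        even_phrase vs \<and> symmetric_phrase tau (proj W) B vs \<and>
        length xs = length vs \<and> set (concat xs @ y) \<subseteq> letters W - B \<and>
        word W = concat (map2 (@) xs vs) @ y \<and>
        W' = \<lparr>letters = letters W - B, proj = proj W, word = concat xs @ y\<rparr>)"


section \<open>The cobordism group of nanowords\<close>

definition nw_step ::
    "'a set \<Rightarrow> ('a \<Rightarrow> 'a) \<Rightarrow> ('l, 'a) nanoword \<Rightarrow> ('l, 'a) nanoword \<Rightarrow> bool" where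
  "nw_step al tau W W' \<longleftrightarrow>
     is_nanoword al W \<and> is_nanoword al W' \<and>
     (nw_isomorphic W W' \<or> move1 W W' \<or> move2 tau W W' \<or> move3 W W' \<or> surgery al tau W W')"

definition nw_cobordant ::
    "'a set \<Rightarrow> ('a \<Rightarrow> 'a) \<Rightarrow> ('l, 'a) nanoword \<Rightarrow> ('l, 'a) nanoword \<Rightarrow> bool" where
  "nw_cobordant al tau = equivclp (nw_step al tau)"

definition nw_class ::
    "'a set \<Rightarrow> ('a \<Rightarrow> 'a) \<Rightarrow> ('l, 'a) nanoword \<Rightarrow> ('l, 'a) nanoword set" where
  "nw_class al tau W = {V. is_nanoword al V \<and> nw_cobordant al tau W V}"

text \<open>Concatenation, meaningful when the two sets of letters are disjoint.\<close>

definition nw_concat ::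
    "('l, 'a) nanoword \<Rightarrow> ('l, 'a) nanoword \<Rightarrow> ('l, 'a) nanoword" where
  "nw_concat U V =
     \<lparr>letters = letters U \<union> letters V,
      proj = (\<lambda>A. if A \<in> letters U then proj U A else proj V A),
      word = word U @ word V\<rparr>"

text \<open>The letters are drawn from a type \<open>'l\<close>. When \<open>'l\<close> is infinite, every nanoword is isomorphic
  to one with letters in \<open>'l\<close>, and disjoint copies always exist.\<close>

definition nw_group :: "'a set \<Rightarrow> ('a \<Rightarrow> 'a) \<Rightarrow> ('l, 'a) nanoword set monoid" where
  "nw_group al tau =
     \<lparr>carrier = {nw_class al tau W | W. is_nanoword al W},
      monoid.mult = (\<lambda>X Y.
        {W. is_nanoword al W \<and>
            (\<exists>U\<in>X. \<exists>V\<in>Y. \<exists>U' V'. nw_isomorphic U U' \<and> nw_isomorphic V V' \<and>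
               letters U' \<inter> letters V' = {} \<and> nw_cobordant al tau (nw_concat U' V') W)}),
      one = nw_class al tau empty_nanoword\<rparr>"


section \<open>Pairings\<close>

text \<open>The abelian group generated by \<open>al\<close> with relations \<open>a + tau a = 0\<close>. As usual in
  \<open>HOL-Algebra\<close>, it is written multiplicatively.\<close>

definition pi_relators :: "'a set \<Rightarrow> ('a \<Rightarrow> 'a) \<Rightarrow> ('a \<Rightarrow>\<^sub>0 int) set" where
  "pi_relators al tau =
     generate (free_Abelian_group al) ((\<lambda>a. frag_of a + frag_of (tau a)) ` al)"

definition pi_group :: "'a set \<Rightarrow> ('a \<Rightarrow> 'a) \<Rightarrow> ('a \<Rightarrow>\<^sub>0 int) set monoid" where
  "pi_group al tau = free_Abelian_group al Mod pi_relators al tau"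

definition pi_gen :: "'a set \<Rightarrow> ('a \<Rightarrow> 'a) \<Rightarrow> 'a \<Rightarrow> ('a \<Rightarrow>\<^sub>0 int) set" where
  "pi_gen al tau a = pi_relators al tau #>\<^bsub>free_Abelian_group al\<^esub> frag_of a"

text \<open>\<open>pproj\<close> is relevant only on \<open>pset - {pbase}\<close>, and \<open>pform\<close> only on \<open>pset \<times> pset\<close>.\<close>

record ('s, 'a) pairing =
  pset :: "'s set"
  pbase :: 's
  pproj :: "'s \<Rightarrow> 'a"
  pform :: "'s \<Rightarrow> 's \<Rightarrow> ('a \<Rightarrow>\<^sub>0 int) set"

definition pcirc :: "('s, 'a) pairing \<Rightarrow> 's set" where
  "pcirc p = pset p - {pbase p}"

definition is_pairing :: "'a set \<Rightarrow> ('a \<Rightarrow> 'a) \<Rightarrow> ('s, 'a) pairing \<Rightarrow> bool" where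
  "is_pairing al tau p \<longleftrightarrow>
     finite (pset p) \<and> pbase p \<in> pset p \<and> pproj p ` pcirc p \<subseteq> al \<and>
     (\<forall>A\<in>pset p. \<forall>B\<in>pset p. pform p A B \<in> carrier (pi_group al tau))"

definition skew_symmetric :: "'a set \<Rightarrow> ('a \<Rightarrow> 'a) \<Rightarrow> ('s, 'a) pairing \<Rightarrow> bool" where
  "skew_symmetric al tau p \<longleftrightarrow>
     (\<forall>A\<in>pset p. pform p A A = \<one>\<^bsub>pi_group al tau\<^esub>) \<and>
     (\<forall>A\<in>pset p. \<forall>B\<in>pset p. pform p A B = inv\<^bsub>pi_group al tau\<^esub> pform p B A)"

definition p_opposite :: "'a set \<Rightarrow> ('a \<Rightarrow> 'a) \<Rightarrow> ('s, 'a) pairing \<Rightarrow> ('s, 'a) pairing" where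
  "p_opposite al tau p = p\<lparr>pform := (\<lambda>A B. inv\<^bsub>pi_group al tau\<^esub> pform p A B)\<rparr>"

text \<open>In the sum, \<open>None\<close> is the new distinguished element.\<close>

definition p_sum ::
    "'a set \<Rightarrow> ('a \<Rightarrow> 'a) \<Rightarrow> ('s, 'a) pairing \<Rightarrow> ('t, 'a) pairing \<Rightarrow> (('s + 't) option, 'a) pairing" where
  "p_sum al tau p q =
     \<lparr>pset = insert None (Some ` (Inl ` pcirc p \<union> Inr ` pcirc q)),
      pbase = None,
      pproj = (\<lambda>x. case the x of Inl A \<Rightarrow> pproj p A | Inr A \<Rightarrow> pproj q A),
      pform = (\<lambda>x y. case (x, y) of
          (Some (Inl A), Some (Inl B)) \<Rightarrow> pform p A B
        | (Some (Inr A), Some (Inr B)) \<Rightarrow> pform q A B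
        | (Some (Inl A), Some (Inr B)) \<Rightarrow> \<one>\<^bsub>pi_group al tau\<^esub>
        | (Some (Inr A), Some (Inl B)) \<Rightarrow> \<one>\<^bsub>pi_group al tau\<^esub>
        | (Some (Inl A), None) \<Rightarrow> pform p A (pbase p)
        | (Some (Inr A), None) \<Rightarrow> pform q A (pbase q)
        | (None, Some (Inl B)) \<Rightarrow> pform p (pbase p) B
        | (None, Some (Inr B)) \<Rightarrow> pform q (pbase q) B
        | (None, None) \<Rightarrow> pform p (pbase p) (pbase p) \<otimes>\<^bsub>pi_group al tau\<^esub> pform q (pbase q) (pbase q))\<rparr>"

text \<open>Vectors of the free abelian group on \<open>pset p\<close> are elements of \<open>'s \<Rightarrow>\<^sub>0 int\<close> with support in
  \<open>pset p\<close>.\<close>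

definition p_bilinear ::
    "'a set \<Rightarrow> ('a \<Rightarrow> 'a) \<Rightarrow> ('s, 'a) pairing \<Rightarrow> ('s \<Rightarrow>\<^sub>0 int) \<Rightarrow> ('s \<Rightarrow>\<^sub>0 int) \<Rightarrow> ('a \<Rightarrow>\<^sub>0 int) set" where
  "p_bilinear al tau p x y =
     finprod (pi_group al tau)
       (\<lambda>(A, B). pform p A B [^]\<^bsub>pi_group al tau\<^esub>
                   (Poly_Mapping.lookup x A * Poly_Mapping.lookup y B))
       (pset p \<times> pset p)"

definition short :: "('a \<Rightarrow> 'a) \<Rightarrow> ('s, 'a) pairing \<Rightarrow> ('s \<Rightarrow>\<^sub>0 int) \<Rightarrow> bool" where
  "short tau p x \<longleftrightarrow>
     (\<exists>A\<in>pcirc p. x = frag_of A) \<or>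
     (\<exists>A\<in>pcirc p. \<exists>B\<in>pcirc p. A \<noteq> B \<and> pproj p A = pproj p B \<and> x = frag_of A + frag_of B) \<or>
     (\<exists>A\<in>pcirc p. \<exists>B\<in>pcirc p. A \<noteq> B \<and> pproj p A = tau (pproj p B) \<and> x = frag_of A - frag_of B)"

definition filling :: "('a \<Rightarrow> 'a) \<Rightarrow> ('s, 'a) pairing \<Rightarrow> ('s \<Rightarrow>\<^sub>0 int) list \<Rightarrow> bool" where
  "filling tau p L \<longleftrightarrow>
     (\<exists>i<length L. L ! i = frag_of (pbase p) \<and> (\<forall>j<length L. j \<noteq> i \<longrightarrow> short tau p (L ! j))) \<and>
     (\<forall>A\<in>pcirc p. \<exists>!i. i < length L \<and> Poly_Mapping.lookup (L ! i) A \<noteq> 0)"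

definition annihilating ::
    "'a set \<Rightarrow> ('a \<Rightarrow> 'a) \<Rightarrow> ('s, 'a) pairing \<Rightarrow> ('s \<Rightarrow>\<^sub>0 int) list \<Rightarrow> bool" where
  "annihilating al tau p L \<longleftrightarrow>
     (\<forall>x\<in>set L. \<forall>y\<in>set L. p_bilinear al tau p x y = \<one>\<^bsub>pi_group al tau\<^esub>)"

definition hyperbolic :: "'a set \<Rightarrow> ('a \<Rightarrow> 'a) \<Rightarrow> ('s, 'a) pairing \<Rightarrow> bool" where
  "hyperbolic al tau p \<longleftrightarrow> (\<exists>L. filling tau p L \<and> annihilating al tau p L)"

definition p_cobordant ::
    "'a set \<Rightarrow> ('a \<Rightarrow> 'a) \<Rightarrow> ('s, 'a) pairing \<Rightarrow> ('t, 'a) pairing \<Rightarrow> bool" where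
  "p_cobordant al tau p q \<longleftrightarrow> hyperbolic al tau (p_sum al tau p (p_opposite al tau q))"

text \<open>Cobordism compares pairings whose underlying sets live in different types, so the class of
  any pairing \<open>p\<close> can be taken among the pairings over a type \<open>'s\<close>. When \<open>'s\<close> is infinite, every
  pairing is isomorphic to one over \<open>'s\<close>.\<close>

definition p_class ::
    "'a set \<Rightarrow> ('a \<Rightarrow> 'a) \<Rightarrow> ('t, 'a) pairing \<Rightarrow> ('s, 'a) pairing set" where
  "p_class al tau p = {q. is_pairing al tau q \<and> p_cobordant al tau p q}"

definition trivial_pairing :: "'a set \<Rightarrow> ('a \<Rightarrow> 'a) \<Rightarrow> (unit, 'a) pairing" where
  "trivial_pairing al tau =
     \<lparr>pset = {()}, pbase = (), pproj = (\<lambda>_. undefined), pform = (\<lambda>_ _. \<one>\<^bsub>pi_group al tau\<^esub>)\<rparr>"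

definition p_group :: "'a set \<Rightarrow> ('a \<Rightarrow> 'a) \<Rightarrow> ('s, 'a) pairing set monoid" where
  "p_group al tau =
     \<lparr>carrier = {p_class al tau p | p :: ('s, 'a) pairing. is_pairing al tau p},
      monoid.mult = (\<lambda>X Y.
        {r. is_pairing al tau r \<and> (\<exists>p\<in>X. \<exists>q\<in>Y. p_cobordant al tau (p_sum al tau p q) r)}),
      one = p_class al tau (trivial_pairing al tau)\<rparr>"

definition psk_group :: "'a set \<Rightarrow> ('a \<Rightarrow> 'a) \<Rightarrow> ('s, 'a) pairing set monoid" where
  "psk_group al tau =
     (p_group al tau)\<lparr>carrier :=
       {p_class al tau p | p :: ('s, 'a) pairing. is_pairing al tau p \<and> skew_symmetric al tau p}\<rparr>"


section \<open>The pairing of a nanoword\<close>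

definition n_w :: "'l list \<Rightarrow> 'l \<Rightarrow> 'l \<Rightarrow> int" where
  "n_w w A B =
     (if \<exists>x1 x2 x3 x4 x5. w = x1 @ [A] @ x2 @ [B] @ x3 @ [A] @ x4 @ [B] @ x5 then 1
      else if \<exists>x1 x2 x3 x4 x5. w = x1 @ [B] @ x2 @ [A] @ x3 @ [B] @ x4 @ [A] @ x5 then - 1
      else 0)"

definition occ_first :: "'l list \<Rightarrow> 'l \<Rightarrow> nat" where
  "occ_first w A = Min {i. i < length w \<and> w ! i = A}"

definition occ_last :: "'l list \<Rightarrow> 'l \<Rightarrow> nat" where
  "occ_last w A = Max {i. i < length w \<and> w ! i = A}"

definition circ_w ::
    "'a set \<Rightarrow> ('a \<Rightarrow> 'a) \<Rightarrow> ('l, 'a) nanoword \<Rightarrow> 'l \<Rightarrow> 'l \<Rightarrow> ('a \<Rightarrow>\<^sub>0 int) set" where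
  "circ_w al tau W A B =
     finprod (pi_group al tau) (\<lambda>D. pi_gen al tau (proj W D))
       {D \<in> letters W.
          occ_first (word W) A < occ_first (word W) D \<and> occ_first (word W) D < occ_last (word W) A \<and>
          occ_first (word W) B < occ_last (word W) D \<and> occ_last (word W) D < occ_last (word W) B}"

definition e_w ::
    "'a set \<Rightarrow> ('a \<Rightarrow> 'a) \<Rightarrow> ('l, 'a) nanoword \<Rightarrow> 'l \<Rightarrow> 'l \<Rightarrow> ('a \<Rightarrow>\<^sub>0 int) set" where
  "e_w al tau W A B =
     (circ_w al tau W A B \<otimes>\<^bsub>pi_group al tau\<^esub> inv\<^bsub>pi_group al tau\<^esub> circ_w al tau W B A)
        [^]\<^bsub>pi_group al tau\<^esub> (2 :: int)
     \<otimes>\<^bsub>pi_group al tau\<^esub>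
     (pi_gen al tau (proj W A) \<otimes>\<^bsub>pi_group al tau\<^esub> pi_gen al tau (proj W B))
        [^]\<^bsub>pi_group al tau\<^esub> n_w (word W) A B"

definition e_w_base ::
    "'a set \<Rightarrow> ('a \<Rightarrow> 'a) \<Rightarrow> ('l, 'a) nanoword \<Rightarrow> 'l \<Rightarrow> ('a \<Rightarrow>\<^sub>0 int) set" where
  "e_w_base al tau W A =
     finprod (pi_group al tau)
       (\<lambda>D. pi_gen al tau (proj W D) [^]\<^bsub>pi_group al tau\<^esub> n_w (word W) A D) (letters W)"

definition nw_pairing ::
    "'a set \<Rightarrow> ('a \<Rightarrow> 'a) \<Rightarrow> ('l, 'a) nanoword \<Rightarrow> ('l option, 'a) pairing" where
  "nw_pairing al tau W =
     \<lparr>pset = insert None (Some ` letters W),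
      pbase = None,
      pproj = (\<lambda>x. proj W (the x)),
      pform = (\<lambda>x y. case (x, y) of
          (Some A, Some B) \<Rightarrow> e_w al tau W A B
        | (Some A, None) \<Rightarrow> e_w_base al tau W A
        | (None, Some A) \<Rightarrow> inv\<^bsub>pi_group al tau\<^esub> e_w_base al tau W A
        | (None, None) \<Rightarrow> \<one>\<^bsub>pi_group al tau\<^esub>)\<rparr>"

end

(*
Values in the group pi are represented by integer combinations of letters modulo the relators, and a
filling by the involution that exchanges the two letters of each short vector together with a sign.

Cobordism of pairings is transitive by a cancellation argument: in the annihilating filling of
p (+) q^- (+) q (+) r^- the two copies of each letter of q are contracted one after the other, and every
new short vector lifts to an integer combination of old ones that is diagonal on the two copies of q.
On such vectors the contributions of q^- and q cancel.

For a nanoword, let J_A be twice the indicator function of the interval between the two occurrences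
i_A < j_A of A (with value 1 at the ends), and J_s = 1. Then
  2 e_w(X, Y) = sum over D of (J_X(i_D) J_Y(j_D) - J_Y(i_D) J_X(j_D)) |D|
for all X, Y in S. For a surgery with symmetry iota, reverse all words v_r in place. The vectors
A + A' for a surviving letter A and B + iota(B), B - iota(B) or B for a removed letter B have functions J
that are invariant under this reversal, and the last three vanish outside of the v_r. Hence the
contributions of D and iota(D) cancel. Evenness excludes fixed letters of iota that occur in two
different words, for which this would fail. The first two moves are surgeries, the third one does not
change the pairing.
*)

theory Submission
  imports Defs
begin

section \<open>Representatives modulo the relators\<close>

text \<open>The group pi can have 2-torsion, since a fixed point a of tau satisfies 2a = 0. The
  formula for 2 e_w(X, Y) therefore cannot be halved in pi. It is halved one letter D at a time, on
  the integer coefficient of |D|, which is even before halving because the values of each J at i_D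
  and at j_D have the same parity. For this reason forms are carried as representatives in the free
  abelian group, the symmetry arguments are identities between integers, and only the resulting sum
  is compared with the relators.

  The same torsion makes a letter with iota(B) = B in two different words harmful: its coefficient
  is not forced to vanish, and |B| = tau(|B|) has order at most 2 but can be nonzero.

  A second obstacle comes from the group laws. A chain of steps from U to U' can pass through words
  that share letters with V even when U and U' do not, so the letters of V are renamed along the
  chain. Likewise a sum of pairings lives over a new type, and copies over one infinite type bring
  representatives back.\<close>

locale inv_set =
  fixes al :: "'a set" and tau :: "'a \<Rightarrow> 'a"
  assumes involution: "involution_on al tau"
begin

abbreviation "FG \<equiv> free_Abelian_group al"
abbreviation "PI \<equiv> pi_group al tau"
abbreviation "rels \<equiv> pi_relators al tau"

definition cls :: "('a \<Rightarrow>\<^sub>0 int) \<Rightarrow> ('a \<Rightarrow>\<^sub>0 int) set" where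
  "cls x = rels #>\<^bsub>FG\<^esub> x"

definition frags :: "('a \<Rightarrow>\<^sub>0 int) set" where
  "frags = {x. Poly_Mapping.keys x \<subseteq> al}"

lemma tau_closed: "a \<in> al \<Longrightarrow> tau a \<in> al"
  and tau_tau: "a \<in> al \<Longrightarrow> tau (tau a) = a"
  using involution by (auto simp: involution_on_def)

lemma frags_carrier: "frags = carrier FG"
  by (auto simp: frags_def)

lemma frags_zero: "0 \<in> frags"
  by (simp add: frags_def)

lemma frags_add: "x \<in> frags \<Longrightarrow> y \<in> frags \<Longrightarrow> x + y \<in> frags"
  unfolding frags_def using keys_add[of x y] by auto

lemma frags_uminus: "x \<in> frags \<Longrightarrow> - x \<in> frags"
  unfolding frags_def by simp

lemma frags_diff: "x \<in> frags \<Longrightarrow> y \<in> frags \<Longrightarrow> x - y \<in> frags"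
  unfolding frags_def using keys_diff[of x y] by auto

lemma frags_cmul: "x \<in> frags \<Longrightarrow> frag_cmul k x \<in> frags"
  unfolding frags_def by auto

lemma frags_of: "a \<in> al \<Longrightarrow> frag_of a \<in> frags"
  unfolding frags_def by simp

lemma frags_sum: "(\<And>i. i \<in> I \<Longrightarrow> f i \<in> frags) \<Longrightarrow> sum f I \<in> frags"
  by (induction I rule: infinite_finite_induct) (auto simp: frags_zero frags_add)

lemmas frags_closed = frags_zero frags_add frags_uminus frags_diff frags_cmul frags_of frags_sum

lemma rels_subgroup: "subgroup rels FG"
  unfolding pi_relators_def
proof (rule group.generate_is_subgroup)
  show "(\<lambda>a. frag_of a + frag_of (tau a)) ` al \<subseteq> carrier FG"
    using frags_add[OF frags_of frags_of] tau_closed unfolding frags_carrier by blast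
qed simp

lemma rels_normal: "rels \<lhd> FG"
  using rels_subgroup by (simp add: comm_group.subgroup_imp_normal abelian_free_Abelian_group)

lemma rels_subset: "rels \<subseteq> frags"
  using rels_subgroup frags_carrier subgroup.subset by metis

lemma rels_zero: "0 \<in> rels"
  using subgroup.one_closed[OF rels_subgroup] by simp

lemma rels_add: "x \<in> rels \<Longrightarrow> y \<in> rels \<Longrightarrow> x + y \<in> rels"
  using subgroup.m_closed[OF rels_subgroup] by simp

lemma rels_uminus: "x \<in> rels \<Longrightarrow> - x \<in> rels"
  using subgroup.m_inv_closed[OF rels_subgroup, of x] rels_subset by (auto simp: frags_def)

lemma rels_diff: "x \<in> rels \<Longrightarrow> y \<in> rels \<Longrightarrow> x - y \<in> rels"
  using rels_add[of x "- y"] rels_uminus by simp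

lemma rels_cmul: "x \<in> rels \<Longrightarrow> frag_cmul k x \<in> rels"
  by (rule frag_closure_minus_cmul[where P = "\<lambda>x. x \<in> rels"]) (auto simp: rels_zero rels_diff)

lemma rels_pair: "a \<in> al \<Longrightarrow> frag_of a + frag_of (tau a) \<in> rels"
  unfolding pi_relators_def by (rule generate.incl) auto

lemma cls_altdef: "cls x = {r + x | r. r \<in> rels}"
  by (auto simp: cls_def r_coset_def)

lemma cls_eq_iff: "cls x = cls y \<longleftrightarrow> x - y \<in> rels"
proof
  assume "cls x = cls y"
  moreover have "x \<in> cls x"
    unfolding cls_altdef using rels_zero by force
  ultimately show "x - y \<in> rels"
    unfolding cls_altdef by auto
next
  assume *: "x - y \<in> rels"
  have "r + x \<in> cls y" if "r \<in> rels" for r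
    unfolding cls_altdef using rels_add[OF that *]
    by (auto intro!: exI[of _ "r + (x - y)"])
  moreover have "r + y \<in> cls x" if "r \<in> rels" for r
    unfolding cls_altdef using rels_diff[OF that *]
    by (auto intro!: exI[of _ "r - (x - y)"])
  ultimately show "cls x = cls y"
    unfolding cls_altdef by blast
qed

lemma one_PI: "\<one>\<^bsub>PI\<^esub> = cls 0"
  by (auto simp: pi_group_def cls_altdef)

lemma cls_eq_one: "cls x = \<one>\<^bsub>PI\<^esub> \<longleftrightarrow> x \<in> rels"
  unfolding one_PI cls_eq_iff by simp

lemma carrier_PI: "carrier PI = cls ` frags"
  unfolding pi_group_def carrier_FactGroup frags_carrier cls_def by simp

lemma cls_closed: "x \<in> frags \<Longrightarrow> cls x \<in> carrier PI"
  unfolding carrier_PI by simp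

lemma mult_cls: "x \<in> frags \<Longrightarrow> y \<in> frags \<Longrightarrow> cls x \<otimes>\<^bsub>PI\<^esub> cls y = cls (x + y)"
  unfolding pi_group_def cls_def mult_FactGroup
  using normal.rcos_sum[OF rels_normal] frags_carrier by simp

lemma comm_group_PI: "comm_group PI"
  unfolding pi_group_def
  by (rule comm_group.abelian_FactGroup[OF abelian_free_Abelian_group rels_subgroup])

lemma group_PI: "group PI"
  using comm_group_PI by (simp add: comm_group_def)

lemma inv_cls: "x \<in> frags \<Longrightarrow> inv\<^bsub>PI\<^esub> cls x = cls (- x)"
  by (rule group.inv_equality[OF group_PI])
    (auto simp: mult_cls one_PI frags_closed intro!: cls_closed)

lemma pow_cls:
  assumes "x \<in> frags" shows "cls x [^]\<^bsub>PI\<^esub> (k :: int) = cls (frag_cmul k x)"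
  using normal.FactGroup_int_pow[OF rels_normal, of x k] assms
  unfolding pi_group_def cls_def frags_carrier by (auto simp: frags_def)

lemma finprod_cls:
  assumes "\<And>i. i \<in> I \<Longrightarrow> f i \<in> frags"
  shows "finprod PI (\<lambda>i. cls (f i)) I = cls (sum f I)"
  using assms
proof (induction I rule: infinite_finite_induct)
  case (infinite A)
  then show ?case
    by (simp add: one_PI comm_monoid.finprod_infinite comm_group.axioms(1)[OF comm_group_PI])
next
  case empty
  then show ?case
    by (simp add: one_PI comm_monoid.finprod_empty comm_group.axioms(1)[OF comm_group_PI])
next
  case (insert x F)
  then show ?case
    by (subst comm_monoid.finprod_insert[OF comm_group.axioms(1)[OF comm_group_PI]])
      (auto simp: mult_cls frags_sum intro!: cls_closed)
qed

lemma pi_gen_cls: "pi_gen al tau a = cls (frag_of a)"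
  by (simp add: pi_gen_def cls_def)

end

section \<open>Hyperbolic pairings and matchings\<close>

text \<open>The bilinear form before reduction modulo the relators. It is an ordinary finite sum
  instead of a product in a quotient group, and its vectors are plain functions, so restricting a
  vector or pulling it back along a map is composition.\<close>

definition bil :: "'s set \<Rightarrow> ('s \<Rightarrow> 's \<Rightarrow> 'a \<Rightarrow>\<^sub>0 int) \<Rightarrow> ('s \<Rightarrow> int) \<Rightarrow> ('s \<Rightarrow> int) \<Rightarrow> ('a \<Rightarrow>\<^sub>0 int)" where
  "bil S e x y = (\<Sum>A\<in>S. \<Sum>B\<in>S. frag_cmul (x A * y B) (e A B))"

lemma bil_cong:
  "\<lbrakk>\<And>A. A \<in> S \<Longrightarrow> x A = x' A; \<And>A. A \<in> S \<Longrightarrow> y A = y' A; \<And>A B. A \<in> S \<Longrightarrow> B \<in> S \<Longrightarrow> e A B = e' A B\<rbrakk>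
   \<Longrightarrow> bil S e x y = bil S e' x' y'"
  unfolding bil_def by (auto intro!: sum.cong)

lemma bil_add_left: "bil S e (\<lambda>X. x X + k * y X) z = bil S e x z + frag_cmul k (bil S e y z)"
  unfolding bil_def
  by (simp add: sum.distrib[symmetric] frag_cmul_sum frag_cmul_distrib[symmetric] algebra_simps)

lemma bil_add_right: "bil S e z (\<lambda>X. x X + k * y X) = bil S e z x + frag_cmul k (bil S e z y)"
  unfolding bil_def
  by (simp add: sum.distrib[symmetric] frag_cmul_sum frag_cmul_distrib[symmetric] algebra_simps)

lemma bil_add_form:
  "bil S (\<lambda>A B. e A B + e' A B) x y = bil S e x y + bil S e' x y"
  unfolding bil_def by (simp add: sum.distrib frag_cmul_distrib2)

lemma frag_cmul_uminus: "frag_cmul k (- z) = - frag_cmul k z"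
  by (rule poly_mapping_eqI) simp

lemma bil_minus_form: "bil S (\<lambda>A B. - e A B) x y = - bil S e x y"
  unfolding bil_def frag_cmul_uminus by (simp add: sum_negf del: minus_frag_cmul)

definition unit_vec :: "'s \<Rightarrow> 's \<Rightarrow> int" where
  "unit_vec A X = of_bool (X = A)"

definition match_vec :: "('s \<Rightarrow> 's) \<Rightarrow> ('s \<Rightarrow> int) \<Rightarrow> 's \<Rightarrow> 's \<Rightarrow> int" where
  "match_vec m c A = (\<lambda>X. unit_vec A X + c A * unit_vec (m A) X)"

text \<open>The short vectors of a filling are encoded by the involution \<open>m\<close> that swaps the two letters of
  such a vector and by their relative sign \<open>c\<close>; the vector \<open>A\<close> alone has \<open>m A = A\<close> and \<open>c A = 0\<close>.
  The filling then consists of the vectors \<open>match_vec m c A\<close>, up to sign and repetition.\<close>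

definition matching ::
    "('a \<Rightarrow> 'a) \<Rightarrow> 's set \<Rightarrow> 's \<Rightarrow> ('s \<Rightarrow> 'a) \<Rightarrow> ('s \<Rightarrow> 's) \<Rightarrow> ('s \<Rightarrow> int) \<Rightarrow> bool" where
  "matching tau S s q m c \<longleftrightarrow> m s = s \<and> c s = 0 \<and>
     (\<forall>A\<in>S - {s}. m A \<in> S - {s} \<and> m (m A) = A \<and> c A \<in> {-1, 0, 1} \<and> (c A = 0 \<longleftrightarrow> m A = A) \<and>
        c (m A) = c A \<and> q (m A) = (if c A = -1 then tau (q A) else q A))"

lemma matchingI:
  assumes "m s = s" "c s = 0"
    "\<And>A. A \<in> S - {s} \<Longrightarrow> m A \<in> S - {s} \<and> m (m A) = A \<and> c A \<in> {-1, 0, 1} \<and> (c A = 0 \<longleftrightarrow> m A = A) \<and>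
       c (m A) = c A \<and> q (m A) = (if c A = -1 then tau (q A) else q A)"
  shows "matching tau S s q m c"
  using assms unfolding matching_def by blast

lemma matchingD:
  assumes "matching tau S s q m c" "A \<in> S - {s}"
  shows "m A \<in> S - {s}" "m (m A) = A" "c A \<in> {-1, 0, 1}" "c A = 0 \<longleftrightarrow> m A = A" "c (m A) = c A"
    "q (m A) = (if c A = -1 then tau (q A) else q A)"
  using assms unfolding matching_def by blast+

lemma matching_closed: "matching tau S s q m c \<Longrightarrow> A \<in> S \<Longrightarrow> m A \<in> S"
  unfolding matching_def by (cases "A = s") auto

lemma matching_base: "matching tau S s q m c \<Longrightarrow> m s = s \<and> c s = 0"
  unfolding matching_def by blast

lemma lookup_match_vec:
  "(\<lambda>X. Poly_Mapping.lookup (frag_of A + frag_cmul k (frag_of B)) X) = (\<lambda>X. unit_vec A X + k * unit_vec B X)"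
  by (auto simp: lookup_add unit_vec_def fun_eq_iff)

context inv_set
begin

section \<open>Forms with representatives in the free abelian group, and fillings as
  matchings\<close>

definition rep_form :: "('s, 'a) pairing \<Rightarrow> ('s \<Rightarrow> 's \<Rightarrow> 'a \<Rightarrow>\<^sub>0 int) \<Rightarrow> bool" where
  "rep_form p e \<longleftrightarrow> (\<forall>A\<in>pset p. \<forall>B\<in>pset p. e A B \<in> frags \<and> pform p A B = cls (e A B))"

lemma rep_form_exists:
  assumes "is_pairing al tau p"
  obtains e where "rep_form p e"
proof -
  have "\<forall>A B. \<exists>x. A \<in> pset p \<longrightarrow> B \<in> pset p \<longrightarrow> x \<in> frags \<and> pform p A B = cls x"
    using assms unfolding is_pairing_def carrier_PI by blast
  then obtain e where "\<forall>A B. A \<in> pset p \<longrightarrow> B \<in> pset p \<longrightarrow> e A B \<in> frags \<and> pform p A B = cls (e A B)"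
    by metis
  then show ?thesis
    using that[of e] unfolding rep_form_def by blast
qed

lemma p_bilinear_cls:
  assumes "rep_form p e"
  shows "p_bilinear al tau p x y =
    cls (bil (pset p) e (Poly_Mapping.lookup x) (Poly_Mapping.lookup y))"
proof -
  let ?k = "\<lambda>A B. Poly_Mapping.lookup x A * Poly_Mapping.lookup y B"
  have "p_bilinear al tau p x y =
      finprod PI (\<lambda>z. cls (frag_cmul (?k (fst z) (snd z)) (e (fst z) (snd z)))) (pset p \<times> pset p)"
    unfolding p_bilinear_def using assms
    by (intro comm_monoid.finprod_cong' comm_group.axioms(1)[OF comm_group_PI])
      (auto simp: rep_form_def pow_cls intro!: cls_closed frags_closed)
  also have "\<dots> = cls (\<Sum>z\<in>pset p \<times> pset p. frag_cmul (?k (fst z) (snd z)) (e (fst z) (snd z)))"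
    using assms by (intro finprod_cls) (auto simp: rep_form_def intro!: frags_closed)
  also have "(\<Sum>z\<in>pset p \<times> pset p. frag_cmul (?k (fst z) (snd z)) (e (fst z) (snd z))) =
      bil (pset p) e (Poly_Mapping.lookup x) (Poly_Mapping.lookup y)"
    unfolding bil_def sum.cartesian_product by (simp add: case_prod_beta)
  finally show ?thesis .
qed

text \<open>A short vector seen from one of its letters \<open>A\<close>. The overall sign
  \<open>l\<close> occurs because a difference \<open>C - D\<close> seen from \<open>D\<close> is
  \<open>-(D - C)\<close>. A vector with the single letter \<open>A\<close> is encoded by
  \<open>k = 0\<close> and \<open>B = A\<close>.\<close>

definition short_data :: "('s, 'a) pairing \<Rightarrow> ('s \<Rightarrow>\<^sub>0 int) \<Rightarrow> 's \<Rightarrow> 's \<Rightarrow> int \<Rightarrow> int \<Rightarrow> bool" where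
  "short_data p x A B k l \<longleftrightarrow> l \<in> {-1, 1} \<and> k \<in> {-1, 0, 1} \<and> (k = 0 \<longleftrightarrow> B = A) \<and> B \<in> pcirc p \<and>
     pproj p B = (if k = -1 then tau (pproj p A) else pproj p A) \<and>
     x = frag_cmul l (frag_of A + frag_cmul k (frag_of B))"

lemma short_data_exists:
  assumes p: "is_pairing al tau p" and x: "short tau p x"
    and A: "A \<in> pcirc p" "Poly_Mapping.lookup x A \<noteq> 0"
  shows "\<exists>B k l. short_data p x A B k l"
  using x unfolding short_def
proof (elim disjE bexE conjE)
  fix C assume "C \<in> pcirc p" "x = frag_of C"
  then have "short_data p x A A 0 1"
    using A by (auto simp: short_data_def split: if_splits)
  then show ?thesis by blast
next
  fix C D assume *: "C \<in> pcirc p" "D \<in> pcirc p" "C \<noteq> D" "pproj p C = pproj p D" "x = frag_of C + frag_of D"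
  then consider "A = C" | "A = D"
    using A by (auto simp: lookup_add split: if_splits)
  then have "short_data p x A (if A = C then D else C) 1 1"
    by cases (use * in \<open>auto simp: short_data_def add.commute\<close>)
  then show ?thesis by blast
next
  fix C D assume *: "C \<in> pcirc p" "D \<in> pcirc p" "C \<noteq> D" "pproj p C = tau (pproj p D)" "x = frag_of C - frag_of D"
  \<comment> \<open>Seen from \<open>C\<close>, the condition on the projections has to be
    inverted.\<close>
  have tt: "tau (tau (pproj p D)) = pproj p D"
    using p *(2) by (intro tau_tau) (auto simp: is_pairing_def)
  consider "A = C" | "A = D"
    using A * by (auto simp: lookup_minus split: if_splits)
  then have "short_data p x A (if A = C then D else C) (-1) (if A = C then 1 else -1)"
    by cases (use * tt in \<open>auto simp: short_data_def\<close>)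
  then show ?thesis by blast
qed

lemma short_data_short:
  assumes p: "is_pairing al tau p" and "short_data p x A B k 1" and A: "A \<in> pcirc p"
  shows "short tau p x"
proof -
  have tt: "tau (tau (pproj p A)) = pproj p A"
    using p A by (intro tau_tau) (auto simp: is_pairing_def)
  consider "k = 0" | "k = 1" | "k = -1"
    using assms(2) by (auto simp: short_data_def)
  then show ?thesis
  proof cases
    case 1
    then show ?thesis using assms by (auto simp: short_data_def short_def)
  next
    case 2
    then show ?thesis using assms unfolding short_data_def short_def by force
  next
    case 3
    then have "A \<noteq> B" "B \<in> pcirc p" "pproj p A = tau (pproj p B)" "x = frag_of A - frag_of B"
      using assms tt by (auto simp: short_data_def)
    then show ?thesis using A unfolding short_def by blast
  qed
qed

lemma lookup_short_data:
  assumes "short_data p x A B k l"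
  shows "Poly_Mapping.lookup x X = l * (unit_vec A X + k * unit_vec B X)"
  using assms by (auto simp: short_data_def lookup_add unit_vec_def)

text \<open>Every letter lies in exactly one vector of the filling, so this vector defines its
  partner and its sign. Up to sign, \<open>match_vec m c A\<close> is that vector, and hence the new
  vectors annihilate each other as well.\<close>

lemma hyperbolic_imp_matching:
  assumes p: "is_pairing al tau p" and e: "rep_form p e" and "hyperbolic al tau p"
  obtains m c where "matching tau (pset p) (pbase p) (pproj p) m c"
    "\<And>A B. A \<in> pset p \<Longrightarrow> B \<in> pset p \<Longrightarrow>
       bil (pset p) e (match_vec m c A) (match_vec m c B) \<in> rels"
proof -
  obtain L where L: "filling tau p L" "annihilating al tau p L"
    using assms(3) by (auto simp: hyperbolic_def)
  obtain i0 where i0: "i0 < length L" "L ! i0 = frag_of (pbase p)"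
      "\<And>j. j < length L \<Longrightarrow> j \<noteq> i0 \<Longrightarrow> short tau p (L ! j)"
    using L(1) unfolding filling_def by blast
  have ex1: "\<exists>!i. i < length L \<and> Poly_Mapping.lookup (L ! i) A \<noteq> 0" if "A \<in> pcirc p" for A
    using L(1) that unfolding filling_def by blast
  have ann: "bil (pset p) e (Poly_Mapping.lookup (L ! i)) (Poly_Mapping.lookup (L ! j)) \<in> rels"
    if "i < length L" "j < length L" for i j
    using L(2) that unfolding annihilating_def p_bilinear_cls[OF e] cls_eq_one by simp
  have "\<exists>i B k l. A \<in> pcirc p \<longrightarrow> i < length L \<and> short_data p (L ! i) A B k l" for A
  proof (cases "A \<in> pcirc p")
    case True
    from ex1[OF True] obtain i where i: "i < length L" "Poly_Mapping.lookup (L ! i) A \<noteq> 0" by blast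
    have "A \<noteq> pbase p" using True by (auto simp: pcirc_def)
    then have "i \<noteq> i0" using i i0(2) by auto
    then show ?thesis using short_data_exists[OF p i0(3) True i(2)] i by blast
  qed auto
  then obtain ix m0 c0 l0 where *: "\<And>A. A \<in> pcirc p \<Longrightarrow> ix A < length L \<and> short_data p (L ! ix A) A (m0 A) (c0 A) (l0 A)"
    by metis
  define m where "m A = (if A = pbase p then A else m0 A)" for A
  define c where "c A = (if A = pbase p then 0 else c0 A)" for A
  define l where "l A = (if A = pbase p then 1 else l0 A)" for A
  define jx where "jx A = (if A = pbase p then i0 else ix A)" for A
  have data: "ix A < length L" "short_data p (L ! ix A) A (m A) (c A) (l A)" if "A \<in> pcirc p" for A
    using *[OF that] that by (auto simp: m_def c_def l_def pcirc_def)
  have symm: "m (m A) = A \<and> c (m A) = c A" if A: "A \<in> pcirc p" for A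
  proof (cases "m A = A")
    case False
    let ?B = "m A"
    have B: "?B \<in> pcirc p" using data(2)[OF A] by (auto simp: short_data_def)
    note dA = lookup_short_data[OF data(2)[OF A]] and dB = lookup_short_data[OF data(2)[OF B]]
    have "Poly_Mapping.lookup (L ! ix A) ?B \<noteq> 0"
      unfolding dA using data(2)[OF A] False by (auto simp: unit_vec_def short_data_def)
    moreover have "Poly_Mapping.lookup (L ! ix ?B) ?B \<noteq> 0"
      unfolding dB using data(2)[OF B] by (auto simp: unit_vec_def short_data_def)
    \<comment> \<open>The vector of \<open>A\<close> and the vector of \<open>m A\<close> both
      contain \<open>m A\<close>, so they are one vector. Comparing its coefficients at
      \<open>A\<close> and at \<open>m A\<close> then gives \<open>m (m A) = A\<close> and equal
      signs.\<close>
    ultimately have ix: "ix ?B = ix A"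
      using ex1[OF B] data(1)[OF A] data(1)[OF B] by blast
    have eq: "l A * (unit_vec A X + c A * unit_vec ?B X) = l ?B * (unit_vec ?B X + c ?B * unit_vec (m ?B) X)" for X
      using dA[of X] dB[of X] ix by simp
    have lc: "l A \<in> {-1,1}" "l ?B \<in> {-1,1}" "c A \<in> {-1,0,1}" "c ?B \<in> {-1,0,1}" "c ?B = 0 \<longleftrightarrow> m ?B = ?B" "c A \<noteq> 0"
      using data(2)[OF A] data(2)[OF B] False by (auto simp: short_data_def)
    show ?thesis
      using eq[of A] eq[of ?B] lc False by (auto simp: unit_vec_def of_bool_def split: if_splits)
  qed auto
  have mat: "matching tau (pset p) (pbase p) (pproj p) m c"
  proof (rule matchingI)
    show "m (pbase p) = pbase p" "c (pbase p) = 0" by (auto simp: m_def c_def)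
    fix A assume A: "A \<in> pset p - {pbase p}"
    then have "A \<in> pcirc p" by (simp add: pcirc_def)
    from data(2)[OF this] symm[OF this]
    show "m A \<in> pset p - {pbase p} \<and> m (m A) = A \<and> c A \<in> {-1, 0, 1} \<and> (c A = 0 \<longleftrightarrow> m A = A) \<and>
        c (m A) = c A \<and> pproj p (m A) = (if c A = -1 then tau (pproj p A) else pproj p A)"
      by (auto simp: short_data_def pcirc_def)
  qed
  have vec: "jx A < length L \<and> l A \<in> {-1,1} \<and> match_vec m c A = (\<lambda>X. 0 + l A * Poly_Mapping.lookup (L ! jx A) X)"
    if "A \<in> pset p" for A
  proof (cases "A = pbase p")
    case True
    then show ?thesis
      using i0 by (auto simp: jx_def l_def c_def m_def match_vec_def unit_vec_def fun_eq_iff)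
  next
    case False
    then have A: "A \<in> pcirc p" using that by (simp add: pcirc_def)
    have "l A * l A = 1" "l A \<in> {-1,1}" using data(2)[OF A] by (auto simp: short_data_def)
    moreover have "jx A = ix A" using False by (simp add: jx_def)
    ultimately show ?thesis
      using data(1)[OF A] lookup_short_data[OF data(2)[OF A]]
      by (auto simp: match_vec_def mult.assoc[symmetric] fun_eq_iff)
  qed
  have z: "bil (pset p) e (\<lambda>_. 0) x = 0" "bil (pset p) e x (\<lambda>_. 0) = 0" for x
    by (simp_all add: bil_def)
  show ?thesis
  proof (rule that[OF mat])
    fix A B assume AB: "A \<in> pset p" "B \<in> pset p"
    let ?L = "\<lambda>A. Poly_Mapping.lookup (L ! jx A)"
    have "bil (pset p) e (match_vec m c A) (match_vec m c B) =
        bil (pset p) e (\<lambda>X. 0 + l A * ?L A X) (\<lambda>X. 0 + l B * ?L B X)"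
      by (rule arg_cong2[where f = "bil (pset p) e"]) (use vec[OF AB(1)] vec[OF AB(2)] in blast)+
    \<comment> \<open>Scaling is additivity with the zero vector as first summand.\<close>
    also have "\<dots> = frag_cmul (l A) (frag_cmul (l B) (bil (pset p) e (?L A) (?L B)))"
      using bil_add_left[of "pset p" e "\<lambda>_. 0" "l A" "?L A" "\<lambda>X. 0 + l B * ?L B X"]
        bil_add_right[of "pset p" e "?L A" "\<lambda>_. 0" "l B" "?L B"] unfolding z by simp
    also have "\<dots> \<in> rels"
      using vec[OF AB(1)] vec[OF AB(2)] by (blast intro: rels_cmul ann)
    finally show "bil (pset p) e (match_vec m c A) (match_vec m c B) \<in> rels" .
  qed
qed

lemma matching_imp_hyperbolic:
  assumes p: "is_pairing al tau p" and e: "rep_form p e"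
    and mat: "matching tau (pset p) (pbase p) (pproj p) m c"
    and ann: "\<And>A B. A \<in> pset p \<Longrightarrow> B \<in> pset p \<Longrightarrow>
       bil (pset p) e (match_vec m c A) (match_vec m c B) \<in> rels"
  shows "hyperbolic al tau p"
proof -
  \<comment> \<open>One vector per orbit of \<open>m\<close> is needed. Choosing from the set
    \<open>{A, m A}\<close> gives the same choice for both letters of the orbit.\<close>
  define rp where "rp A = (SOME B. B \<in> {A, m A})" for A
  have rp: "rp A \<in> {A, m A}" for A
    unfolding rp_def by (rule someI[of _ A]) simp
  have fin: "finite (pcirc p)" using p by (auto simp: is_pairing_def pcirc_def)
  note mm = matchingD[OF mat, folded pcirc_def]
  have rpm: "rp (m A) = rp A" if "A \<in> pcirc p" for A
    unfolding rp_def mm(2)[OF that] by (rule arg_cong[of _ _ "\<lambda>X. SOME B. B \<in> X"]) auto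
  obtain K where K: "set K = rp ` pcirc p" "distinct K"
    using finite_distinct_list[of "rp ` pcirc p"] fin by blast
  define v where "v A = frag_of A + frag_cmul (c A) (frag_of (m A))" for A
  define L where "L = frag_of (pbase p) # map v K"
  have KS: "A \<in> pcirc p" if "A \<in> set K" for A
    using that rp mm(1) unfolding K by (metis imageE insertE singletonD)
  have lookv: "Poly_Mapping.lookup (v A) = match_vec m c A" for A
    unfolding v_def match_vec_def lookup_match_vec[symmetric] by simp
  have "filling tau p L"
    unfolding filling_def
  proof (intro conjI ballI exI[of _ 0] allI impI)
    show "0 < length L" "L ! 0 = frag_of (pbase p)" by (auto simp: L_def)
  next
    fix j assume "j < length L" "j \<noteq> 0"
    then obtain i where i: "j = Suc i" "i < length K" by (cases j) (auto simp: L_def)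
    then have A: "K ! i \<in> pcirc p" using KS by simp
    have "short_data p (v (K ! i)) (K ! i) (m (K ! i)) (c (K ! i)) 1"
      using mm[OF A] by (auto simp: short_data_def v_def)
    then show "short tau p (L ! j)"
      using short_data_short[OF p _ A] i by (simp add: L_def)
  next
    fix A assume A: "A \<in> pcirc p"
    have key: "Poly_Mapping.lookup (v B) A \<noteq> 0 \<longleftrightarrow> B = A \<or> B = m A" if "B \<in> pcirc p" for B
      unfolding lookv using mm[OF that] mm[OF A] by (auto simp: match_vec_def unit_vec_def)
    \<comment> \<open>\<open>A\<close> occurs only in vectors of its own orbit, and \<open>K\<close>
      contains one letter of each orbit. This is the uniqueness required of a filling.\<close>
    have key2: "Poly_Mapping.lookup (v B) A \<noteq> 0 \<longleftrightarrow> B = rp A" if B: "B \<in> set K" for B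
    proof
      assume "B = rp A"
      then show "Poly_Mapping.lookup (v B) A \<noteq> 0" using key[OF KS[OF B]] rp[of A] by auto
    next
      assume "Poly_Mapping.lookup (v B) A \<noteq> 0"
      then have "B = A \<or> B = m A" using key[OF KS[OF B]] by simp
      then have "rp B = rp A" using rpm[OF A] by auto
      moreover obtain D where D: "D \<in> pcirc p" "B = rp D" using B K by auto
      have "rp D \<in> {D, m D}" by (rule rp)
      then have "rp B = B" using D rpm[OF D(1)] by auto
      ultimately show "B = rp A" by simp
    qed
    have "rp A \<in> set K" using A K by auto
    then obtain i where i: "i < length K" "K ! i = rp A" by (auto simp: in_set_conv_nth)
    show "\<exists>!i. i < length L \<and> Poly_Mapping.lookup (L ! i) A \<noteq> 0"
    proof (rule ex1I[of _ "Suc i"])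
      show "Suc i < length L \<and> Poly_Mapping.lookup (L ! Suc i) A \<noteq> 0"
        using i key2[of "rp A"] \<open>rp A \<in> set K\<close> by (simp add: L_def)
    next
      fix j assume j: "j < length L \<and> Poly_Mapping.lookup (L ! j) A \<noteq> 0"
      have "j \<noteq> 0" using j A by (auto simp: L_def pcirc_def intro!: gr0I)
      then obtain k where k: "j = Suc k" "k < length K" using j by (cases j) (auto simp: L_def)
      then have "K ! k = rp A" using j key2[of "K ! k"] by (simp add: L_def)
      then show "j = Suc i" using k i nth_eq_iff_index_eq[OF K(2) k(2) i(1)] by simp
    qed
  qed
  moreover have "annihilating al tau p L"
  proof -
    have *: "\<exists>A\<in>pset p. Poly_Mapping.lookup x = match_vec m c A" if "x \<in> set L" for x
    proof -
      have "x = frag_of (pbase p) \<or> x \<in> v ` set K"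
        using that by (simp add: L_def)
      then show ?thesis
      proof (elim disjE imageE)
        assume "x = frag_of (pbase p)"
        then have "Poly_Mapping.lookup x = match_vec m c (pbase p)"
          using matching_base[OF mat] by (simp add: match_vec_def unit_vec_def fun_eq_iff)
        then show ?thesis using p by (auto simp: is_pairing_def)
      next
        fix A assume "A \<in> set K" "x = v A"
        then show ?thesis using lookv[of A] KS[of A] by (intro bexI[of _ A]) (simp_all add: pcirc_def)
      qed
    qed
    show ?thesis
      unfolding annihilating_def p_bilinear_cls[OF e] cls_eq_one using * ann by metis
  qed
  ultimately show ?thesis by (auto simp: hyperbolic_def)
qed

end

section \<open>Contracting matchings\<close>

lemma match_vec_other: "X \<noteq> A \<Longrightarrow> X \<noteq> m A \<Longrightarrow> match_vec m c A X = 0"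
  by (simp add: match_vec_def unit_vec_def)

text \<open>View the short vectors as edges on the letters. Identifying \<open>b1\<close> with
  \<open>b2\<close> and deleting them joins the edges at \<open>b1\<close> and at \<open>b2\<close>
  into one edge between their partners. The signs multiply: sign -1 stands for an application of
  \<open>tau\<close>, the projections of \<open>b1\<close> and \<open>b2\<close> agree, and
  \<open>tau\<close> is involutive there. The new vector lifts to one old vector plus a multiple of
  the other, chosen to have equal coefficients at \<open>b1\<close> and \<open>b2\<close>.\<close>

lemma contract_step:
  assumes mat: "matching tau T s q m c"
    and b: "b1 \<in> T - {s}" "b2 \<in> T - {s}" "b1 \<noteq> b2" "q b1 = q b2"
    and tt: "\<And>A. A \<in> T - {s} \<Longrightarrow> tau (tau (q A)) = q A"
  obtains m' c' where "matching tau (T - {b1, b2}) s q m' c'"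
    "\<And>A. A \<in> T - {b1, b2} \<Longrightarrow> \<exists>B\<in>T. \<exists>k.
       (\<forall>X\<in>T - {b1, b2}. match_vec m' c' A X = match_vec m c A X + k * match_vec m c B X) \<and>
       match_vec m c A b1 + k * match_vec m c B b1 = match_vec m c A b2 + k * match_vec m c B b2"
proof -
  have mm: "m A \<in> T" "m A \<noteq> s" "m (m A) = A" "c A = -1 \<or> c A = 0 \<or> c A = 1" "c A = 0 \<longleftrightarrow> m A = A" "c (m A) = c A"
      "q (m A) = (if c A = -1 then tau (q A) else q A)" if "A \<in> T" "A \<noteq> s" for A
    using mat that unfolding matching_def by blast+
  note base = matching_base[OF mat]
  note m1 = mm[of b1] and m2 = mm[of b2]
  show ?thesis
  proof (cases "m b1 = b2")
    \<comment> \<open>The pair to be deleted is a vector by itself, and every other vector is zero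
      at both of its letters.\<close>
    case True
    then have b2: "m b2 = b1" using m1(3) b by auto
    have ne: "m A \<noteq> b1 \<and> m A \<noteq> b2" if "A \<in> T - {b1, b2}" for A
      using that mm(3)[of A] True b2 base by (cases "A = s") auto
    have "matching tau (T - {b1, b2}) s q m c"
      unfolding matching_def
    proof (intro conjI ballI)
      show "m s = s" "c s = 0" using base by auto
      fix A assume A: "A \<in> T - {b1, b2} - {s}"
      then show "m A \<in> T - {b1, b2} - {s}" "m (m A) = A" "c A \<in> {-1,0,1}" "c A = 0 \<longleftrightarrow> m A = A"
          "c (m A) = c A" "q (m A) = (if c A = -1 then tau (q A) else q A)"
        using mm[of A] ne[of A] by auto
    qed
    moreover have "match_vec m c A b1 + 0 * match_vec m c b1 b1 = match_vec m c A b2 + 0 * match_vec m c b1 b2"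
      if "A \<in> T - {b1, b2}" for A
      using that ne[of A] by (auto simp: match_vec_other)
    ultimately show ?thesis
      using that[of m c] b(1) by fastforce
  next
    case False
    then have F2: "m b2 \<noteq> b1" using m2(3) b by auto
    \<comment> \<open>If \<open>b1\<close> is alone in its vector, the partner of \<open>b2\<close>
      becomes alone. The product of the signs is then 0, as the encoding demands.\<close>
    define m' where "m' A = (if A = m b1 then (if m b2 = b2 then A else m b2)
       else if A = m b2 then (if m b1 = b1 then A else m b1) else m A)" for A
    define c' where "c' A = (if A = m b1 \<or> A = m b2 then c b1 * c b2 else c A)" for A
    have ms: "m b1 \<noteq> s" "m b2 \<noteq> s" using m1(2) m2(2) b by auto
    have mne: "m b1 \<noteq> m b2" using m1(3) m2(3) b by auto
    have ne: "m A \<noteq> b1" "m A \<noteq> b2" if "A \<in> T" "A \<noteq> m b1" "A \<noteq> m b2" for A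
      using that mm(3)[of A] base b by (cases "A = s"; auto)+
    have nm: "m A \<noteq> m b1" "m A \<noteq> m b2" if "A \<in> T" "A \<noteq> b1" "A \<noteq> b2" for A
      using that mm(3)[of A] m1(3) m2(3) base b by (cases "A = s"; auto)+
    have cc: "c b1 = 0 \<longleftrightarrow> m b1 = b1" "c b2 = 0 \<longleftrightarrow> m b2 = b2" "c (m b1) = c b1" "c (m b2) = c b2"
      "c b1 = -1 \<or> c b1 = 0 \<or> c b1 = 1" "c b2 = -1 \<or> c b2 = 0 \<or> c b2 = 1" "m (m b1) = b1" "m (m b2) = b2"
      "m b1 \<in> T" "m b2 \<in> T"
      using mm b by auto
    have "matching tau (T - {b1, b2}) s q m' c'"
      unfolding matching_def
    proof (intro conjI ballI)
      show "m' s = s" "c' s = 0" using base ms by (auto simp: m'_def c'_def)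
      fix A assume A: "A \<in> T - {b1, b2} - {s}"
      consider "A = m b1" "A \<noteq> m b2" | "A = m b2" "A \<noteq> m b1" | "A \<noteq> m b1" "A \<noteq> m b2" using mne by metis
      then have "m' A \<in> T - {b1, b2} - {s} \<and> m' (m' A) = A \<and> c' A \<in> {-1,0,1} \<and> (c' A = 0 \<longleftrightarrow> m' A = A) \<and>
          c' (m' A) = c' A \<and> q (m' A) = (if c' A = -1 then tau (q A) else q A)"
      proof cases
        case 1
        then show ?thesis
          using A mm(7)[of b1] mm(7)[of b2] b tt[of b1] tt[of b2] cc False F2 ms mne
          unfolding m'_def c'_def by (elim disjE) auto
      next
        case 2
        then show ?thesis
          using A mm(7)[of b1] mm(7)[of b2] b tt[of b1] tt[of b2] cc False F2 ms mne
          unfolding m'_def c'_def by (elim disjE) auto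
      next
        case 3
        then show ?thesis
          using A mm[of A] ne[of A] nm[of A] unfolding m'_def c'_def by auto
      qed
      then show "m' A \<in> T - {b1, b2} - {s}" "m' (m' A) = A" "c' A \<in> {-1,0,1}" "c' A = 0 \<longleftrightarrow> m' A = A"
          "c' (m' A) = c' A" "q (m' A) = (if c' A = -1 then tau (q A) else q A)"
        by blast+
    qed
    moreover have "\<exists>B\<in>T. \<exists>k.
       (\<forall>X\<in>T - {b1, b2}. match_vec m' c' A X = match_vec m c A X + k * match_vec m c B X) \<and>
       match_vec m c A b1 + k * match_vec m c B b1 = match_vec m c A b2 + k * match_vec m c B b2"
      if A: "A \<in> T - {b1, b2}" for A
    proof -
      consider "A = m b1" "A \<noteq> m b2" | "A = m b2" "A \<noteq> m b1" | "A \<noteq> m b1" "A \<noteq> m b2" using mne by metis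
      then show ?thesis
      proof cases
        \<comment> \<open>The vector of \<open>A\<close> has coefficient \<open>c b1\<close> at
          \<open>b1\<close>, and that of \<open>b2\<close> has coefficient 1 at \<open>b2\<close>;
          hence the multiplier \<open>c b1\<close>.\<close>
        case 1
        then show ?thesis
          using A b cc False F2 mne
          by (intro bexI[of _ b2] exI[of _ "c b1"]) (auto simp: m'_def c'_def match_vec_def unit_vec_def)
      next
        case 2
        then show ?thesis
          using A b cc False F2 mne
          by (intro bexI[of _ b1] exI[of _ "c b2"]) (auto simp: m'_def c'_def match_vec_def unit_vec_def)
      next
        case 3
        then show ?thesis
          using A b ne[of A]
          by (intro bexI[of _ b1] exI[of _ 0]) (auto simp: m'_def c'_def match_vec_def unit_vec_def)
      qed
    qed
    ultimately show ?thesis using that[of m' c'] by blast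
  qed
qed

text \<open>Closure under \<open>x + k * y\<close> is what contraction produces: each step adds one
  multiple of an already lifted vector. Annihilation passes to such combinations by
  bilinearity.\<close>

inductive_set zspan :: "('s \<Rightarrow> int) set \<Rightarrow> ('s \<Rightarrow> int) set" for V where
  base: "v \<in> V \<Longrightarrow> v \<in> zspan V"
| comb: "x \<in> zspan V \<Longrightarrow> y \<in> zspan V \<Longrightarrow> (\<lambda>X. x X + k * y X) \<in> zspan V"

text \<open>Iterated contraction along the pairs \<open>d b\<close>, \<open>d' b\<close>. The lifts
  for a new step are combinations of earlier lifts, and having equal coefficients at an earlier pair
  is a linear condition, so it survives.\<close>

lemma contract:
  assumes mat: "matching tau S s q m c" and D: "finite D"
    "d ` D \<subseteq> S - {s}" "d' ` D \<subseteq> S - {s}" "inj_on d D" "inj_on d' D" "d ` D \<inter> d' ` D = {}"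
    "\<And>b. b \<in> D \<Longrightarrow> q (d b) = q (d' b)"
    and tt: "\<And>A. A \<in> S - {s} \<Longrightarrow> tau (tau (q A)) = q A"
  shows "\<exists>m' c'. matching tau (S - d ` D - d' ` D) s q m' c' \<and>
    (\<forall>A\<in>S - d ` D - d' ` D. \<exists>x\<in>zspan (match_vec m c ` S).
       (\<forall>X\<in>S - d ` D - d' ` D. x X = match_vec m' c' A X) \<and> (\<forall>b\<in>D. x (d b) = x (d' b)))"
  using D
proof (induction D rule: finite_induct)
  case empty
  have "\<forall>A\<in>S. \<exists>x\<in>zspan (match_vec m c ` S). \<forall>X\<in>S. x X = match_vec m c A X"
    by (blast intro: zspan.base)
  then show ?case using mat by auto
next
  case (insert b D)
  let ?T = "S - d ` D - d' ` D" and ?T' = "S - d ` insert b D - d' ` insert b D"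
  obtain m1 c1 where 1: "matching tau ?T s q m1 c1"
    "\<And>A. A \<in> ?T \<Longrightarrow> \<exists>x\<in>zspan (match_vec m c ` S). (\<forall>X\<in>?T. x X = match_vec m1 c1 A X) \<and> (\<forall>b\<in>D. x (d b) = x (d' b))"
    using insert by auto
  have T': "?T' = ?T - {d b, d' b}" by auto
  have b: "d b \<in> ?T - {s}" "d' b \<in> ?T - {s}" "d b \<noteq> d' b" "q (d b) = q (d' b)"
    using insert by (auto simp: inj_on_def)
  obtain m2 c2 where 2: "matching tau ?T' s q m2 c2"
    "\<And>A. A \<in> ?T' \<Longrightarrow> \<exists>B\<in>?T. \<exists>k.
       (\<forall>X\<in>?T'. match_vec m2 c2 A X = match_vec m1 c1 A X + k * match_vec m1 c1 B X) \<and>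
       match_vec m1 c1 A (d b) + k * match_vec m1 c1 B (d b) = match_vec m1 c1 A (d' b) + k * match_vec m1 c1 B (d' b)"
    using contract_step[OF 1(1) b] tt unfolding T' by (metis (no_types, lifting) DiffD1 DiffD2 DiffI)
  show ?case
  proof (intro exI conjI ballI)
    show "matching tau ?T' s q m2 c2" by (rule 2)
    fix A assume A: "A \<in> ?T'"
    obtain B k where Bk: "B \<in> ?T" "\<forall>X\<in>?T'. match_vec m2 c2 A X = match_vec m1 c1 A X + k * match_vec m1 c1 B X"
       "match_vec m1 c1 A (d b) + k * match_vec m1 c1 B (d b) = match_vec m1 c1 A (d' b) + k * match_vec m1 c1 B (d' b)"
      using 2(2)[OF A] by blast
    obtain x where x: "x \<in> zspan (match_vec m c ` S)" "\<forall>X\<in>?T. x X = match_vec m1 c1 A X" "\<forall>b\<in>D. x (d b) = x (d' b)"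
      using 1(2)[of A] A T' by blast
    obtain y where y: "y \<in> zspan (match_vec m c ` S)" "\<forall>X\<in>?T. y X = match_vec m1 c1 B X" "\<forall>b\<in>D. y (d b) = y (d' b)"
      using 1(2)[OF Bk(1)] by blast
    show "\<exists>x\<in>zspan (match_vec m c ` S). (\<forall>X\<in>?T'. x X = match_vec m2 c2 A X) \<and> (\<forall>b\<in>insert b D. x (d b) = x (d' b))"
    proof (intro bexI[of _ "\<lambda>X. x X + k * y X"] conjI ballI)
      show "(\<lambda>X. x X + k * y X) \<in> zspan (match_vec m c ` S)" using x y by (blast intro: zspan.comb)
      show "x X + k * y X = match_vec m2 c2 A X" if "X \<in> ?T'" for X
        using that x(2) y(2) Bk(2) T' by auto
      show "x (d a) + k * y (d a) = x (d' a) + k * y (d' a)" if "a \<in> insert b D" for a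
        using that x(2,3) y(2,3) Bk(3) b by auto
    qed
  qed
qed

context inv_set
begin

lemma bil_zspan:
  assumes "\<And>v w. v \<in> V \<Longrightarrow> w \<in> V \<Longrightarrow> bil S e v w \<in> rels" "x \<in> zspan V" "y \<in> zspan V"
  shows "bil S e x y \<in> rels"
  using assms(2)
proof induction
  case (base v)
  show ?case using assms(3)
    by induction (auto simp: bil_add_right assms(1) base intro!: rels_add rels_cmul)
qed (auto simp: bil_add_left intro!: rels_add rels_cmul)

end

lemma bil_reindex:
  assumes "bij_betw g S S'"
  shows "bil S' e x y = bil S (\<lambda>A B. e (g A) (g B)) (\<lambda>A. x (g A)) (\<lambda>A. y (g A))"
  unfolding bil_def by (simp add: sum.reindex_bij_betw[OF assms, symmetric])

lemma bil_restrict: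
  assumes "finite S" "S' \<subseteq> S" "\<And>A B. A \<in> S \<Longrightarrow> B \<in> S \<Longrightarrow> A \<notin> S' \<or> B \<notin> S' \<Longrightarrow> e A B = 0"
  shows "bil S e x y = bil S' e x y"
proof -
  have "bil S e x y = (\<Sum>A\<in>S'. \<Sum>B\<in>S. frag_cmul (x A * y B) (e A B))"
    unfolding bil_def using assms by (intro sum.mono_neutral_right) (auto intro!: sum.neutral)
  also have "\<dots> = bil S' e x y"
    unfolding bil_def using assms by (intro sum.cong sum.mono_neutral_right) auto
  finally show ?thesis .
qed

lemma matching_transfer:
  assumes g: "bij_betw g S S'" "s \<in> S" "g s = s'" "\<And>A. A \<in> S - {s} \<Longrightarrow> q' (g A) = q A"
    and mat: "matching tau S' s' q' m c"
  obtains m0 c0 where "matching tau S s q m0 c0"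
    "\<And>A X. A \<in> S \<Longrightarrow> X \<in> S \<Longrightarrow> match_vec m0 c0 A X = match_vec m c (g A) (g X)"
proof -
  define h where "h = inv_into S g"
  define m0 where "m0 A = h (m (g A))" for A
  define c0 where "c0 A = c (g A)" for A
  have gS: "g A \<in> S'" if "A \<in> S" for A using g(1) that by (auto simp: bij_betw_def)
  have hg: "h (g A) = A" if "A \<in> S" for A
    using g(1) that by (auto simp: h_def bij_betw_def)
  have gh: "g (h X) = X" "h X \<in> S" if "X \<in> S'" for X
    using g(1) that unfolding h_def by (auto simp: bij_betw_def f_inv_into_f inv_into_into)
  have gne: "g A \<in> S' - {s'}" if "A \<in> S - {s}" for A
    using that gS[of A] hg[of A] hg[OF g(2)] g(3) by auto
  have mS: "m X \<in> S'" if "X \<in> S'" for X using matching_closed[OF mat that] .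
  have gm: "g (m0 A) = m (g A)" if "A \<in> S" for A
    unfolding m0_def using gh mS gS that by blast
  note mm = matchingD[OF mat]
  have "matching tau S s q m0 c0"
    unfolding matching_def
  proof (intro conjI ballI)
    show "m0 s = s" "c0 s = 0"
      using matching_base[OF mat] hg[OF g(2)] g(3) by (auto simp: m0_def c0_def)
    fix A assume A: "A \<in> S - {s}"
    note mA = mm[OF gne[OF A]]
    show m0: "m0 A \<in> S - {s}"
      using mA(1) gm[of A] A gh(2)[of "m (g A)"] g(3) unfolding m0_def by auto
    show "m0 (m0 A) = A"
      using mA(2) gm[of A] A hg by (auto simp: m0_def)
    show "c0 A \<in> {-1, 0, 1}" using mA(3) by (simp add: c0_def)
    show "c0 (m0 A) = c0 A" using mA(5) gm[of A] A by (simp add: c0_def)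
    show "c0 A = 0 \<longleftrightarrow> m0 A = A"
      using mA(4) gm[of A] A hg[of A] m0 hg[of "m0 A"] by (auto simp: c0_def)
    have "q (m0 A) = q' (m (g A))" using g(4)[OF m0] gm[of A] A by simp
    then show "q (m0 A) = (if c0 A = -1 then tau (q A) else q A)"
      using mA(6) g(4)[OF A] by (simp add: c0_def)
  qed
  moreover have "match_vec m0 c0 A X = match_vec m c (g A) (g X)" if "A \<in> S" "X \<in> S" for A X
  proof -
    have "X = A \<longleftrightarrow> g X = g A" using g(1) that by (auto simp: bij_betw_def inj_on_def)
    moreover have "X = m0 A \<longleftrightarrow> g X = m (g A)"
      using that gm[of A] hg[of X] gh mS gS by (auto simp: m0_def)
    ultimately show ?thesis by (simp add: match_vec_def unit_vec_def c0_def)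
  qed
  ultimately show ?thesis using that by blast
qed

section \<open>Sums and cobordism of pairings\<close>

definition p_iso :: "('s \<Rightarrow> 't) \<Rightarrow> ('s, 'a) pairing \<Rightarrow> ('t, 'a) pairing \<Rightarrow> bool" where
  "p_iso f p q \<longleftrightarrow> bij_betw f (pset p) (pset q) \<and> f (pbase p) = pbase q \<and>
     (\<forall>A\<in>pcirc p. pproj q (f A) = pproj p A) \<and>
     (\<forall>A\<in>pset p. \<forall>B\<in>pset p. pform q (f A) (f B) = pform p A B)"

definition p_inl :: "('s, 'a) pairing \<Rightarrow> 's \<Rightarrow> ('s + 't) option" where
  "p_inl p A = (if A = pbase p then None else Some (Inl A))"

definition p_inr :: "('t, 'a) pairing \<Rightarrow> 't \<Rightarrow> ('s + 't) option" where
  "p_inr p A = (if A = pbase p then None else Some (Inr A))"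

text \<open>Replaces the case distinction in the form of a sum: that form is the sum of two forms,
  each extended by zero to the letters of the other summand, which are sent to \<open>None\<close>.
  The common base element belongs to both summands.\<close>

definition sum_left :: "('s, 'a) pairing \<Rightarrow> ('s + 't) option \<Rightarrow> 's option" where
  "sum_left p X = (case X of None \<Rightarrow> Some (pbase p) | Some (Inl A) \<Rightarrow> Some A | Some (Inr B) \<Rightarrow> None)"

definition sum_right :: "('t, 'a) pairing \<Rightarrow> ('s + 't) option \<Rightarrow> 't option" where
  "sum_right p X = (case X of None \<Rightarrow> Some (pbase p) | Some (Inl A) \<Rightarrow> None | Some (Inr B) \<Rightarrow> Some B)"

definition ext_form :: "('s \<Rightarrow> 's \<Rightarrow> 'a \<Rightarrow>\<^sub>0 int) \<Rightarrow> 's option \<Rightarrow> 's option \<Rightarrow> 'a \<Rightarrow>\<^sub>0 int" where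
  "ext_form e X Y = (case (X, Y) of (Some A, Some B) \<Rightarrow> e A B | _ \<Rightarrow> 0)"

definition sum_form ::
  "('s, 'a) pairing \<Rightarrow> ('t, 'a) pairing \<Rightarrow> ('s \<Rightarrow> 's \<Rightarrow> 'b \<Rightarrow>\<^sub>0 int) \<Rightarrow> ('t \<Rightarrow> 't \<Rightarrow> 'b \<Rightarrow>\<^sub>0 int) \<Rightarrow>
   ('s + 't) option \<Rightarrow> ('s + 't) option \<Rightarrow> 'b \<Rightarrow>\<^sub>0 int" where
  "sum_form p q e e' X Y = ext_form e (sum_left p X) (sum_left p Y) + ext_form e' (sum_right q X) (sum_right q Y)"

lemma p_sum_sel [simp]:
  "pset (p_sum al tau p q) = insert None (Some ` (Inl ` pcirc p \<union> Inr ` pcirc q))"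
  "pbase (p_sum al tau p q) = None"
  "pproj (p_sum al tau p q) (Some (Inl A)) = pproj p A"
  "pproj (p_sum al tau p q) (Some (Inr B)) = pproj q B"
  "pcirc (p_sum al tau p q) = Some ` (Inl ` pcirc p \<union> Inr ` pcirc q)"
  by (auto simp: p_sum_def pcirc_def)

lemma p_sum_cases [consumes 1, case_names None Inl Inr]:
  assumes "X \<in> pset (p_sum al tau p q)"
  obtains "X = None" | A where "A \<in> pcirc p" "X = Some (Inl A)" | B where "B \<in> pcirc q" "X = Some (Inr B)"
  using assms unfolding p_sum_sel by blast

lemma p_opposite_sel [simp]:
  "pset (p_opposite al tau p) = pset p" "pbase (p_opposite al tau p) = pbase p"
  "pproj (p_opposite al tau p) = pproj p" "pcirc (p_opposite al tau p) = pcirc p"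
  "pform (p_opposite al tau p) A B = inv\<^bsub>pi_group al tau\<^esub> pform p A B"
  by (auto simp: p_opposite_def pcirc_def)

lemma pcirc_subset: "A \<in> pcirc p \<Longrightarrow> A \<in> pset p" "A \<in> pcirc p \<Longrightarrow> A \<noteq> pbase p"
  by (auto simp: pcirc_def)

text \<open>A vector on the sum is determined by its two restrictions, which share the coefficient
  of the base element. Calculations in sums of several pairings are reduced to the summands in this
  way.\<close>

lemma bil_sum_form:
  assumes "finite (pset p)" "finite (pset q)" "pbase p \<in> pset p" "pbase q \<in> pset q"
  shows "bil (pset (p_sum al tau p q)) (sum_form p q e e') x y =
    bil (pset p) e (\<lambda>A. x (p_inl p A)) (\<lambda>A. y (p_inl p A)) +
    bil (pset q) e' (\<lambda>A. x (p_inr q A)) (\<lambda>A. y (p_inr q A))"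
proof -
  let ?S = "pset (p_sum al tau p q)"
  have fin: "finite ?S" using assms by (auto simp: pcirc_def)
  have "bil ?S (\<lambda>X Y. ext_form e (sum_left p X) (sum_left p Y)) x y =
      bil (p_inl p ` pset p) (\<lambda>X Y. ext_form e (sum_left p X) (sum_left p Y)) x y"
    using assms by (intro bil_restrict fin)
      (auto simp: pcirc_def p_inl_def ext_form_def sum_left_def image_iff split: option.splits)
  also have "\<dots> = bil (pset p) e (\<lambda>A. x (p_inl p A)) (\<lambda>A. y (p_inl p A))"
    by (subst bil_reindex[of "p_inl p" "pset p"])
      (auto simp: bij_betw_def inj_on_def p_inl_def ext_form_def sum_left_def intro!: bil_cong)
  finally have 1: "bil ?S (\<lambda>X Y. ext_form e (sum_left p X) (sum_left p Y)) x y = \<dots>" .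
  have "bil ?S (\<lambda>X Y. ext_form e' (sum_right q X) (sum_right q Y)) x y =
      bil (p_inr q ` pset q) (\<lambda>X Y. ext_form e' (sum_right q X) (sum_right q Y)) x y"
    using assms by (intro bil_restrict fin)
      (auto simp: pcirc_def p_inr_def ext_form_def sum_right_def image_iff split: option.splits)
  also have "\<dots> = bil (pset q) e' (\<lambda>A. x (p_inr q A)) (\<lambda>A. y (p_inr q A))"
    by (subst bil_reindex[of "p_inr q" "pset q"])
      (auto simp: bij_betw_def inj_on_def p_inr_def ext_form_def sum_right_def intro!: bil_cong)
  finally have 2: "bil ?S (\<lambda>X Y. ext_form e' (sum_right q X) (sum_right q Y)) x y = \<dots>" .
  have "bil ?S (sum_form p q e e') x y =
      bil ?S (\<lambda>X Y. ext_form e (sum_left p X) (sum_left p Y) + ext_form e' (sum_right q X) (sum_right q Y)) x y"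
    by (rule bil_cong) (auto simp: sum_form_def)
  then show ?thesis unfolding bil_add_form 1 2 .
qed

lemma p_iso_inverse:
  assumes "p_iso f p q" "pbase p \<in> pset p"
  shows "p_iso (inv_into (pset p) f) q p"
proof -
  let ?h = "inv_into (pset p) f"
  have f: "bij_betw f (pset p) (pset q)" "f (pbase p) = pbase q"
    using assms by (auto simp: p_iso_def)
  have h: "f (?h X) = X" "?h X \<in> pset p" if "X \<in> pset q" for X
    using f that by (auto simp: bij_betw_def f_inv_into_f inv_into_into)
  have hf: "?h (f A) = A" if "A \<in> pset p" for A
    using f that by (auto simp: bij_betw_def)
  have hb: "?h (pbase q) = pbase p" using hf[OF assms(2)] f by simp
  show ?thesis
    unfolding p_iso_def
  proof (intro conjI ballI)
    show "bij_betw ?h (pset q) (pset p)" by (rule bij_betw_inv_into[OF f(1)])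
    show "?h (pbase q) = pbase p" by (rule hb)
    show "pproj p (?h X) = pproj q X" if "X \<in> pcirc q" for X
    proof -
      have "?h X \<in> pcirc p" using h[of X] that f(2) by (auto simp: pcirc_def)
      then show ?thesis using assms(1) h(1)[of X] that unfolding p_iso_def by (metis pcirc_subset(1))
    qed
    show "pform p (?h X) (?h Y) = pform q X Y" if "X \<in> pset q" "Y \<in> pset q" for X Y
      using assms(1) h that unfolding p_iso_def by metis
  qed
qed

context inv_set
begin

abbreviation "Opp \<equiv> p_opposite al tau"
abbreviation psum (infixl \<open>\<oplus>\<^sub>p\<close> 65) where "psum \<equiv> p_sum al tau"
abbreviation pcob (infix \<open>\<sim>\<^sub>p\<close> 50) where "pcob \<equiv> p_cobordant al tau"
abbreviation "pairing \<equiv> is_pairing al tau"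

lemma pairingD:
  assumes "pairing p"
  shows "finite (pset p)" "pbase p \<in> pset p" "A \<in> pcirc p \<Longrightarrow> pproj p A \<in> al"
    "A \<in> pset p \<Longrightarrow> B \<in> pset p \<Longrightarrow> pform p A B \<in> carrier PI"
  using assms by (auto simp: is_pairing_def)

lemma Inv_cls_carrier: "x \<in> carrier PI \<Longrightarrow> inv\<^bsub>PI\<^esub> x \<in> carrier PI"
  by (rule group.inv_closed[OF group_PI])

lemma pairing_opposite: "pairing p \<Longrightarrow> pairing (Opp p)"
  by (auto simp: is_pairing_def Inv_cls_carrier)

lemma rep_form_opposite: "rep_form p e \<Longrightarrow> rep_form (Opp p) (\<lambda>A B. - e A B)"
  by (simp add: rep_form_def inv_cls frags_closed)

lemma rep_form_sum:
  assumes "pairing p" "pairing q" "rep_form p e" "rep_form q e'"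
  shows "rep_form (p \<oplus>\<^sub>p q) (sum_form p q e e')"
  using assms pairingD(2)[of p] pairingD(2)[of q]
  by (auto simp: rep_form_def sum_form_def ext_form_def sum_left_def sum_right_def one_PI mult_cls frags_closed
      p_sum_def pcirc_def)

lemma rep_form_pairing:
  "\<lbrakk>finite (pset p); pbase p \<in> pset p; pproj p ` pcirc p \<subseteq> al; rep_form p e\<rbrakk> \<Longrightarrow> pairing p"
  by (auto simp: is_pairing_def rep_form_def cls_closed)

lemma pairing_sum: "pairing p \<Longrightarrow> pairing q \<Longrightarrow> pairing (p \<oplus>\<^sub>p q)"
proof -
  assume p: "pairing p" "pairing q"
  obtain e e' where e: "rep_form p e" "rep_form q e'"
    using p rep_form_exists by metis
  show ?thesis
    by (rule rep_form_pairing[OF _ _ _ rep_form_sum[OF p e]])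
      (use p pairingD(3)[of p] pairingD(3)[of q] in \<open>auto simp: is_pairing_def pcirc_def\<close>)
qed

section \<open>Hyperbolicity under isomorphism, opposite and sum\<close>

lemma hyperbolic_iso:
  assumes pq: "pairing p" "pairing q" and f: "p_iso f p q" and hyp: "hyperbolic al tau q"
  shows "hyperbolic al tau p"
proof -
  obtain e where e: "rep_form q e" using rep_form_exists[OF pq(2)] .
  obtain m c where mc: "matching tau (pset q) (pbase q) (pproj q) m c"
    "\<And>A B. A \<in> pset q \<Longrightarrow> B \<in> pset q \<Longrightarrow> bil (pset q) e (match_vec m c A) (match_vec m c B) \<in> rels"
    using hyperbolic_imp_matching[OF pq(2) e hyp] by blast
  have f': "bij_betw f (pset p) (pset q)" "f (pbase p) = pbase q"
      "\<And>A. A \<in> pset p - {pbase p} \<Longrightarrow> pproj q (f A) = pproj p A"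
    using f by (auto simp: p_iso_def pcirc_def)
  obtain m0 c0 where m0: "matching tau (pset p) (pbase p) (pproj p) m0 c0"
    "\<And>A X. A \<in> pset p \<Longrightarrow> X \<in> pset p \<Longrightarrow> match_vec m0 c0 A X = match_vec m c (f A) (f X)"
    using matching_transfer[OF f'(1) pairingD(2)[OF pq(1)] f'(2,3) mc(1)] by blast
  have fin: "f A \<in> pset q" if "A \<in> pset p" for A using f'(1) that by (auto simp: bij_betw_def)
  have e': "rep_form p (\<lambda>A B. e (f A) (f B))"
    using e f fin unfolding rep_form_def p_iso_def by metis
  show ?thesis
  proof (rule matching_imp_hyperbolic[OF pq(1) e' m0(1)])
    fix A B assume AB: "A \<in> pset p" "B \<in> pset p"
    have "bil (pset p) (\<lambda>A B. e (f A) (f B)) (match_vec m0 c0 A) (match_vec m0 c0 B) =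
        bil (pset q) e (match_vec m c (f A)) (match_vec m c (f B))"
      unfolding bil_reindex[OF f'(1)] using m0(2) AB by (intro bil_cong) auto
    then show "bil (pset p) (\<lambda>A B. e (f A) (f B)) (match_vec m0 c0 A) (match_vec m0 c0 B) \<in> rels"
      using mc(2) fin AB by simp
  qed
qed

lemma hyperbolic_opposite:
  assumes p: "pairing p" and hyp: "hyperbolic al tau p"
  shows "hyperbolic al tau (Opp p)"
proof -
  obtain e where e: "rep_form p e" using rep_form_exists[OF p] .
  obtain m c where mc: "matching tau (pset p) (pbase p) (pproj p) m c"
    "\<And>A B. A \<in> pset p \<Longrightarrow> B \<in> pset p \<Longrightarrow> bil (pset p) e (match_vec m c A) (match_vec m c B) \<in> rels"
    using hyperbolic_imp_matching[OF p e hyp] by blast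
  show ?thesis
    by (rule matching_imp_hyperbolic[OF pairing_opposite[OF p] rep_form_opposite[OF e], of m c])
      (use mc in \<open>auto simp: bil_minus_form rels_uminus\<close>)
qed

text \<open>The union of the two fillings, with the base vectors identified. Restricted to one
  summand, each of its vectors is zero or a vector of the filling of that summand, and the form is
  the sum of its values on the two restrictions.\<close>

lemma hyperbolic_sum:
  assumes pq: "pairing p" "pairing q" and hyp: "hyperbolic al tau p" "hyperbolic al tau q"
  shows "hyperbolic al tau (p \<oplus>\<^sub>p q)"
proof -
  obtain e e' where e: "rep_form p e" "rep_form q e'"
    using pq rep_form_exists by metis
  obtain m c where mc: "matching tau (pset p) (pbase p) (pproj p) m c"
    "\<And>A B. A \<in> pset p \<Longrightarrow> B \<in> pset p \<Longrightarrow> bil (pset p) e (match_vec m c A) (match_vec m c B) \<in> rels"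
    using hyperbolic_imp_matching[OF pq(1) e(1) hyp(1)] by blast
  obtain m' c' where mc': "matching tau (pset q) (pbase q) (pproj q) m' c'"
    "\<And>A B. A \<in> pset q \<Longrightarrow> B \<in> pset q \<Longrightarrow> bil (pset q) e' (match_vec m' c' A) (match_vec m' c' B) \<in> rels"
    using hyperbolic_imp_matching[OF pq(2) e(2) hyp(2)] by blast
  define M where "M X = (case X of None \<Rightarrow> None | Some (Inl A) \<Rightarrow> Some (Inl (m A)) | Some (Inr B) \<Rightarrow> Some (Inr (m' B)))" for X
  define C where "C X = (case X of None \<Rightarrow> 0 | Some (Inl A) \<Rightarrow> c A | Some (Inr B) \<Rightarrow> c' B)" for X
  note simps = M_def C_def p_inl_def p_inr_def match_vec_def unit_vec_def
  note mm = matchingD[OF mc(1), folded pcirc_def] and mm' = matchingD[OF mc'(1), folded pcirc_def]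
  have mat: "matching tau (pset (p \<oplus>\<^sub>p q)) (pbase (p \<oplus>\<^sub>p q)) (pproj (p \<oplus>\<^sub>p q)) M C"
  proof (rule matchingI)
    show "M (pbase (p \<oplus>\<^sub>p q)) = pbase (p \<oplus>\<^sub>p q)" "C (pbase (p \<oplus>\<^sub>p q)) = 0" by (simp_all add: M_def C_def)
    fix X assume "X \<in> pset (p \<oplus>\<^sub>p q) - {pbase (p \<oplus>\<^sub>p q)}"
    then consider A where "A \<in> pcirc p" "X = Some (Inl A)" | A where "A \<in> pcirc q" "X = Some (Inr A)" by auto
    then show "M X \<in> pset (p \<oplus>\<^sub>p q) - {pbase (p \<oplus>\<^sub>p q)} \<and> M (M X) = X \<and> C X \<in> {-1,0,1} \<and> (C X = 0 \<longleftrightarrow> M X = X)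
       \<and> C (M X) = C X \<and> pproj (p \<oplus>\<^sub>p q) (M X) = (if C X = -1 then tau (pproj (p \<oplus>\<^sub>p q) X) else pproj (p \<oplus>\<^sub>p q) X)"
    proof cases
      case 1 then show ?thesis using mm[OF 1(1)] by (simp add: M_def C_def)
    next
      case 2 then show ?thesis using mm'[OF 2(1)] by (simp add: M_def C_def)
    qed
  qed
  have vl: "(\<forall>A\<in>pset p. match_vec M C X (p_inl p A) = 0) \<or>
      (\<exists>B\<in>pset p. \<forall>A\<in>pset p. match_vec M C X (p_inl p A) = match_vec m c B A)" if X: "X \<in> pset (p \<oplus>\<^sub>p q)" for X
  proof -
    consider "X = None" | B where "B \<in> pcirc p" "X = Some (Inl B)" | B where "B \<in> pcirc q" "X = Some (Inr B)"
      using p_sum_cases[OF X] by metis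
    then show ?thesis
    proof cases
      case 1
      then have "\<forall>A\<in>pset p. match_vec M C X (p_inl p A) = match_vec m c (pbase p) A"
        using matching_base[OF mc(1)] by (auto simp: simps)
      then show ?thesis by (intro disjI2 bexI[of _ "pbase p"] pairingD(2)[OF pq(1)])
    next
      case 2
      then have "\<forall>A\<in>pset p. match_vec M C X (p_inl p A) = match_vec m c B A"
        using mm(1)[of B] pcirc_subset(2)[of B p] pcirc_subset(2)[of "m B" p] by (auto simp: simps)
      then show ?thesis by (intro disjI2 bexI[of _ B] pcirc_subset(1)[OF 2(1)])
    qed (auto simp: simps)
  qed
  have vr: "(\<forall>A\<in>pset q. match_vec M C X (p_inr q A) = 0) \<or>
      (\<exists>B\<in>pset q. \<forall>A\<in>pset q. match_vec M C X (p_inr q A) = match_vec m' c' B A)" if X: "X \<in> pset (p \<oplus>\<^sub>p q)" for X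
  proof -
    consider "X = None" | B where "B \<in> pcirc p" "X = Some (Inl B)" | B where "B \<in> pcirc q" "X = Some (Inr B)"
      using p_sum_cases[OF X] by metis
    then show ?thesis
    proof cases
      case 1
      then have "\<forall>A\<in>pset q. match_vec M C X (p_inr q A) = match_vec m' c' (pbase q) A"
        using matching_base[OF mc'(1)] by (auto simp: simps)
      then show ?thesis by (intro disjI2 bexI[of _ "pbase q"] pairingD(2)[OF pq(2)])
    next
      case 3
      then have "\<forall>A\<in>pset q. match_vec M C X (p_inr q A) = match_vec m' c' B A"
        using mm'(1)[of B] pcirc_subset(2)[of B q] pcirc_subset(2)[of "m' B" q] by (auto simp: simps)
      then show ?thesis by (intro disjI2 bexI[of _ B] pcirc_subset(1)[OF 3(1)])
    qed (auto simp: simps)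
  qed
  have z: "bil S e x y \<in> rels"
    if h: "(\<forall>A\<in>S. x A = 0) \<or> (\<exists>B\<in>S. \<forall>A\<in>S. x A = v B A)" "(\<forall>A\<in>S. y A = 0) \<or> (\<exists>B\<in>S. \<forall>A\<in>S. y A = v B A)"
       "\<And>A B. A \<in> S \<Longrightarrow> B \<in> S \<Longrightarrow> bil S e (v A) (v B) \<in> rels" for S :: "'z set" and e x y v
  proof -
    have zz: "bil S e x y = 0" if "(\<forall>A\<in>S. x A = 0) \<or> (\<forall>A\<in>S. y A = 0)"
      unfolding bil_def using that by (intro sum.neutral ballI) auto
    show ?thesis
    proof (cases "(\<forall>A\<in>S. x A = 0) \<or> (\<forall>A\<in>S. y A = 0)")
      case True
      then show ?thesis using zz rels_zero by simp
    next
      case False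
      then obtain B B' where B: "B \<in> S" "\<forall>A\<in>S. x A = v B A" "B' \<in> S" "\<forall>A\<in>S. y A = v B' A"
        using h(1,2) by blast
      then have "bil S e x y = bil S e (v B) (v B')" by (intro bil_cong) auto
      then show ?thesis using h(3) B by simp
    qed
  qed
  show ?thesis
  proof (rule matching_imp_hyperbolic[OF pairing_sum[OF pq] rep_form_sum[OF pq e] mat])
    fix X Y assume XY: "X \<in> pset (p \<oplus>\<^sub>p q)" "Y \<in> pset (p \<oplus>\<^sub>p q)"
    show "bil (pset (p \<oplus>\<^sub>p q)) (sum_form p q e e') (match_vec M C X) (match_vec M C Y) \<in> rels"
      unfolding bil_sum_form[OF pairingD(1)[OF pq(1)] pairingD(1)[OF pq(2)] pairingD(2)[OF pq(1)] pairingD(2)[OF pq(2)]]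
      by (intro rels_add z[OF vl[OF XY(1)] vl[OF XY(2)] mc(2)] z[OF vr[OF XY(1)] vr[OF XY(2)] mc'(2)])
  qed
qed

section \<open>Cobordism as an equivalence relation compatible with sums\<close>

lemma cob_iso:
  assumes pq: "pairing p" "pairing q" and f: "p_iso f p q"
  shows "p \<sim>\<^sub>p q"
proof -
  obtain e where e: "rep_form q e" using rep_form_exists[OF pq(2)] .
  have fin: "f A \<in> pset q" if "A \<in> pset p" for A using f that by (auto simp: p_iso_def bij_betw_def)
  \<comment> \<open>The representatives for \<open>p\<close> are pulled back from \<open>q\<close>,
    so that the two forms cancel exactly and not only modulo the relators.\<close>
  have e': "rep_form p (\<lambda>A B. e (f A) (f B))"
    using e f fin unfolding rep_form_def p_iso_def by metis
  have fbij: "bij_betw f (pset p) (pset q)" and fb: "f (pbase p) = pbase q" using f by (auto simp: p_iso_def)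
  then have inj: "inj_on f (pset p)" by (auto simp: bij_betw_def)
  have fc: "f A \<in> pcirc q" if "A \<in> pcirc p" for A
    using f that fin[of A] inj pairingD(2)[OF pq(1)] unfolding p_iso_def pcirc_def inj_on_def by fastforce
  let ?g = "inv_into (pset p) f"
  have g: "p_iso ?g q p" by (rule p_iso_inverse[OF f pairingD(2)[OF pq(1)]])
  then have gb: "?g (pbase q) = pbase p" "\<And>B. B \<in> pset q \<Longrightarrow> ?g B \<in> pset p"
    by (auto simp: p_iso_def bij_betw_def)
  have gf: "?g (f A) = A" if "A \<in> pset p" for A using inj that by simp
  have fg: "f (?g B) = B" if "B \<in> pset q" for B using fbij that by (simp add: bij_betw_inv_into_right)
  have gc: "?g B \<in> pcirc p" if "B \<in> pcirc q" for B
    using gb(2)[of B] fg[of B] that fb by (auto simp: pcirc_def)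
  \<comment> \<open>Each letter is matched with its image, so the filling consists of
    \<open>s\<close> and the diagonal vectors \<open>A + f A\<close>. Their restrictions to the two
    summands agree, and the second form is the negative of the first.\<close>
  define M where "M X = (case X of None \<Rightarrow> None | Some (Inl A) \<Rightarrow> Some (Inr (f A)) | Some (Inr B) \<Rightarrow> Some (Inl (?g B)))" for X
  define C where "C X = (if X = None then 0 else 1 :: int)" for X :: "('b + 'c) option"
  let ?P = "p \<oplus>\<^sub>p Opp q"
  have P: "pairing ?P" by (intro pairing_sum pairing_opposite pq)
  have mat: "matching tau (pset ?P) (pbase ?P) (pproj ?P) M C"
  proof (rule matchingI)
    show "M (pbase ?P) = pbase ?P" "C (pbase ?P) = 0" by (simp_all add: M_def C_def)
    fix X assume "X \<in> pset ?P - {pbase ?P}"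
    then consider A where "A \<in> pcirc p" "X = Some (Inl A)" | A where "A \<in> pcirc q" "X = Some (Inr A)" by auto
    then show "M X \<in> pset ?P - {pbase ?P} \<and> M (M X) = X \<and> C X \<in> {-1,0,1} \<and> (C X = 0 \<longleftrightarrow> M X = X)
       \<and> C (M X) = C X \<and> pproj ?P (M X) = (if C X = -1 then tau (pproj ?P X) else pproj ?P X)"
    proof cases
      case 1 then show ?thesis using fc f gf[of A] by (auto simp: M_def C_def p_iso_def pcirc_subset)
    next
      case 2 then show ?thesis using gc g fg[of A] by (auto simp: M_def C_def p_iso_def pcirc_subset)
    qed
  qed
  have sym: "match_vec M C X (p_inr (Opp q) (f A)) = match_vec M C X (p_inl p A)"
    if X: "X \<in> pset ?P" and that: "A \<in> pset p" for X A
  proof -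
    consider "X = None" | B where "B \<in> pcirc p" "X = Some (Inl B)" | B where "B \<in> pcirc q" "X = Some (Inr B)"
      using p_sum_cases[OF X] by (metis p_opposite_sel(4))
    then show ?thesis
    proof cases
      case 1
      then show ?thesis using that gf[of A] gb fb by (auto simp: M_def C_def p_inl_def p_inr_def match_vec_def unit_vec_def)
    next
      case 2
      then show ?thesis using that gf[of A] gf[of B] gb fb pcirc_subset[of B p]
        by (auto simp: M_def C_def p_inl_def p_inr_def match_vec_def unit_vec_def)
    next
      case 3
      then show ?thesis using that gf[of A] fg[of B] gb fb pcirc_subset[of B q]
        by (auto simp: M_def C_def p_inl_def p_inr_def match_vec_def unit_vec_def)
    qed
  qed
  show ?thesis
    unfolding p_cobordant_def
  proof (rule matching_imp_hyperbolic[OF P rep_form_sum[OF pq(1) pairing_opposite[OF pq(2)] e' rep_form_opposite[OF e]] mat])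
    fix X Y assume XY: "X \<in> pset ?P" "Y \<in> pset ?P"
    have "bil (pset ?P) (sum_form p (Opp q) (\<lambda>A B. e (f A) (f B)) (\<lambda>A B. - e A B)) (match_vec M C X) (match_vec M C Y) =
      bil (pset p) (\<lambda>A B. e (f A) (f B)) (\<lambda>A. match_vec M C X (p_inl p A)) (\<lambda>A. match_vec M C Y (p_inl p A)) -
      bil (pset p) (\<lambda>A B. e (f A) (f B)) (\<lambda>A. match_vec M C X (p_inr (Opp q) (f A))) (\<lambda>A. match_vec M C Y (p_inr (Opp q) (f A)))"
      using pairingD(1,2)[OF pq(1)] pairingD(1,2)[OF pq(2)]
      by (subst bil_sum_form) (auto simp: bil_minus_form bil_reindex[OF fbij])
    also have "\<dots> = 0"
      using sym XY by (simp cong: bil_cong)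
    finally show "bil (pset ?P) (sum_form p (Opp q) (\<lambda>A B. e (f A) (f B)) (\<lambda>A B. - e A B)) (match_vec M C X) (match_vec M C Y) \<in> rels"
      using rels_zero by simp
  qed
qed

lemma cob_refl: "pairing p \<Longrightarrow> p \<sim>\<^sub>p p"
  by (rule cob_iso[where f = id]) (auto simp: p_iso_def)

lemma p_sum_form [simp]:
  "pform (p \<oplus>\<^sub>p q) (Some (Inl A)) (Some (Inl B)) = pform p A B"
  "pform (p \<oplus>\<^sub>p q) (Some (Inr A')) (Some (Inr B')) = pform q A' B'"
  "pform (p \<oplus>\<^sub>p q) (Some (Inl A)) (Some (Inr B')) = \<one>\<^bsub>PI\<^esub>"
  "pform (p \<oplus>\<^sub>p q) (Some (Inr A')) (Some (Inl B)) = \<one>\<^bsub>PI\<^esub>"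
  "pform (p \<oplus>\<^sub>p q) (Some (Inl A)) None = pform p A (pbase p)"
  "pform (p \<oplus>\<^sub>p q) (Some (Inr A')) None = pform q A' (pbase q)"
  "pform (p \<oplus>\<^sub>p q) None (Some (Inl B)) = pform p (pbase p) B"
  "pform (p \<oplus>\<^sub>p q) None (Some (Inr B')) = pform q (pbase q) B'"
  "pform (p \<oplus>\<^sub>p q) None None = pform p (pbase p) (pbase p) \<otimes>\<^bsub>PI\<^esub> pform q (pbase q) (pbase q)"
  by (simp_all add: p_sum_def)


lemma rep_formD:
  assumes "rep_form p e" "A \<in> pset p" "B \<in> pset p"
  shows "e A B \<in> frags" "pform p A B = cls (e A B)"
  using assms by (auto simp: rep_form_def)

text \<open>Exchanging the summands turns \<open>q \<oplus>\<^sub>p Opp p\<close> into the opposite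
  of \<open>p \<oplus>\<^sub>p Opp q\<close>, and an annihilating filling also annihilates the
  opposite form.\<close>

lemma cob_sym:
  assumes pq: "pairing p" "pairing q" and "p \<sim>\<^sub>p q"
  shows "q \<sim>\<^sub>p p"
proof -
  obtain e1 e2 where e: "rep_form p e1" "rep_form q e2"
    using rep_form_exists pq by metis
  let ?f = "\<lambda>X. case X of None \<Rightarrow> None | Some (Inl B) \<Rightarrow> Some (Inr B) | Some (Inr A) \<Rightarrow> Some (Inl A)"
  have bij: "bij_betw ?f (pset (q \<oplus>\<^sub>p Opp p)) (pset (Opp (p \<oplus>\<^sub>p Opp q)))"
    by (rule bij_betwI[where g = "\<lambda>X. case X of None \<Rightarrow> None | Some (Inl B) \<Rightarrow> Some (Inr B) | Some (Inr A) \<Rightarrow> Some (Inl A)"]) auto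
  have iso: "p_iso ?f (q \<oplus>\<^sub>p Opp p) (Opp (p \<oplus>\<^sub>p Opp q))"
    unfolding p_iso_def
  proof (intro conjI ballI bij)
    fix X Y assume "X \<in> pset (q \<oplus>\<^sub>p Opp p)" "Y \<in> pset (q \<oplus>\<^sub>p Opp p)"
    then show "pform (Opp (p \<oplus>\<^sub>p Opp q)) (?f X) (?f Y) = pform (q \<oplus>\<^sub>p Opp p) X Y"
      using pairingD(2)[OF pq(1)] pairingD(2)[OF pq(2)]
      by (elim p_sum_cases) (simp_all add: pcirc_subset(1) rep_formD[OF e(1)] rep_formD[OF e(2)] inv_cls mult_cls frags_closed one_PI)
  next
    show "?f (pbase (q \<oplus>\<^sub>p Opp p)) = pbase (Opp (p \<oplus>\<^sub>p Opp q))" by simp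
    show "pproj (Opp (p \<oplus>\<^sub>p Opp q)) (?f X) = pproj (q \<oplus>\<^sub>p Opp p) X" if "X \<in> pcirc (q \<oplus>\<^sub>p Opp p)" for X
      using that by auto
  qed
  have hyp: "hyperbolic al tau (Opp (p \<oplus>\<^sub>p Opp q))"
    using assms(3) pq unfolding p_cobordant_def by (intro hyperbolic_opposite pairing_sum pairing_opposite)
  show ?thesis
    unfolding p_cobordant_def by (rule hyperbolic_iso[OF _ _ iso hyp]) (intro pairing_sum pairing_opposite pq)+
qed

text \<open>Exchanging the two middle ones of the four summands gives the sum of the two given
  hyperbolic pairings.\<close>

lemma cob_sum:
  fixes p1 :: "('x, 'a) pairing" and p2 :: "('y, 'a) pairing" and q1 :: "('z, 'a) pairing" and q2 :: "('w, 'a) pairing"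
  assumes P: "pairing p1" "pairing p2" "pairing q1" "pairing q2" and cob: "p1 \<sim>\<^sub>p q1" "p2 \<sim>\<^sub>p q2"
  shows "p1 \<oplus>\<^sub>p p2 \<sim>\<^sub>p q1 \<oplus>\<^sub>p q2"
proof -
  obtain e1 e2 e3 e4 where e: "rep_form p1 e1" "rep_form p2 e2" "rep_form q1 e3" "rep_form q2 e4"
    using rep_form_exists P by metis
  \<comment> \<open>A nested sum has only one base element, the outer \<open>None\<close>. The last
    pattern catches \<open>Some (Inl None)\<close> and \<open>Some (Inr None)\<close>, which are not
    elements of it.\<close>
  define f where "f X = (case X of None \<Rightarrow> None | Some (Inl (Some (Inl a))) \<Rightarrow> Some (Inl (Some (Inl a)))
    | Some (Inl (Some (Inr b))) \<Rightarrow> Some (Inr (Some (Inl b))) | Some (Inr (Some (Inl c))) \<Rightarrow> Some (Inl (Some (Inr c)))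
    | Some (Inr (Some (Inr d))) \<Rightarrow> Some (Inr (Some (Inr d))) | _ \<Rightarrow> None)"
    for X :: "(('x + 'y) option + ('z + 'w) option) option"
  have f: "f None = None" "f (Some (Inl (Some (Inl a)))) = Some (Inl (Some (Inl a)))"
    "f (Some (Inl (Some (Inr b)))) = Some (Inr (Some (Inl b)))" "f (Some (Inr (Some (Inl c)))) = Some (Inl (Some (Inr c)))"
    "f (Some (Inr (Some (Inr d)))) = Some (Inr (Some (Inr d)))" for a b c d
    by (simp_all add: f_def)
  let ?L = "(p1 \<oplus>\<^sub>p p2) \<oplus>\<^sub>p Opp (q1 \<oplus>\<^sub>p q2)" and ?R = "(p1 \<oplus>\<^sub>p Opp q1) \<oplus>\<^sub>p (p2 \<oplus>\<^sub>p Opp q2)"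
  have iso: "p_iso f ?L ?R"
    unfolding p_iso_def
  proof (intro conjI ballI)
    show "bij_betw f (pset ?L) (pset ?R)"
      unfolding bij_betw_def by (auto simp: f inj_on_def image_Un image_image)
    show "f (pbase ?L) = pbase ?R" by (simp add: f)
    show "pproj ?R (f A) = pproj ?L A" if "A \<in> pcirc ?L" for A
      using that by (auto simp: f)
    fix X Y assume XY: "X \<in> pset ?L" "Y \<in> pset ?L"
    have cases: "X = None \<or> (\<exists>a\<in>pcirc p1. X = Some (Inl (Some (Inl a)))) \<or> (\<exists>a\<in>pcirc p2. X = Some (Inl (Some (Inr a))))
       \<or> (\<exists>a\<in>pcirc q1. X = Some (Inr (Some (Inl a)))) \<or> (\<exists>a\<in>pcirc q2. X = Some (Inr (Some (Inr a))))"
      if "X \<in> pset ?L" for X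
      using that by auto
    note b = pairingD(2)[OF P(1)] pairingD(2)[OF P(2)] pairingD(2)[OF P(3)] pairingD(2)[OF P(4)]
    show "pform ?R (f X) (f Y) = pform ?L X Y"
      using cases[OF XY(1)] cases[OF XY(2)]
      by (elim disjE bexE) (simp_all add: f b pcirc_subset(1) rep_formD[OF e(1)] rep_formD[OF e(2)]
          rep_formD[OF e(3)] rep_formD[OF e(4)] inv_cls mult_cls frags_closed one_PI algebra_simps)
  qed
  have hyp: "hyperbolic al tau ?R"
    using cob unfolding p_cobordant_def by (rule hyperbolic_sum[rotated 2]) (intro pairing_sum pairing_opposite P)+
  show ?thesis
    unfolding p_cobordant_def by (rule hyperbolic_iso[OF _ _ iso hyp]) (intro pairing_sum pairing_opposite P)+
qed

lemma cob_trans: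
  fixes p :: "('x, 'a) pairing" and q :: "('y, 'a) pairing" and r :: "('z, 'a) pairing"
  assumes P: "pairing p" "pairing q" "pairing r" and cob: "p \<sim>\<^sub>p q" "q \<sim>\<^sub>p r"
  shows "p \<sim>\<^sub>p r"
proof -
  obtain e1 e2 e3 where e: "rep_form p e1" "rep_form q e2" "rep_form r e3"
    using rep_form_exists P by metis
  let ?P = "(p \<oplus>\<^sub>p Opp q) \<oplus>\<^sub>p (q \<oplus>\<^sub>p Opp r)" and ?R = "p \<oplus>\<^sub>p Opp r"
  define E where "E = sum_form (p \<oplus>\<^sub>p Opp q) (q \<oplus>\<^sub>p Opp r) (sum_form p (Opp q) e1 (\<lambda>A B. - e2 A B)) (sum_form q (Opp r) e2 (\<lambda>A B. - e3 A B))"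
  have pP: "pairing ?P" and pR: "pairing ?R" and pQ: "pairing (p \<oplus>\<^sub>p Opp q)" "pairing (q \<oplus>\<^sub>p Opp r)"
    using P by (auto intro!: pairing_sum pairing_opposite)
  have E: "rep_form ?P E"
    unfolding E_def using P e by (intro rep_form_sum rep_form_opposite pairing_sum pairing_opposite)
  have R: "rep_form ?R (sum_form p (Opp r) e1 (\<lambda>A B. - e3 A B))"
    using P e by (intro rep_form_sum rep_form_opposite pairing_opposite)
  have "hyperbolic al tau ?P"
    using cob unfolding p_cobordant_def by (rule hyperbolic_sum[rotated 2]) (intro pairing_sum pairing_opposite P)+
  then obtain m c where mc: "matching tau (pset ?P) (pbase ?P) (pproj ?P) m c"
    "\<And>A B. A \<in> pset ?P \<Longrightarrow> B \<in> pset ?P \<Longrightarrow> bil (pset ?P) E (match_vec m c A) (match_vec m c B) \<in> rels"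
    using hyperbolic_imp_matching[OF pP E] by blast
  let ?d = "\<lambda>b. Some (Inl (Some (Inr b)))" and ?d' = "\<lambda>b. Some (Inr (Some (Inl b)))"
  let ?D = "pcirc q" and ?V = "match_vec m c ` pset ?P"
  let ?T = "pset ?P - ?d ` ?D - ?d' ` ?D"
  have "\<exists>m' c'. matching tau ?T (pbase ?P) (pproj ?P) m' c' \<and>
    (\<forall>A\<in>?T. \<exists>x\<in>zspan ?V. (\<forall>X\<in>?T. x X = match_vec m' c' A X) \<and> (\<forall>b\<in>?D. x (?d b) = x (?d' b)))"
  proof (rule contract[OF mc(1)])
    show "finite ?D" using pairingD(1)[OF P(2)] by (simp add: pcirc_def)
    show "tau (tau (pproj ?P A)) = pproj ?P A" if "A \<in> pset ?P - {pbase ?P}" for A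
      using pairingD(3)[OF pP, of A] that by (intro tau_tau) (auto simp: pcirc_def)
  qed (auto simp: inj_on_def)
  then obtain m' c' where m': "matching tau ?T (pbase ?P) (pproj ?P) m' c'"
    "\<And>A. A \<in> ?T \<Longrightarrow> \<exists>x\<in>zspan ?V. (\<forall>X\<in>?T. x X = match_vec m' c' A X) \<and> (\<forall>b\<in>?D. x (?d b) = x (?d' b))"
    by (elim exE conjE) blast
  define g :: "('x + 'z) option \<Rightarrow> (('x + 'y) option + ('y + 'z) option) option" where
    "g X = (case X of None \<Rightarrow> None | Some (Inl a) \<Rightarrow> Some (Inl (Some (Inl a))) | Some (Inr b) \<Rightarrow> Some (Inr (Some (Inr b))))" for X
  have g: "g None = None" "g (Some (Inl a)) = Some (Inl (Some (Inl a)))" "g (Some (Inr b)) = Some (Inr (Some (Inr b)))" for a b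
    by (simp_all add: g_def)
  have T: "?T = insert None (Some ` (Inl ` Some ` Inl ` pcirc p \<union> Inr ` Some ` Inr ` pcirc r))"
    by auto
  have gbij: "bij_betw g (pset ?R) ?T"
    unfolding T bij_betw_def by (auto simp: g inj_on_def image_Un image_image)
  then have gT: "g X \<in> ?T" if "X \<in> pset ?R" for X using that unfolding bij_betw_def by blast
  obtain m0 c0 where m0: "matching tau (pset ?R) (pbase ?R) (pproj ?R) m0 c0"
    "\<And>A X. A \<in> pset ?R \<Longrightarrow> X \<in> pset ?R \<Longrightarrow> match_vec m0 c0 A X = match_vec m' c' (g A) (g X)"
    by (rule matching_transfer[OF gbij _ _ _ m'(1), of "pbase ?R" "pproj ?R"])
      (auto simp: g)
  \<comment> \<open>The two copies of \<open>q\<close> see the same coefficients at its letters by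
    assumption, and at its base element because all base elements are one. So the two terms with
    \<open>e2\<close> have the same value and opposite signs.\<close>
  have diag: "bil (pset ?P) E x y =
      bil (pset ?R) (sum_form p (Opp r) e1 (\<lambda>A B. - e3 A B)) (\<lambda>X. x (g X)) (\<lambda>X. y (g X))"
    if "\<forall>b\<in>?D. x (?d b) = x (?d' b)" "\<forall>b\<in>?D. y (?d b) = y (?d' b)" for x y
  proof -
    have xq: "x (p_inl (p \<oplus>\<^sub>p Opp q) (p_inr (Opp q) A)) = x (p_inr (q \<oplus>\<^sub>p Opp r) (p_inl q A))"
      "y (p_inl (p \<oplus>\<^sub>p Opp q) (p_inr (Opp q) A)) = y (p_inr (q \<oplus>\<^sub>p Opp r) (p_inl q A))" if "A \<in> pset q" for A
      using \<open>\<forall>b\<in>?D. x (?d b) = x (?d' b)\<close> \<open>\<forall>b\<in>?D. y (?d b) = y (?d' b)\<close> that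
      by (auto simp: p_inl_def p_inr_def pcirc_def)
    have gp: "p_inl (p \<oplus>\<^sub>p Opp q) (p_inl p A) = g (p_inl p A)" for A
      by (auto simp: p_inl_def g)
    have gr: "p_inr (q \<oplus>\<^sub>p Opp r) (p_inr (Opp r) A) = g (p_inr (Opp r) A)" for A
      by (auto simp: p_inr_def g)
    note D = pairingD(1,2)[OF P(1)] pairingD(1,2)[OF P(2)] pairingD(1,2)[OF P(3)]
    have 1: "bil (pset ?P) E x y =
       bil (pset (p \<oplus>\<^sub>p Opp q)) (sum_form p (Opp q) e1 (\<lambda>A B. - e2 A B))
         (\<lambda>A. x (p_inl (p \<oplus>\<^sub>p Opp q) A)) (\<lambda>A. y (p_inl (p \<oplus>\<^sub>p Opp q) A)) +
       bil (pset (q \<oplus>\<^sub>p Opp r)) (sum_form q (Opp r) e2 (\<lambda>A B. - e3 A B))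
         (\<lambda>A. x (p_inr (q \<oplus>\<^sub>p Opp r) A)) (\<lambda>A. y (p_inr (q \<oplus>\<^sub>p Opp r) A))"
      unfolding E_def by (rule bil_sum_form pairingD(1,2)[OF pQ(1)] pairingD(1,2)[OF pQ(2)])+
    have 2: "bil (pset (p \<oplus>\<^sub>p Opp q)) (sum_form p (Opp q) e1 (\<lambda>A B. - e2 A B))
         (\<lambda>A. x (p_inl (p \<oplus>\<^sub>p Opp q) A)) (\<lambda>A. y (p_inl (p \<oplus>\<^sub>p Opp q) A)) =
        bil (pset p) e1 (\<lambda>A. x (g (p_inl p A))) (\<lambda>A. y (g (p_inl p A)))
        - bil (pset q) e2 (\<lambda>A. x (p_inl (p \<oplus>\<^sub>p Opp q) (p_inr (Opp q) A))) (\<lambda>A. y (p_inl (p \<oplus>\<^sub>p Opp q) (p_inr (Opp q) A)))"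
      by (subst bil_sum_form) (use D in \<open>simp_all add: bil_minus_form gp\<close>)
    have 3: "bil (pset (q \<oplus>\<^sub>p Opp r)) (sum_form q (Opp r) e2 (\<lambda>A B. - e3 A B))
         (\<lambda>A. x (p_inr (q \<oplus>\<^sub>p Opp r) A)) (\<lambda>A. y (p_inr (q \<oplus>\<^sub>p Opp r) A)) =
        bil (pset q) e2 (\<lambda>A. x (p_inr (q \<oplus>\<^sub>p Opp r) (p_inl q A))) (\<lambda>A. y (p_inr (q \<oplus>\<^sub>p Opp r) (p_inl q A)))
        - bil (pset r) e3 (\<lambda>A. x (g (p_inr (Opp r) A))) (\<lambda>A. y (g (p_inr (Opp r) A)))"
      by (subst bil_sum_form) (use D in \<open>simp_all add: bil_minus_form gr\<close>)
    have 4: "bil (pset ?R) (sum_form p (Opp r) e1 (\<lambda>A B. - e3 A B)) (\<lambda>X. x (g X)) (\<lambda>X. y (g X)) =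
        bil (pset p) e1 (\<lambda>A. x (g (p_inl p A))) (\<lambda>A. y (g (p_inl p A)))
        - bil (pset r) e3 (\<lambda>A. x (g (p_inr (Opp r) A))) (\<lambda>A. y (g (p_inr (Opp r) A)))"
      by (subst bil_sum_form) (use D in \<open>simp_all add: bil_minus_form\<close>)
    have 5: "bil (pset q) e2 (\<lambda>A. x (p_inl (p \<oplus>\<^sub>p Opp q) (p_inr (Opp q) A))) (\<lambda>A. y (p_inl (p \<oplus>\<^sub>p Opp q) (p_inr (Opp q) A)))
       = bil (pset q) e2 (\<lambda>A. x (p_inr (q \<oplus>\<^sub>p Opp r) (p_inl q A))) (\<lambda>A. y (p_inr (q \<oplus>\<^sub>p Opp r) (p_inl q A)))"
      by (rule bil_cong) (simp_all only: xq)
    show ?thesis unfolding 1 2 3 4 5 by simp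
  qed
  show ?thesis
    unfolding p_cobordant_def
  proof (rule matching_imp_hyperbolic[OF pR R m0(1)])
    fix A B assume AB: "A \<in> pset ?R" "B \<in> pset ?R"
    obtain x where x: "x \<in> zspan ?V" "\<forall>X\<in>?T. x X = match_vec m' c' (g A) X" "\<forall>b\<in>?D. x (?d b) = x (?d' b)"
      using m'(2)[OF gT[OF AB(1)]] by (elim bexE conjE)
    obtain y where y: "y \<in> zspan ?V" "\<forall>X\<in>?T. y X = match_vec m' c' (g B) X" "\<forall>b\<in>?D. y (?d b) = y (?d' b)"
      using m'(2)[OF gT[OF AB(2)]] by (elim bexE conjE)
    \<comment> \<open>\<open>x\<close> and \<open>y\<close> are integer combinations of annihilating
      vectors, though they need not be short themselves.\<close>
    have "bil (pset ?P) E x y \<in> rels"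
      by (rule bil_zspan[OF _ x(1) y(1)]) (elim imageE, simp only: mc(2))
    moreover have "bil (pset ?R) (sum_form p (Opp r) e1 (\<lambda>A B. - e3 A B)) (\<lambda>X. x (g X)) (\<lambda>X. y (g X)) =
        bil (pset ?R) (sum_form p (Opp r) e1 (\<lambda>A B. - e3 A B)) (match_vec m0 c0 A) (match_vec m0 c0 B)"
    proof (rule bil_cong)
      fix X assume X: "X \<in> pset ?R"
      show "x (g X) = match_vec m0 c0 A X" "y (g X) = match_vec m0 c0 B X"
        using bspec[OF x(2) gT[OF X]] bspec[OF y(2) gT[OF X]] m0(2)[OF AB(1) X] m0(2)[OF AB(2) X] by simp_all
    qed simp
    ultimately show "bil (pset ?R) (sum_form p (Opp r) e1 (\<lambda>A B. - e3 A B)) (match_vec m0 c0 A) (match_vec m0 c0 B) \<in> rels"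
      using diag[OF x(3) y(3)] by simp
  qed
qed

end

section \<open>The group of pairings\<close>

context inv_set
begin

section \<open>Skew-symmetry under opposite, sum and isomorphism\<close>

lemma skew_iff:
  assumes "rep_form p e"
  shows "skew_symmetric al tau p \<longleftrightarrow>
    (\<forall>A\<in>pset p. e A A \<in> rels) \<and> (\<forall>A\<in>pset p. \<forall>B\<in>pset p. e A B + e B A \<in> rels)"
  using rep_formD[OF assms] by (simp add: skew_symmetric_def inv_cls cls_eq_one cls_eq_iff)

lemma skew_opposite: "pairing p \<Longrightarrow> skew_symmetric al tau p \<Longrightarrow> skew_symmetric al tau (Opp p)"
proof -
  assume p: "pairing p" "skew_symmetric al tau p"
  obtain e where e: "rep_form p e" using rep_form_exists[OF p(1)] .
  have "- e A B + - e B A \<in> rels" if "e A B + e B A \<in> rels" for A B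
    using rels_uminus[OF that] by (simp add: algebra_simps)
  then show ?thesis
    using p(2) unfolding skew_iff[OF e] skew_iff[OF rep_form_opposite[OF e]] p_opposite_sel
    by (auto intro: rels_uminus)
qed

lemma skew_sum:
  assumes p: "pairing p" "skew_symmetric al tau p" and q: "pairing q" "skew_symmetric al tau q"
  shows "skew_symmetric al tau (p \<oplus>\<^sub>p q)"
proof -
  obtain e e' where e: "rep_form p e" "rep_form q e'" using rep_form_exists p(1) q(1) by metis
  have 1: "ext_form e X X \<in> rels" if "X = None \<or> the X \<in> pset p" for X
    using p(2) that rels_zero unfolding skew_iff[OF e(1)] by (cases X) (auto simp: ext_form_def)
  have 2: "ext_form e X Y + ext_form e Y X \<in> rels" if "X = None \<or> the X \<in> pset p" "Y = None \<or> the Y \<in> pset p" for X Y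
    using p(2) that rels_zero unfolding skew_iff[OF e(1)] by (cases X; cases Y) (auto simp: ext_form_def)
  have 3: "ext_form e' X X \<in> rels" if "X = None \<or> the X \<in> pset q" for X
    using q(2) that rels_zero unfolding skew_iff[OF e(2)] by (cases X) (auto simp: ext_form_def)
  have 4: "ext_form e' X Y + ext_form e' Y X \<in> rels" if "X = None \<or> the X \<in> pset q" "Y = None \<or> the Y \<in> pset q" for X Y
    using q(2) that rels_zero unfolding skew_iff[OF e(2)] by (cases X; cases Y) (auto simp: ext_form_def)
  have 5: "sum_left p X = None \<or> the (sum_left p X) \<in> pset p" "sum_right q X = None \<or> the (sum_right q X) \<in> pset q"
    if "X \<in> pset (p \<oplus>\<^sub>p q)" for X
    using that pairingD(2)[OF p(1)] pairingD(2)[OF q(1)]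
    by (auto simp: sum_left_def sum_right_def pcirc_subset)
  have "sum_form p q e e' X Y + sum_form p q e e' Y X =
     (ext_form e (sum_left p X) (sum_left p Y) + ext_form e (sum_left p Y) (sum_left p X)) +
     (ext_form e' (sum_right q X) (sum_right q Y) + ext_form e' (sum_right q Y) (sum_right q X))" for X Y
    by (simp add: sum_form_def algebra_simps)
  then have "sum_form p q e e' X Y + sum_form p q e e' Y X \<in> rels"
    if "X \<in> pset (p \<oplus>\<^sub>p q)" "Y \<in> pset (p \<oplus>\<^sub>p q)" for X Y
    using 2[OF 5(1)[OF that(1)] 5(1)[OF that(2)]] 4[OF 5(2)[OF that(1)] 5(2)[OF that(2)]] by (simp add: rels_add)
  moreover have "sum_form p q e e' X X \<in> rels" if "X \<in> pset (p \<oplus>\<^sub>p q)" for X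
    unfolding sum_form_def using 1[OF 5(1)[OF that]] 3[OF 5(2)[OF that]] by (rule rels_add)
  ultimately show ?thesis
    unfolding skew_iff[OF rep_form_sum[OF p(1) q(1) e]] by blast
qed

lemma skew_iso:
  assumes "p_iso f p q" "skew_symmetric al tau p"
  shows "skew_symmetric al tau q"
proof -
  have "\<exists>A'\<in>pset p. A = f A'" if "A \<in> pset q" for A
    using assms(1) that by (auto simp: p_iso_def bij_betw_def)
  then show ?thesis
    using assms unfolding skew_symmetric_def p_iso_def by (metis (no_types, lifting))
qed

text \<open>Sums and pairings of nanowords live over types built from others, whereas the classes
  are sets of pairings over \<open>'s\<close>. A finite underlying set fits into every infinite
  type.\<close>

lemma pairing_copy:
  assumes p: "pairing p"
  obtains f and q :: "('s::infinite, 'a) pairing" where "p_iso f p q" "pairing q"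
proof -
  obtain B :: "'s set" where "finite B" "card B = card (pset p)"
    using infinite_arbitrarily_large[OF infinite_UNIV] by blast
  then obtain f where f: "bij_betw f (pset p) B"
    using pairingD(1)[OF p] finite_same_card_bij by metis
  let ?h = "inv_into (pset p) f"
  define q where "q = \<lparr>pset = B, pbase = f (pbase p), pproj = (\<lambda>X. pproj p (?h X)), pform = (\<lambda>X Y. pform p (?h X) (?h Y))\<rparr>"
  have h: "?h (f A) = A" if "A \<in> pset p" for A using f that by (simp add: bij_betw_def)
  have iso: "p_iso f p q"
    using f h by (auto simp: p_iso_def q_def pcirc_def)
  have hB: "?h X \<in> pset p" "f (?h X) = X" if "X \<in> B" for X
    using f that by (auto simp: bij_betw_def f_inv_into_f inv_into_into)
  have "f (pbase p) \<in> B" using f pairingD(2)[OF p] by (auto simp: bij_betw_def)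
  moreover have "?h X \<in> pcirc p" if "X \<in> B" "X \<noteq> f (pbase p)" for X
    using hB[OF that(1)] that(2) by (auto simp: pcirc_def)
  ultimately have "pairing q"
    using p hB(1) \<open>finite B\<close> by (auto simp: is_pairing_def q_def pcirc_def[of "\<lparr>pset = _, pbase = _, pproj = _, pform = _\<rparr>"])
  then show ?thesis using iso that by blast
qed

section \<open>Classes of pairings and their product\<close>

abbreviation pclass :: "('t, 'a) pairing \<Rightarrow> ('s, 'a) pairing set" where
  "pclass \<equiv> p_class al tau"

lemma pclass_eqI:
  assumes "pairing p" "pairing q" "p \<sim>\<^sub>p q"
  shows "pclass p = pclass q"
  unfolding p_class_def using assms by (auto intro: cob_trans cob_sym)

lemma pclass_copy:
  fixes p :: "('t, 'a) pairing"
  assumes p: "pairing p"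
  obtains q :: "('s::infinite, 'a) pairing" where "pairing q" "p \<sim>\<^sub>p q" "(pclass p :: ('s, 'a) pairing set) = pclass q"
    "q \<in> pclass p" "skew_symmetric al tau p \<Longrightarrow> skew_symmetric al tau q"
proof -
  obtain f and q :: "('s, 'a) pairing" where q: "p_iso f p q" "pairing q" using pairing_copy[OF p] .
  have cob: "p \<sim>\<^sub>p q" by (rule cob_iso[OF p q(2,1)])
  show ?thesis
    by (rule that[OF q(2) cob pclass_eqI[OF p q(2) cob] _ skew_iso[OF q(1)]])
      (use q cob in \<open>simp_all add: p_class_def\<close>)
qed

text \<open>The product is formed with representatives over \<open>'s\<close>, but \<open>p\<close>
  and \<open>q\<close> may live over any types. Copies over \<open>'s\<close> show that the product
  contains everything cobordant to the sum; compatibility of sums with cobordism gives the other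
  inclusion.\<close>

lemma pclass_mult:
  fixes p :: "('t, 'a) pairing" and q :: "('u, 'a) pairing"
  assumes p: "pairing p" and q: "pairing q"
  shows "(pclass p :: ('s::infinite, 'a) pairing set) \<otimes>\<^bsub>psk_group al tau\<^esub> pclass q = pclass (p \<oplus>\<^sub>p q)"
proof -
  have "r \<in> pclass (p \<oplus>\<^sub>p q)" if "pairing r" "p' \<in> pclass p" "q' \<in> pclass q" "p' \<oplus>\<^sub>p q' \<sim>\<^sub>p r"
    for r p' q' :: "('s, 'a) pairing"
  proof -
    have *: "pairing p'" "pairing q'" "p \<sim>\<^sub>p p'" "q \<sim>\<^sub>p q'" using that by (auto simp: p_class_def)
    have "p \<oplus>\<^sub>p q \<sim>\<^sub>p r"
      by (rule cob_trans[OF pairing_sum[OF p q] pairing_sum[OF *(1,2)] that(1) cob_sum[OF p q *] that(4)])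
    then show ?thesis using that(1) by (simp add: p_class_def)
  qed
  moreover have "\<exists>p'\<in>(pclass p :: ('s, 'a) pairing set). \<exists>q'\<in>(pclass q :: ('s, 'a) pairing set). p' \<oplus>\<^sub>p q' \<sim>\<^sub>p r" if "r \<in> pclass (p \<oplus>\<^sub>p q)" for r :: "('s, 'a) pairing"
  proof -
    obtain p' :: "('s, 'a) pairing" where p': "pairing p'" "p \<sim>\<^sub>p p'" "p' \<in> pclass p" using pclass_copy[OF p] by metis
    obtain q' :: "('s, 'a) pairing" where q': "pairing q'" "q \<sim>\<^sub>p q'" "q' \<in> pclass q" using pclass_copy[OF q] by metis
    have r: "pairing r" "p \<oplus>\<^sub>p q \<sim>\<^sub>p r" using that by (auto simp: p_class_def)
    have "p' \<oplus>\<^sub>p q' \<sim>\<^sub>p r"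
      by (rule cob_trans[OF pairing_sum[OF p'(1) q'(1)] pairing_sum[OF p q] r(1)
           cob_sym[OF pairing_sum[OF p q] pairing_sum[OF p'(1) q'(1)] cob_sum[OF p q p'(1) q'(1) p'(2) q'(2)]] r(2)])
    then show ?thesis using p' q' by blast
  qed
  ultimately show ?thesis
    unfolding psk_group_def p_group_def by (fastforce simp: p_class_def[of _ _ "p \<oplus>\<^sub>p q"])
qed

lemma pclass_carrier:
  assumes "pairing p" "skew_symmetric al tau p"
  shows "(pclass p :: ('s::infinite, 'a) pairing set) \<in> carrier (psk_group al tau)"
proof -
  obtain q :: "('s, 'a) pairing" where q: "pairing q" "(pclass p :: ('s, 'a) pairing set) = pclass q" "skew_symmetric al tau q"
    using pclass_copy[OF assms(1)] assms(2) by metis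
  then show ?thesis by (auto simp: psk_group_def)
qed

lemma pclass_carrierE:
  fixes X :: "('s, 'a) pairing set"
  assumes "X \<in> carrier (psk_group al tau)"
  obtains p :: "('s, 'a) pairing" where "pairing p" "skew_symmetric al tau p" "X = pclass p"
  using assms by (auto simp: psk_group_def)

section \<open>Unit, associativity and inverses\<close>

abbreviation "triv \<equiv> trivial_pairing al tau"

lemma triv_sel: "pset triv = {()}" "pbase triv = ()" "pcirc triv = {}" "pform triv A B = \<one>\<^bsub>PI\<^esub>"
  by (auto simp: trivial_pairing_def pcirc_def)

lemma rep_form_triv: "rep_form triv (\<lambda>_ _. 0)"
  by (simp add: rep_form_def triv_sel one_PI frags_zero)

lemma pairing_triv: "pairing triv"
  by (rule rep_form_pairing[OF _ _ _ rep_form_triv]) (simp_all add: triv_sel)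

lemma skew_triv: "skew_symmetric al tau triv"
  unfolding skew_iff[OF rep_form_triv] by (simp add: rels_zero)

lemma cob_triv_left:
  fixes p :: "('x, 'a) pairing"
  assumes p: "pairing p"
  shows "triv \<oplus>\<^sub>p p \<sim>\<^sub>p p"
proof -
  obtain e where e: "rep_form p e" using rep_form_exists[OF p] .
  define f where "f X = (case X of None \<Rightarrow> pbase p | Some (Inl _) \<Rightarrow> pbase p | Some (Inr A) \<Rightarrow> A)" for X :: "(unit + 'x) option"
  have "p_iso f (triv \<oplus>\<^sub>p p) p"
    unfolding p_iso_def
  proof (intro conjI ballI)
    show "bij_betw f (pset (triv \<oplus>\<^sub>p p)) (pset p)"
      unfolding bij_betw_def using pairingD(2)[OF p] by (auto simp: triv_sel f_def inj_on_def pcirc_def image_iff)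
    show "f (pbase (triv \<oplus>\<^sub>p p)) = pbase p" by (simp add: f_def)
    show "pproj p (f A) = pproj (triv \<oplus>\<^sub>p p) A" if "A \<in> pcirc (triv \<oplus>\<^sub>p p)" for A
      using that by (auto simp: triv_sel f_def)
    show "pform p (f X) (f Y) = pform (triv \<oplus>\<^sub>p p) X Y" if "X \<in> pset (triv \<oplus>\<^sub>p p)" "Y \<in> pset (triv \<oplus>\<^sub>p p)" for X Y
      using that pairingD(2)[OF p] by (elim p_sum_cases)
        (simp_all add: triv_sel f_def pcirc_subset(1) rep_formD[OF e] mult_cls frags_closed one_PI)
  qed
  then show ?thesis by (rule cob_iso[OF pairing_sum[OF pairing_triv p] p])
qed

lemma cob_assoc:
  fixes p :: "('x, 'a) pairing" and q :: "('y, 'a) pairing" and r :: "('z, 'a) pairing"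
  assumes P: "pairing p" "pairing q" "pairing r"
  shows "(p \<oplus>\<^sub>p q) \<oplus>\<^sub>p r \<sim>\<^sub>p p \<oplus>\<^sub>p (q \<oplus>\<^sub>p r)"
proof -
  obtain e1 e2 e3 where e: "rep_form p e1" "rep_form q e2" "rep_form r e3"
    using rep_form_exists P by metis
  define f :: "(('x + 'y) option + 'z) option \<Rightarrow> ('x + ('y + 'z) option) option" where
    "f X = (case X of None \<Rightarrow> None | Some (Inl (Some (Inl a))) \<Rightarrow> Some (Inl a)
      | Some (Inl (Some (Inr b))) \<Rightarrow> Some (Inr (Some (Inl b))) | Some (Inr c) \<Rightarrow> Some (Inr (Some (Inr c))) | _ \<Rightarrow> None)" for X
  have f: "f None = None" "f (Some (Inl (Some (Inl a)))) = Some (Inl a)"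
    "f (Some (Inl (Some (Inr b)))) = Some (Inr (Some (Inl b)))" "f (Some (Inr c)) = Some (Inr (Some (Inr c)))" for a b c
    by (simp_all add: f_def)
  let ?L = "(p \<oplus>\<^sub>p q) \<oplus>\<^sub>p r" and ?R = "p \<oplus>\<^sub>p (q \<oplus>\<^sub>p r)"
  have "p_iso f ?L ?R"
    unfolding p_iso_def
  proof (intro conjI ballI)
    show "bij_betw f (pset ?L) (pset ?R)"
      unfolding bij_betw_def by (auto simp: f inj_on_def image_Un image_image)
    show "f (pbase ?L) = pbase ?R" by (simp add: f)
    show "pproj ?R (f A) = pproj ?L A" if "A \<in> pcirc ?L" for A
      using that by (auto simp: f)
    fix X Y assume XY: "X \<in> pset ?L" "Y \<in> pset ?L"
    have cases: "X = None \<or> (\<exists>a\<in>pcirc p. X = Some (Inl (Some (Inl a)))) \<or> (\<exists>a\<in>pcirc q. X = Some (Inl (Some (Inr a))))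
       \<or> (\<exists>a\<in>pcirc r. X = Some (Inr a))"
      if "X \<in> pset ?L" for X
      using that by auto
    note b = pairingD(2)[OF P(1)] pairingD(2)[OF P(2)] pairingD(2)[OF P(3)]
    show "pform ?R (f X) (f Y) = pform ?L X Y"
      using cases[OF XY(1)] cases[OF XY(2)]
      by (elim disjE bexE) (simp_all add: f b pcirc_subset(1) rep_formD[OF e(1)] rep_formD[OF e(2)]
          rep_formD[OF e(3)] inv_cls mult_cls frags_closed one_PI algebra_simps)
  qed
  then show ?thesis by (rule cob_iso[rotated 2]) (intro pairing_sum P)+
qed

text \<open>The opposite of the trivial pairing contributes neither letters nor values, so the sum
  in the definition of cobordism is isomorphic to \<open>p\<close> itself.\<close>

lemma hyperbolic_imp_cob_triv:
  fixes p :: "('x, 'a) pairing"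
  assumes p: "pairing p" and hyp: "hyperbolic al tau p"
  shows "p \<sim>\<^sub>p triv"
proof -
  obtain e where e: "rep_form p e" using rep_form_exists[OF p] .
  define f where "f X = (case X of None \<Rightarrow> pbase p | Some (Inr _) \<Rightarrow> pbase p | Some (Inl A) \<Rightarrow> A)" for X :: "('x + unit) option"
  have iso: "p_iso f (p \<oplus>\<^sub>p Opp triv) p"
    unfolding p_iso_def
  proof (intro conjI ballI)
    show "bij_betw f (pset (p \<oplus>\<^sub>p Opp triv)) (pset p)"
      unfolding bij_betw_def using pairingD(2)[OF p] by (auto simp: triv_sel f_def inj_on_def pcirc_def image_iff)
    show "f (pbase (p \<oplus>\<^sub>p Opp triv)) = pbase p" by (simp add: f_def)
    show "pproj p (f A) = pproj (p \<oplus>\<^sub>p Opp triv) A" if "A \<in> pcirc (p \<oplus>\<^sub>p Opp triv)" for A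
      using that by (auto simp: triv_sel f_def)
    show "pform p (f X) (f Y) = pform (p \<oplus>\<^sub>p Opp triv) X Y" if "X \<in> pset (p \<oplus>\<^sub>p Opp triv)" "Y \<in> pset (p \<oplus>\<^sub>p Opp triv)" for X Y
      using that pairingD(2)[OF p] by (elim p_sum_cases)
        (simp_all add: triv_sel f_def pcirc_subset(1) rep_formD[OF e] inv_cls mult_cls frags_closed one_PI)
  qed
  show ?thesis
    unfolding p_cobordant_def
    by (rule hyperbolic_iso[OF _ p iso hyp]) (intro pairing_sum p pairing_opposite pairing_triv)
qed

text \<open>This is reflexivity for \<open>Opp p\<close>, once its double opposite is replaced by
  \<open>p\<close>. Inverting a value twice restores it inside the carrier of the group, hence the
  isomorphism \<open>id\<close> in place of an equation of records.\<close>

lemma cob_opposite_left: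
  assumes p: "pairing p"
  shows "Opp p \<oplus>\<^sub>p p \<sim>\<^sub>p triv"
proof (rule hyperbolic_imp_cob_triv)
  obtain e where e: "rep_form p e" using rep_form_exists[OF p] .
  have hyp: "hyperbolic al tau (Opp p \<oplus>\<^sub>p Opp (Opp p))"
    using cob_refl[OF pairing_opposite[OF p]] unfolding p_cobordant_def .
  have iso: "p_iso id (Opp p \<oplus>\<^sub>p p) (Opp p \<oplus>\<^sub>p Opp (Opp p))"
    unfolding p_iso_def
  proof (intro conjI ballI)
    show "bij_betw id (pset (Opp p \<oplus>\<^sub>p p)) (pset (Opp p \<oplus>\<^sub>p Opp (Opp p)))" by simp
    show "id (pbase (Opp p \<oplus>\<^sub>p p)) = pbase (Opp p \<oplus>\<^sub>p Opp (Opp p))" by simp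
    show "pproj (Opp p \<oplus>\<^sub>p Opp (Opp p)) (id A) = pproj (Opp p \<oplus>\<^sub>p p) A" if "A \<in> pcirc (Opp p \<oplus>\<^sub>p p)" for A
      using that by auto
    show "pform (Opp p \<oplus>\<^sub>p Opp (Opp p)) (id X) (id Y) = pform (Opp p \<oplus>\<^sub>p p) X Y"
      if "X \<in> pset (Opp p \<oplus>\<^sub>p p)" "Y \<in> pset (Opp p \<oplus>\<^sub>p p)" for X Y
      using that pairingD(2)[OF p] by (elim p_sum_cases)
        (simp_all add: pcirc_subset(1) rep_formD[OF e] inv_cls frags_closed)
  qed
  show "hyperbolic al tau (Opp p \<oplus>\<^sub>p p)"
    by (rule hyperbolic_iso[OF _ _ iso hyp]) (intro pairing_sum p pairing_opposite)+
  show "pairing (Opp p \<oplus>\<^sub>p p)" by (intro pairing_sum p pairing_opposite)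
qed

lemma group_psk: "group (psk_group al tau :: ('s::infinite, 'a) pairing set monoid)"
proof (rule groupI)
  let ?G = "psk_group al tau :: ('s, 'a) pairing set monoid"
  have one: "\<one>\<^bsub>?G\<^esub> = pclass triv" by (simp add: psk_group_def p_group_def)
  show "\<one>\<^bsub>?G\<^esub> \<in> carrier ?G"
    unfolding one by (rule pclass_carrier[OF pairing_triv skew_triv])
  fix x assume "x \<in> carrier ?G"
  then obtain p :: "('s, 'a) pairing" where p: "pairing p" "skew_symmetric al tau p" "x = pclass p" by (rule pclass_carrierE)
  show "\<one>\<^bsub>?G\<^esub> \<otimes>\<^bsub>?G\<^esub> x = x"
    unfolding one p(3) pclass_mult[OF pairing_triv p(1)]
    by (rule pclass_eqI[OF pairing_sum[OF pairing_triv p(1)] p(1) cob_triv_left[OF p(1)]])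
  show "\<exists>y\<in>carrier ?G. y \<otimes>\<^bsub>?G\<^esub> x = \<one>\<^bsub>?G\<^esub>"
  proof
    show "pclass (Opp p) \<in> carrier ?G"
      by (rule pclass_carrier[OF pairing_opposite[OF p(1)] skew_opposite[OF p(1,2)]])
    show "pclass (Opp p) \<otimes>\<^bsub>?G\<^esub> x = \<one>\<^bsub>?G\<^esub>"
      unfolding one p(3) pclass_mult[OF pairing_opposite[OF p(1)] p(1)]
      by (rule pclass_eqI[OF pairing_sum[OF pairing_opposite[OF p(1)] p(1)] pairing_triv cob_opposite_left[OF p(1)]])
  qed
  fix y assume "y \<in> carrier ?G"
  then obtain q :: "('s, 'a) pairing" where q: "pairing q" "skew_symmetric al tau q" "y = pclass q" by (rule pclass_carrierE)
  show "x \<otimes>\<^bsub>?G\<^esub> y \<in> carrier ?G"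
    unfolding p(3) q(3) pclass_mult[OF p(1) q(1)]
    by (rule pclass_carrier[OF pairing_sum[OF p(1) q(1)] skew_sum[OF p(1,2) q(1,2)]])
  fix z assume "z \<in> carrier ?G"
  then obtain r :: "('s, 'a) pairing" where r: "pairing r" "skew_symmetric al tau r" "z = pclass r" by (rule pclass_carrierE)
  show "x \<otimes>\<^bsub>?G\<^esub> y \<otimes>\<^bsub>?G\<^esub> z = x \<otimes>\<^bsub>?G\<^esub> (y \<otimes>\<^bsub>?G\<^esub> z)"
    unfolding p(3) q(3) r(3) pclass_mult[OF p(1) q(1)] pclass_mult[OF q(1) r(1)]
      pclass_mult[OF pairing_sum[OF p(1) q(1)] r(1)] pclass_mult[OF p(1) pairing_sum[OF q(1) r(1)]]
    by (rule pclass_eqI[OF _ _ cob_assoc[OF p(1) q(1) r(1)]]) (intro pairing_sum p(1) q(1) r(1))+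
qed

end

section \<open>The form of a nanoword\<close>

lemma occ_props:
  assumes "count_list w A = 2"
  shows "occ_first w A < occ_last w A" "occ_last w A < length w"
    "w ! occ_first w A = A" "w ! occ_last w A = A"
    "k < length w \<Longrightarrow> w ! k = A \<longleftrightarrow> k = occ_first w A \<or> k = occ_last w A"
proof -
  let ?S = "{i. i < length w \<and> w ! i = A}"
  have "card ?S = 2"
    using assms unfolding count_list_eq_length_filter length_filter_conv_card by (simp only: eq_commute[of A])
  then obtain a' b' where ab': "?S = {a', b'}" "a' \<noteq> b'"
    unfolding card_2_iff by (elim exE conjE)
  define a b where "a = min a' b'" "b = max a' b'"
  have ab: "?S = {a, b}" "a < b"
    unfolding ab'(1) a_b_def using ab'(2) by (auto simp: min_def max_def)
  have first: "occ_first w A = a" and last: "occ_last w A = b"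
    unfolding occ_first_def occ_last_def ab(1) using ab(2) by auto
  show "occ_first w A < occ_last w A" using first last ab(2) by simp
  have "a \<in> ?S" "b \<in> ?S" unfolding ab(1) by auto
  then show "occ_last w A < length w" "w ! occ_first w A = A" "w ! occ_last w A = A"
    using first last by auto
  show "w ! k = A \<longleftrightarrow> k = occ_first w A \<or> k = occ_last w A" if "k < length w"
  proof -
    have "w ! k = A \<longleftrightarrow> k \<in> ?S" using that by simp
    then show ?thesis unfolding ab(1) first last by simp
  qed
qed

lemma occ_unique:
  assumes "count_list w A = 2" "i < j" "j < length w" "w ! i = A" "w ! j = A"
  shows "occ_first w A = i" "occ_last w A = j"
  using occ_props(1)[OF assms(1)] occ_props(5)[OF assms(1), of i] occ_props(5)[OF assms(1), of j] assms by auto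

text \<open>Replaces the decompositions in the definition of \<open>n_w\<close> by inequalities
  between positions, in which the heights are expressed too.\<close>

lemma four_split:
  "(\<exists>x1 x2 x3 x4 x5. w = x1 @ [A] @ x2 @ [B] @ x3 @ [A] @ x4 @ [B] @ x5) \<longleftrightarrow>
   (\<exists>p q r s. p < q \<and> q < r \<and> r < s \<and> s < length w \<and> w ! p = A \<and> w ! q = B \<and> w ! r = A \<and> w ! s = B)"
proof
  assume "\<exists>x1 x2 x3 x4 x5. w = x1 @ [A] @ x2 @ [B] @ x3 @ [A] @ x4 @ [B] @ x5"
  then obtain x1 x2 x3 x4 x5 where w: "w = x1 @ [A] @ x2 @ [B] @ x3 @ [A] @ x4 @ [B] @ x5" by blast
  let ?p = "length x1" let ?q = "?p + 1 + length x2" let ?r = "?q + 1 + length x3" let ?s = "?r + 1 + length x4"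
  have "w ! ?p = A" "w ! ?q = B" "w ! ?r = A" "w ! ?s = B"
    unfolding w by (simp_all add: nth_append)
  moreover have "?s < length w" using w by simp
  ultimately show "\<exists>p q r s. p < q \<and> q < r \<and> r < s \<and> s < length w \<and> w ! p = A \<and> w ! q = B \<and> w ! r = A \<and> w ! s = B"
    by (intro exI[of _ ?p] exI[of _ ?q] exI[of _ ?r] exI[of _ ?s]) simp
next
  assume "\<exists>p q r s. p < q \<and> q < r \<and> r < s \<and> s < length w \<and> w ! p = A \<and> w ! q = B \<and> w ! r = A \<and> w ! s = B"
  then obtain p q r s where *: "p < q" "q < r" "r < s" "s < length w" "w ! p = A" "w ! q = B" "w ! r = A" "w ! s = B" by blast
  have step: "\<exists>a. drop k w = a @ [w ! m] @ drop (Suc m) w" if "k \<le> m" "m < length w" for k m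
    using that id_take_nth_drop[of "m - k" "drop k w"]
    by (intro exI[of _ "take (m - k) (drop k w)"]) simp
  obtain a1 where 1: "drop 0 w = a1 @ [A] @ drop (Suc p) w" using step[of 0 p] * by auto
  obtain a2 where 2: "drop (Suc p) w = a2 @ [B] @ drop (Suc q) w" using step[of "Suc p" q] * by auto
  obtain a3 where 3: "drop (Suc q) w = a3 @ [A] @ drop (Suc r) w" using step[of "Suc q" r] * by auto
  obtain a4 where 4: "drop (Suc r) w = a4 @ [B] @ drop (Suc s) w" using step[of "Suc r" s] * by auto
  have "drop 0 w = a1 @ [A] @ a2 @ [B] @ a3 @ [A] @ a4 @ [B] @ drop (Suc s) w"
    unfolding 1 2 3 4 ..
  then show "\<exists>x1 x2 x3 x4 x5. w = x1 @ [A] @ x2 @ [B] @ x3 @ [A] @ x4 @ [B] @ x5"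
    by (intro exI) simp
qed

lemma four_split_occ:
  assumes "count_list w A = 2" "count_list w B = 2"
  shows "(\<exists>x1 x2 x3 x4 x5. w = x1 @ [A] @ x2 @ [B] @ x3 @ [A] @ x4 @ [B] @ x5) \<longleftrightarrow>
    occ_first w A < occ_first w B \<and> occ_first w B < occ_last w A \<and> occ_last w A < occ_last w B"
  unfolding four_split
proof
  assume "\<exists>p q r s. p < q \<and> q < r \<and> r < s \<and> s < length w \<and> w ! p = A \<and> w ! q = B \<and> w ! r = A \<and> w ! s = B"
  then obtain p q r s where *: "p < q" "q < r" "r < s" "s < length w" "w ! p = A" "w ! q = B" "w ! r = A" "w ! s = B" by blast
  then show "occ_first w A < occ_first w B \<and> occ_first w B < occ_last w A \<and> occ_last w A < occ_last w B"
    using occ_unique[OF assms(1), of p r] occ_unique[OF assms(2), of q s] by auto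
next
  assume "occ_first w A < occ_first w B \<and> occ_first w B < occ_last w A \<and> occ_last w A < occ_last w B"
  then show "\<exists>p q r s. p < q \<and> q < r \<and> r < s \<and> s < length w \<and> w ! p = A \<and> w ! q = B \<and> w ! r = A \<and> w ! s = B"
    using occ_props(2-4)[OF assms(1)] occ_props(2-4)[OF assms(2)]
    by (intro exI[of _ "occ_first w A"] exI[of _ "occ_first w B"] exI[of _ "occ_last w A"] exI[of _ "occ_last w B"]) simp
qed

lemma n_w_occ:
  assumes "count_list w A = 2" "count_list w B = 2"
  shows "n_w w A B =
    (if occ_first w A < occ_first w B \<and> occ_first w B < occ_last w A \<and> occ_last w A < occ_last w B then 1
     else if occ_first w B < occ_first w A \<and> occ_first w A < occ_last w B \<and> occ_last w B < occ_last w A then -1 else 0)"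
  unfolding n_w_def four_split_occ[OF assms] four_split_occ[OF assms(2,1)] ..

text \<open>Twice the indicator function of the interval between the two occurrences of a letter, with
  the mean value at the ends. The constant \<open>1\<close> makes \<open>None\<close>, the element \<open>s\<close>, behave like a letter,
  and \<open>e\<^sub>w(X, Y)\<close> becomes the sum of \<open>coef w X Y D * |D|\<close>, including \<open>D = X\<close> and \<open>D = Y\<close>.\<close>

definition hgt :: "'l list \<Rightarrow> 'l option \<Rightarrow> nat \<Rightarrow> int" where
  "hgt w X t = (case X of None \<Rightarrow> 1
     | Some A \<Rightarrow> sgn (int t - int (occ_first w A)) - sgn (int t - int (occ_last w A)))"

definition coef :: "'l list \<Rightarrow> 'l option \<Rightarrow> 'l option \<Rightarrow> 'l \<Rightarrow> int" where
  "coef w X Y D = (hgt w X (occ_first w D) * hgt w Y (occ_last w D) - hgt w Y (occ_first w D) * hgt w X (occ_last w D)) div 2"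

definition nw_form :: "('l, 'a) nanoword \<Rightarrow> 'l option \<Rightarrow> 'l option \<Rightarrow> 'a \<Rightarrow>\<^sub>0 int" where
  "nw_form W X Y = (\<Sum>D\<in>letters W. frag_cmul (coef (word W) X Y D) (frag_of (proj W D)))"

abbreviation nset :: "('l, 'a) nanoword \<Rightarrow> 'l option set" where
  "nset W \<equiv> insert None (Some ` letters W)"

lemma occ_distinct:
  assumes "count_list w A = 2" "count_list w B = 2" "A \<noteq> B"
  shows "occ_first w A \<noteq> occ_first w B" "occ_first w A \<noteq> occ_last w B" "occ_last w A \<noteq> occ_first w B" "occ_last w A \<noteq> occ_last w B"
  using occ_props[OF assms(1)] occ_props[OF assms(2)] assms(3) by metis+

text \<open>The height of \<open>A\<close> is odd exactly at the two occurrences of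
  \<open>A\<close>. So both values are odd when \<open>D\<close> is \<open>A\<close> and even
  otherwise; for \<open>None\<close> both are 1. Applied to \<open>X\<close> and to
  \<open>Y\<close>, this makes the division in \<open>coef\<close> exact.\<close>

lemma hgt_parity:
  assumes "\<And>A. X = Some A \<Longrightarrow> count_list w A = 2" "count_list w D = 2"
  shows "even (hgt w X (occ_first w D) - hgt w X (occ_last w D))"
proof (cases X)
  case (Some A)
  then have A: "count_list w A = 2" using assms(1) by simp
  have "even (sgn (int t - int u) - 1) \<longleftrightarrow> t \<noteq> u" for t u :: nat
    by (cases t u rule: linorder_cases) auto
  then show ?thesis
    using occ_props(1)[OF A] occ_props(1)[OF assms(2)] occ_distinct[OF A assms(2)]
    by (cases "A = D") (auto simp: Some hgt_def sgn_if)
qed (simp add: hgt_def)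

lemma two_coef:
  assumes "\<And>A. X = Some A \<Longrightarrow> count_list w A = 2" "\<And>A. Y = Some A \<Longrightarrow> count_list w A = 2" "count_list w D = 2"
  shows "2 * coef w X Y D = hgt w X (occ_first w D) * hgt w Y (occ_last w D) - hgt w Y (occ_first w D) * hgt w X (occ_last w D)"
proof -
  let ?a = "hgt w X (occ_first w D)" and ?b = "hgt w X (occ_last w D)" and ?c = "hgt w Y (occ_first w D)" and ?d = "hgt w Y (occ_last w D)"
  have "even (?a - ?b)" by (rule hgt_parity[OF _ assms(3)]) (rule assms(1))
  moreover have "even (?c - ?d)" by (rule hgt_parity[OF _ assms(3)]) (rule assms(2))
  ultimately obtain k l where "?a - ?b = 2 * k" "?c - ?d = 2 * l"
    by (elim evenE)
  then have "?a = ?b + 2 * k" "?c = ?d + 2 * l" by simp_all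
  then have "?a * ?d - ?c * ?b = 2 * (k * ?d - l * ?b)" by (simp add: algebra_simps)
  then show ?thesis unfolding coef_def by simp
qed

context inv_set
begin

section \<open>The form of a nanoword in terms of heights\<close>

abbreviation "nword \<equiv> is_nanoword al"
abbreviation "npair \<equiv> nw_pairing al tau"

lemma nwordD:
  assumes "nword W"
  shows "A \<in> letters W \<Longrightarrow> proj W A \<in> al" "A \<in> letters W \<Longrightarrow> count_list (word W) A = 2" "set (word W) = letters W" "finite (letters W)"
proof -
  show "A \<in> letters W \<Longrightarrow> proj W A \<in> al" "A \<in> letters W \<Longrightarrow> count_list (word W) A = 2"
    using assms by (auto simp: is_nanoword_def)
  have "A \<in> set (word W)" if "A \<in> letters W" for A
    using assms that count_notin[of A "word W"] by (fastforce simp: is_nanoword_def)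
  then show "set (word W) = letters W" using assms by (auto simp: is_nanoword_def)
  then show "finite (letters W)" by (metis List.finite_set)
qed

lemma nw_form_frags: "nword W \<Longrightarrow> nw_form W X Y \<in> frags"
  unfolding nw_form_def by (intro frags_sum frags_cmul frags_of nwordD(1))

text \<open>For \<open>D\<close> different from \<open>A\<close> and \<open>B\<close>, each product
  of two heights is 4 or 0 and detects the condition in the definition of \<open>circ_w\<close>;
  halving leaves the factor 2. For \<open>D = A\<close> both heights of \<open>A\<close> are 1, and
  the heights of \<open>B\<close> at the two occurrences of \<open>A\<close> differ by twice
  \<open>n_w\<close>; similarly for \<open>D = B\<close>. So the term with \<open>|A| + |B|\<close>
  is part of the same sum.\<close>

lemma e_w_cls:
  assumes W: "nword W" and AB: "A \<in> letters W" "B \<in> letters W"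
  shows "e_w al tau W A B = cls (nw_form W (Some A) (Some B))"
proof -
  let ?w = "word W"
  define cond where "cond A B D \<longleftrightarrow> occ_first ?w A < occ_first ?w D \<and> occ_first ?w D < occ_last ?w A \<and>
      occ_first ?w B < occ_last ?w D \<and> occ_last ?w D < occ_last ?w B" for A B D
  define ci where "ci A B = (\<Sum>D\<in>letters W. frag_cmul (of_bool (cond A B D)) (frag_of (proj W D)))" for A B
  note c2 = nwordD(2)[OF W]
  have ci: "ci A B \<in> frags" for A B
    unfolding ci_def by (intro frags_sum frags_cmul frags_of nwordD(1)[OF W])
  have circ: "circ_w al tau W A B = cls (ci A B)" for A B
  proof -
    have "circ_w al tau W A B = finprod PI (\<lambda>D. cls (frag_of (proj W D))) {D \<in> letters W. cond A B D}"
      unfolding circ_w_def pi_gen_cls cond_def ..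
    also have "\<dots> = cls (\<Sum>D\<in>{D \<in> letters W. cond A B D}. frag_of (proj W D))"
      by (rule finprod_cls) (auto intro: frags_of nwordD(1)[OF W])
    also have "(\<Sum>D\<in>{D \<in> letters W. cond A B D}. frag_of (proj W D)) = ci A B"
      unfolding ci_def using nwordD(4)[OF W] by (intro sum.mono_neutral_cong_left) auto
    finally show ?thesis .
  qed
  let ?n = "n_w ?w A B"
  have eq: "e_w al tau W A B =
      cls (frag_cmul 2 (ci A B - ci B A) + frag_cmul ?n (frag_of (proj W A) + frag_of (proj W B)))"
    unfolding e_w_def circ pi_gen_cls
    using ci nwordD(1)[OF W] AB by (simp add: inv_cls mult_cls pow_cls frags_closed)
  have coef: "coef ?w (Some A) (Some B) D = 2 * (of_bool (cond A B D) - of_bool (cond B A D)) + ?n * (of_bool (D = A) + of_bool (D = B))"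
    if D: "D \<in> letters W" for D
  proof -
    \<comment> \<open>Both sides are doubled in order to compare integers without
      \<open>div\<close>.\<close>
    have "2 * coef ?w (Some A) (Some B) D = 2 * (2 * (of_bool (cond A B D) - of_bool (cond B A D)) + ?n * (of_bool (D = A) + of_bool (D = B)))"
    proof (cases "A = B")
      case True
      then show ?thesis by (simp add: coef_def n_w_occ c2 AB)
    next
      case False
      note ne = occ_distinct[OF c2[OF AB(1)] c2[OF AB(2)] False]
      note lt = occ_props(1)[OF c2[OF AB(1)]] occ_props(1)[OF c2[OF AB(2)]] occ_props(1)[OF c2[OF D]]
      have two: "2 * coef ?w (Some A) (Some B) D = hgt ?w (Some A) (occ_first ?w D) * hgt ?w (Some B) (occ_last ?w D)
          - hgt ?w (Some B) (occ_first ?w D) * hgt ?w (Some A) (occ_last ?w D)"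
        by (rule two_coef) (use c2 AB D in auto)
      have h: "hgt ?w (Some C) t = 2 * of_bool (occ_first ?w C < t \<and> t < occ_last ?w C)"
        if "t \<noteq> occ_first ?w C" "t \<noteq> occ_last ?w C" "occ_first ?w C < occ_last ?w C" for C t
        using that by (auto simp: hgt_def sgn_if)
      have h1: "hgt ?w (Some C) (occ_first ?w C) = 1" "hgt ?w (Some C) (occ_last ?w C) = 1"
        if "occ_first ?w C < occ_last ?w C" for C
        using that by (auto simp: hgt_def sgn_if)
      consider "D = A" | "D = B" | "D \<noteq> A" "D \<noteq> B" by blast
      then show ?thesis
      proof cases
        case 1
        have "2 * coef ?w (Some A) (Some B) D = 2 * of_bool (occ_first ?w B < occ_last ?w A \<and> occ_last ?w A < occ_last ?w B)
            - 2 * of_bool (occ_first ?w B < occ_first ?w A \<and> occ_first ?w A < occ_last ?w B)"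
          unfolding two unfolding 1 using lt ne by (simp add: h h1)
        then show ?thesis unfolding n_w_occ[OF c2[OF AB(1)] c2[OF AB(2)]]
          using False ne lt by (simp add: 1 cond_def) arith
      next
        case 2
        have "2 * coef ?w (Some A) (Some B) D = 2 * of_bool (occ_first ?w A < occ_first ?w B \<and> occ_first ?w B < occ_last ?w A)
            - 2 * of_bool (occ_first ?w A < occ_last ?w B \<and> occ_last ?w B < occ_last ?w A)"
          unfolding two unfolding 2 using lt ne by (simp add: h h1)
        then show ?thesis unfolding n_w_occ[OF c2[OF AB(1)] c2[OF AB(2)]]
          using False ne lt by (simp add: 2 cond_def) arith
      next
        case 3
        show ?thesis
          unfolding two
          using h[OF occ_distinct(1,2)[OF c2[OF D] c2[OF AB(1)] 3(1)] lt(1)] h[OF occ_distinct(1,2)[OF c2[OF D] c2[OF AB(2)] 3(2)] lt(2)]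
            h[OF occ_distinct(3,4)[OF c2[OF D] c2[OF AB(1)] 3(1)] lt(1)] h[OF occ_distinct(3,4)[OF c2[OF D] c2[OF AB(2)] 3(2)] lt(2)] 3
          by (simp add: cond_def of_bool_conj)
      qed
    qed
    then show ?thesis by simp
  qed
  have sel: "(\<Sum>D\<in>letters W. frag_cmul (k * of_bool (D = A)) (frag_of (proj W D))) = frag_cmul k (frag_of (proj W A))"
    if "A \<in> letters W" for A k
  proof -
    have "frag_cmul (k * of_bool (D = A)) (frag_of (proj W D)) = (if D = A then frag_cmul k (frag_of (proj W A)) else 0)" for D
      by simp
    then show ?thesis using that nwordD(4)[OF W] by (simp add: sum.delta)
  qed
  have "nw_form W (Some A) (Some B) = (\<Sum>D\<in>letters W.
      (frag_cmul 2 (frag_cmul (of_bool (cond A B D)) (frag_of (proj W D))) - frag_cmul 2 (frag_cmul (of_bool (cond B A D)) (frag_of (proj W D))))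
       + (frag_cmul (?n * of_bool (D = A)) (frag_of (proj W D)) + frag_cmul (?n * of_bool (D = B)) (frag_of (proj W D))))"
    unfolding nw_form_def
  proof (rule sum.cong)
    fix D assume D: "D \<in> letters W"
    show "frag_cmul (coef ?w (Some A) (Some B) D) (frag_of (proj W D)) =
      (frag_cmul 2 (frag_cmul (of_bool (cond A B D)) (frag_of (proj W D))) - frag_cmul 2 (frag_cmul (of_bool (cond B A D)) (frag_of (proj W D))))
       + (frag_cmul (?n * of_bool (D = A)) (frag_of (proj W D)) + frag_cmul (?n * of_bool (D = B)) (frag_of (proj W D)))"
      unfolding coef[OF D] by (rule poly_mapping_eqI) (simp add: lookup_add lookup_minus algebra_simps)
  qed simp
  also have "\<dots> = frag_cmul 2 (ci A B) - frag_cmul 2 (ci B A) + (frag_cmul ?n (frag_of (proj W A)) + frag_cmul ?n (frag_of (proj W B)))"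
    unfolding sum.distrib sum_subtractf sel[OF AB(1)] sel[OF AB(2)] ci_def frag_cmul_sum ..
  also have "\<dots> = frag_cmul 2 (ci A B - ci B A) + frag_cmul ?n (frag_of (proj W A) + frag_of (proj W B))"
    by (rule poly_mapping_eqI) (simp add: lookup_add lookup_minus algebra_simps)
  finally show ?thesis unfolding eq by simp
qed

text \<open>Against the constant height 1 the determinant is the difference of the heights of
  \<open>A\<close> at the two occurrences of \<open>D\<close>. It is 2, -2 or 0 according to how
  \<open>A\<close> and \<open>D\<close> interleave.\<close>

lemma e_w_base_cls:
  assumes W: "nword W" and A: "A \<in> letters W"
  shows "e_w_base al tau W A = cls (nw_form W (Some A) None)"
proof -
  let ?w = "word W"
  note c2 = nwordD(2)[OF W]
  have "n_w ?w A D = coef ?w (Some A) None D" if D: "D \<in> letters W" for D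
  proof -
    have two: "2 * coef ?w (Some A) None D = hgt ?w (Some A) (occ_first ?w D) * hgt ?w None (occ_last ?w D)
        - hgt ?w None (occ_first ?w D) * hgt ?w (Some A) (occ_last ?w D)"
      by (rule two_coef) (use c2 A D in auto)
    have "2 * n_w ?w A D = 2 * coef ?w (Some A) None D"
      unfolding two n_w_occ[OF c2[OF A] c2[OF D]]
      using occ_distinct[OF c2[OF A] c2[OF D]] occ_props(1)[OF c2[OF A]] occ_props(1)[OF c2[OF D]]
      by (cases "A = D") (auto simp: hgt_def sgn_if)
    then show ?thesis by simp
  qed
  then have "(\<Sum>D\<in>letters W. frag_cmul (n_w ?w A D) (frag_of (proj W D))) = nw_form W (Some A) None"
    unfolding nw_form_def by simp
  moreover have "e_w_base al tau W A = finprod PI (\<lambda>D. cls (frag_cmul (n_w ?w A D) (frag_of (proj W D)))) (letters W)"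
    unfolding e_w_base_def pi_gen_cls
    by (intro comm_monoid.finprod_cong' comm_group.axioms(1)[OF comm_group_PI])
      (auto simp: pow_cls frags_of nwordD(1)[OF W] intro!: cls_closed frags_closed nwordD(1)[OF W])
  moreover have "\<dots> = cls (\<Sum>D\<in>letters W. frag_cmul (n_w ?w A D) (frag_of (proj W D)))"
    by (rule finprod_cls) (intro frags_closed nwordD(1)[OF W])
  ultimately show ?thesis by simp
qed

lemma nw_form_skew:
  assumes W: "nword W" and "\<And>A. X = Some A \<Longrightarrow> A \<in> letters W" "\<And>A. Y = Some A \<Longrightarrow> A \<in> letters W"
  shows "nw_form W X Y = - nw_form W Y X"
proof -
  have "coef (word W) X Y D = - coef (word W) Y X D" if "D \<in> letters W" for D
    using two_coef[of X "word W" Y D] two_coef[of Y "word W" X D] assms that nwordD(2)[OF W] by fastforce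
  then show ?thesis
    unfolding nw_form_def by (simp add: sum_negf[symmetric])
qed

lemma nw_form_self: "nw_form W X X = 0"
  by (simp add: nw_form_def coef_def)

lemma nw_pairing_sel [simp]:
  "pset (npair W) = nset W" "pbase (npair W) = None"
  "pcirc (npair W) = Some ` letters W" "pproj (npair W) (Some A) = proj W A"
  by (auto simp: nw_pairing_def pcirc_def)

lemma rep_form_nw:
  assumes W: "nword W"
  shows "rep_form (npair W) (nw_form W)"
  unfolding rep_form_def
proof (intro ballI conjI)
  fix X Y assume XY: "X \<in> pset (npair W)" "Y \<in> pset (npair W)"
  show "nw_form W X Y \<in> frags" by (rule nw_form_frags[OF W])
  show "pform (npair W) X Y = cls (nw_form W X Y)"
  proof (cases X)
    case X: None
    show ?thesis
    proof (cases Y)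
      case None
      then show ?thesis using X by (simp add: nw_pairing_def nw_form_self one_PI)
    next
      case (Some B)
      then have B: "B \<in> letters W" using XY by auto
      then show ?thesis
        using X Some nw_form_skew[OF W, of None "Some B"] nw_form_frags[OF W]
        by (simp add: nw_pairing_def e_w_base_cls[OF W] inv_cls)
    qed
  next
    case X: (Some A)
    then have A: "A \<in> letters W" using XY by auto
    show ?thesis
      using X XY by (cases Y) (auto simp: nw_pairing_def e_w_base_cls[OF W A] e_w_cls[OF W A])
  qed
qed

lemma pairing_nw: "nword W \<Longrightarrow> pairing (npair W)"
  by (rule rep_form_pairing[OF _ _ _ rep_form_nw]) (auto simp: nwordD)

lemma skew_nw:
  assumes W: "nword W"
  shows "skew_symmetric al tau (npair W)"
  unfolding skew_iff[OF rep_form_nw[OF W]]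
proof (intro conjI ballI)
  fix X Y assume "X \<in> pset (npair W)" "Y \<in> pset (npair W)"
  then have "nw_form W X Y = - nw_form W Y X" by (intro nw_form_skew[OF W]) auto
  then show "nw_form W X Y + nw_form W Y X \<in> rels" using rels_zero by simp
qed (simp add: nw_form_self rels_zero)

end

section \<open>Surgery\<close>

definition hgt_vec :: "('l, 'a) nanoword \<Rightarrow> ('l option \<Rightarrow> int) \<Rightarrow> nat \<Rightarrow> int" where
  "hgt_vec W x t = (\<Sum>X\<in>nset W. x X * hgt (word W) X t)"

definition coef_vec :: "('l, 'a) nanoword \<Rightarrow> ('l option \<Rightarrow> int) \<Rightarrow> ('l option \<Rightarrow> int) \<Rightarrow> 'l \<Rightarrow> int" where
  "coef_vec W x y D = (\<Sum>X\<in>nset W. \<Sum>Y\<in>nset W.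
     x X * y Y * coef (word W) X Y D)"

lemma frag_cmul_sum_left: "frag_cmul (sum f I) z = (\<Sum>i\<in>I. frag_cmul (f i) z)"
  by (induction I rule: infinite_finite_induct) (auto simp: frag_cmul_distrib)

lemma bil_nw_form:
  "bil (nset W) (nw_form W) x y =
     (\<Sum>D\<in>letters W. frag_cmul (coef_vec W x y D) (frag_of (proj W D)))"
proof -
  let ?S = "nset W"
  have "bil ?S (nw_form W) x y = (\<Sum>X\<in>?S. \<Sum>Y\<in>?S. \<Sum>D\<in>letters W. frag_cmul (x X * y Y * coef (word W) X Y D) (frag_of (proj W D)))"
    unfolding bil_def nw_form_def frag_cmul_sum frag_cmul_cmul ..
  also have "\<dots> = (\<Sum>X\<in>?S. \<Sum>D\<in>letters W. \<Sum>Y\<in>?S. frag_cmul (x X * y Y * coef (word W) X Y D) (frag_of (proj W D)))"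
    by (intro sum.cong sum.swap refl)
  also have "\<dots> = (\<Sum>D\<in>letters W. \<Sum>X\<in>?S. \<Sum>Y\<in>?S. frag_cmul (x X * y Y * coef (word W) X Y D) (frag_of (proj W D)))"
    by (rule sum.swap)
  finally show ?thesis unfolding coef_vec_def frag_cmul_sum_left .
qed

text \<open>The determinant of heights is bilinear, so the value on two vectors depends only on
  their height functions. In the surgery argument a short vector enters through its height function
  alone.\<close>

lemma two_coef_vec:
  assumes "\<And>A. A \<in> letters W \<Longrightarrow> count_list (word W) A = 2" "D \<in> letters W"
  shows "2 * coef_vec W x y D =
     hgt_vec W x (occ_first (word W) D) * hgt_vec W y (occ_last (word W) D)
     - hgt_vec W y (occ_first (word W) D) * hgt_vec W x (occ_last (word W) D)"
proof -
  let ?S = "nset W" and ?w = "word W"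
  let ?i = "occ_first ?w D" and ?j = "occ_last ?w D"
  have *: "2 * (x X * y Y * coef ?w X Y D) = (x X * hgt ?w X ?i) * (y Y * hgt ?w Y ?j) - (x X * hgt ?w X ?j) * (y Y * hgt ?w Y ?i)"
    if "X \<in> ?S" "Y \<in> ?S" for X Y
  proof -
    have "2 * coef ?w X Y D = hgt ?w X ?i * hgt ?w Y ?j - hgt ?w Y ?i * hgt ?w X ?j"
      by (rule two_coef) (use assms that in auto)
    then have "x X * y Y * (2 * coef ?w X Y D) = x X * y Y * (hgt ?w X ?i * hgt ?w Y ?j - hgt ?w Y ?i * hgt ?w X ?j)"
      by simp
    then show ?thesis by (simp add: algebra_simps)
  qed
  have "2 * coef_vec W x y D = (\<Sum>X\<in>?S. \<Sum>Y\<in>?S. 2 * (x X * y Y * coef ?w X Y D))"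
    unfolding coef_vec_def sum_distrib_left ..
  also have "\<dots> = (\<Sum>X\<in>?S. \<Sum>Y\<in>?S. (x X * hgt ?w X ?i) * (y Y * hgt ?w Y ?j) - (x X * hgt ?w X ?j) * (y Y * hgt ?w Y ?i))"
    by (intro sum.cong refl *)
  also have "\<dots> = hgt_vec W x ?i * hgt_vec W y ?j - hgt_vec W x ?j * hgt_vec W y ?i"
    unfolding sum_subtractf hgt_vec_def sum_product ..
  finally show ?thesis by (simp add: mult.commute)
qed

lemma hgt_vec_unit:
  assumes "finite (letters W)" "X \<in> nset W"
  shows "hgt_vec W (unit_vec X) t = hgt (word W) X t"
proof -
  have "unit_vec X Y * hgt (word W) Y t = (if Y = X then hgt (word W) X t else 0)" for Y
    by (simp add: unit_vec_def)
  then show ?thesis unfolding hgt_vec_def using assms by (simp only: sum.delta finite_insert finite_imageI if_True)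
qed

lemma hgt_vec_add: "hgt_vec W (\<lambda>X. x X + k * y X) t = hgt_vec W x t + k * hgt_vec W y t"
  unfolding hgt_vec_def by (simp only: distrib_right sum.distrib mult.assoc sum_distrib_left)

lemma hgt_vec_zero: "hgt_vec W (\<lambda>X. 0) t = 0"
  unfolding hgt_vec_def by simp

text \<open>Deleting letters renumbers the surviving positions by an increasing map:
  \<open>K\<close> lists these positions, and \<open>\<phi>\<close> is indexing into
  \<open>K\<close>.\<close>

lemma occ_filter:
  assumes "\<And>A. A \<in> S \<Longrightarrow> count_list w A = 2" "\<And>A. A \<in> S \<Longrightarrow> P A"
  shows "\<exists>\<phi>. (\<forall>i j. i < j \<longrightarrow> j < length (filter P w) \<longrightarrow> \<phi> i < (\<phi> j :: nat)) \<and>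
    (\<forall>A\<in>S. count_list (filter P w) A = 2 \<and> occ_first w A = \<phi> (occ_first (filter P w) A) \<and>
       occ_last w A = \<phi> (occ_last (filter P w) A))"
proof -
  define K where "K = filter (\<lambda>i. P (w ! i)) [0..<length w]"
  have fK: "filter P w = map ((!) w) K"
  proof -
    have "filter P (map ((!) w) [0..<length w]) = map ((!) w) K"
      unfolding K_def filter_map comp_def ..
    then show ?thesis unfolding map_nth .
  qed
  have len: "length (filter P w) = length K" unfolding fK by simp
  have sorted: "sorted_wrt (<) K"
    unfolding K_def by (intro sorted_wrt_filter sorted_wrt_upt)
  have less: "K ! i < K ! j" if "i < j" "j < length K" for i j
    using sorted_wrt_nth_less[OF sorted that] .
  have c: "count_list (filter P w) A = 2" if "A \<in> S" for A
  proof -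
    have "filter ((=) A) (filter P w) = filter ((=) A) w"
      unfolding filter_filter using assms(2)[OF that] by (intro filter_cong) auto
    then show ?thesis using assms(1)[OF that] unfolding count_list_eq_length_filter by simp
  qed
  have occ: "occ_first w A = K ! (occ_first (filter P w) A)" "occ_last w A = K ! (occ_last (filter P w) A)" if A: "A \<in> S" for A
  proof -
    note o = occ_props[OF c[OF A], unfolded len]
    let ?i = "occ_first (filter P w) A" and ?j = "occ_last (filter P w) A"
    have ij: "?i < length K" "?j < length K" using o(1,2) by auto
    have "w ! (K ! ?i) = A" "w ! (K ! ?j) = A" using o(3,4) ij unfolding fK by simp_all
    moreover have "K ! ?j \<in> set K" using ij by simp
    then have "K ! ?j < length w" unfolding K_def by simp
    ultimately show "occ_first w A = K ! ?i" "occ_last w A = K ! ?j"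
      using occ_unique[OF assms(1)[OF A] less[OF o(1) ij(2)]] by auto
  qed
  show ?thesis
    by (rule exI[of _ "(!) K"]) (use less c occ len in auto)
qed

text \<open>Heights depend only on the order of positions, and deletion keeps this order.\<close>

lemma hgt_filter:
  assumes w: "\<And>A. A \<in> S \<Longrightarrow> count_list w A = 2" "\<And>A. A \<in> S \<Longrightarrow> P A"
    and X: "\<And>A. X = Some A \<Longrightarrow> A \<in> S" and D: "D \<in> S"
  shows "hgt (filter P w) X (occ_first (filter P w) D) = hgt w X (occ_first w D)"
    "hgt (filter P w) X (occ_last (filter P w) D) = hgt w X (occ_last w D)"
proof -
  have "\<exists>\<phi>. (\<forall>i j. i < j \<longrightarrow> j < length (filter P w) \<longrightarrow> \<phi> i < (\<phi> j :: nat)) \<and>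
    (\<forall>A\<in>S. count_list (filter P w) A = 2 \<and> occ_first w A = \<phi> (occ_first (filter P w) A) \<and>
       occ_last w A = \<phi> (occ_last (filter P w) A))"
    by (rule occ_filter) (fact w)+
  then obtain \<phi> where *: "\<forall>i j. i < j \<longrightarrow> j < length (filter P w) \<longrightarrow> \<phi> i < (\<phi> j :: nat)"
    "\<forall>A\<in>S. count_list (filter P w) A = 2 \<and> occ_first w A = \<phi> (occ_first (filter P w) A) \<and>
       occ_last w A = \<phi> (occ_last (filter P w) A)"
    by (elim exE conjE)
  have \<phi>: "\<phi> i < \<phi> j" if "i < j" "j < length (filter P w)" for i j
    using *(1) that by simp
  have \<phi>2: "count_list (filter P w) A = 2" and \<phi>3: "occ_first w A = \<phi> (occ_first (filter P w) A)"
    and \<phi>4: "occ_last w A = \<phi> (occ_last (filter P w) A)" if "A \<in> S" for A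
    using bspec[OF *(2) that] by simp_all
  have sg: "sgn (int (\<phi> i) - int (\<phi> j)) = sgn (int i - int j)" if "i < length (filter P w)" "j < length (filter P w)" for i j
    using \<phi>[of i j] \<phi>[of j i] that by (cases i j rule: linorder_cases) auto
  have l: "occ_first (filter P w) A < length (filter P w)" "occ_last (filter P w) A < length (filter P w)" if "A \<in> S" for A
    using occ_props(1,2)[OF \<phi>2[OF that]] by auto
  show "hgt (filter P w) X (occ_first (filter P w) D) = hgt w X (occ_first w D)"
    "hgt (filter P w) X (occ_last (filter P w) D) = hgt w X (occ_last w D)"
    using X l[OF D] sg[of "occ_first (filter P w) D"] sg[of "occ_last (filter P w) D"] l
    by (cases X; simp add: hgt_def \<phi>3[OF D] \<phi>4[OF D]; simp add: \<phi>3 \<phi>4)+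
qed

context inv_set
begin

text \<open>Fixed points have a condition of their own: because of 2-torsion,
  \<open>g b + g b\<close> can be a relator without \<open>g b\<close> being one.\<close>

lemma rels_sum_involution:
  assumes "finite B" "\<And>b. b \<in> B \<Longrightarrow> \<iota> b \<in> B" "\<And>b. b \<in> B \<Longrightarrow> \<iota> (\<iota> b) = b"
    and "\<And>b. b \<in> B \<Longrightarrow> \<iota> b = b \<Longrightarrow> g b \<in> rels" "\<And>b. b \<in> B \<Longrightarrow> \<iota> b \<noteq> b \<Longrightarrow> g b + g (\<iota> b) \<in> rels"
  shows "sum g B \<in> rels"
  using assms
proof (induction "card B" arbitrary: B rule: less_induct)
  case less
  show ?case
  proof (cases "B = {}")
    case True
    then show ?thesis using rels_zero by simp
  next
    case False
    then obtain b where b: "b \<in> B" by blast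
    have IH: "sum g (B - {b, \<iota> b}) \<in> rels"
    proof (rule less.hyps)
      show "card (B - {b, \<iota> b}) < card B" using b less.prems(1) by (intro psubset_card_mono) auto
      show "finite (B - {b, \<iota> b})" using less.prems(1) by simp
      fix d assume d: "d \<in> B - {b, \<iota> b}"
      show "\<iota> d \<in> B - {b, \<iota> b}"
        using d less.prems(2)[of d] less.prems(3)[of d] less.prems(3)[OF b] by auto
    qed (use less.prems in auto)
    have "sum g {b, \<iota> b} \<in> rels"
      using less.prems(4,5)[OF b] by (cases "\<iota> b = b") auto
    moreover have "sum g B = sum g (B - {b, \<iota> b}) + sum g {b, \<iota> b}"
      using b less.prems(1,2) by (intro sum.subset_diff) auto
    ultimately show ?thesis using IH rels_add by simp
  qed
qed

end

text \<open>\<open>\<rho>\<close> reverses every word \<open>v\<^sub>r\<close> in place, and \<open>bl\<close> maps a position to \<open>r\<close> if it lies in \<open>v\<^sub>r\<close> and to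
  \<open>0\<close> if it lies outside.\<close>

locale surgery_data = inv_set al tau for al :: "'a set" and tau :: "'a \<Rightarrow> 'a" +
  fixes W W' :: "('l, 'a) nanoword" and B :: "'l set" and \<iota> :: "'l \<Rightarrow> 'l" and \<rho> bl :: "nat \<Rightarrow> nat"
  assumes nW: "is_nanoword al W" "is_nanoword al W'"
    and W': "letters W' = letters W - B" "proj W' = proj W" "word W' = filter (\<lambda>A. A \<notin> B) (word W)"
    and B: "B \<subseteq> letters W"
    and \<iota>: "\<And>b. b \<in> B \<Longrightarrow> \<iota> b \<in> B" "\<And>b. b \<in> B \<Longrightarrow> \<iota> (\<iota> b) = b"
    and \<rho>: "\<And>t. t < length (word W) \<Longrightarrow> \<rho> t < length (word W)"
      "\<And>t. t < length (word W) \<Longrightarrow> bl (\<rho> t) = bl t"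
      "\<And>t. t < length (word W) \<Longrightarrow> word W ! t \<notin> B \<Longrightarrow> bl t = 0 \<and> \<rho> t = t"
      "\<And>t. t < length (word W) \<Longrightarrow> word W ! t \<in> B \<Longrightarrow> bl t \<noteq> 0 \<and> \<rho> t \<noteq> t \<and> word W ! \<rho> t = \<iota> (word W ! t)"
      "\<And>t u. t < u \<Longrightarrow> u < length (word W) \<Longrightarrow> bl t = bl u \<Longrightarrow> bl t \<noteq> 0 \<Longrightarrow> \<rho> u < \<rho> t"
      "\<And>t u. t < u \<Longrightarrow> u < length (word W) \<Longrightarrow> bl t \<noteq> bl u \<or> bl t = 0 \<Longrightarrow> \<rho> t < \<rho> u"
    and conv: "\<And>t u v. t < u \<Longrightarrow> u < v \<Longrightarrow> v < length (word W) \<Longrightarrow> bl t = bl v \<Longrightarrow> bl t \<noteq> 0 \<Longrightarrow> bl u = bl t"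
    and pr: "\<And>b. b \<in> B \<Longrightarrow> proj W (\<iota> b) =
        (if bl (occ_first (word W) b) = bl (occ_last (word W) b) then proj W b else tau (proj W b))"
begin

abbreviation "w \<equiv> word W"
abbreviation "n \<equiv> length (word W)"
abbreviation "fst_occ \<equiv> occ_first (word W)"
abbreviation "lst_occ \<equiv> occ_last (word W)"

text \<open>The case \<open>\<epsilon> = 0\<close>: both occurrences lie in the same word
  \<open>v\<^sub>r\<close>.\<close>

definition "inner b \<longleftrightarrow> bl (fst_occ b) = bl (lst_occ b)"

definition S :: "nat \<Rightarrow> nat \<Rightarrow> int" where "S t u = sgn (int t - int u)"

section \<open>Heights under the reversal\<close>

lemma hgt_S: "hgt w (Some A) t = S t (fst_occ A) - S t (lst_occ A)"
  by (simp add: hgt_def S_def)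

lemma S_minus: "S u t = - S t u"
  unfolding S_def by (simp add: sgn_if)

lemma S_\<rho>:
  assumes "t < n" "u < n"
  shows "S (\<rho> t) (\<rho> u) = (if bl t = bl u \<and> bl t \<noteq> 0 then - S t u else S t u)"
  using \<rho>(5)[of t u] \<rho>(5)[of u t] \<rho>(6)[of t u] \<rho>(6)[of u t] assms
  by (cases t u rule: linorder_cases) (auto simp: S_def)

text \<open>Each word occupies an interval of positions, so a position elsewhere lies on the same
  side of all of them.\<close>

lemma S_block:
  assumes "t < n" "t' < n" "u < n" "bl t = bl t'" "bl t \<noteq> 0" "bl u \<noteq> bl t"
  shows "S t u = S t' u"
proof -
  have "t \<noteq> u" "t' \<noteq> u" using assms by auto
  then show ?thesis
    using conv[of t u t'] conv[of t' u t] assms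
    by (cases "t < u"; cases "t' < u") (auto simp: S_def)
qed

lemma letter:
  assumes "A \<in> letters W"
  shows "count_list w A = 2" "fst_occ A < n" "lst_occ A < n" "fst_occ A < lst_occ A" "w ! fst_occ A = A" "w ! lst_occ A = A"
  using nwordD(2)[OF nW(1) assms] occ_props[OF nwordD(2)[OF nW(1) assms]] by auto

lemma outer_letter:
  assumes "A \<in> letters W - B"
  shows "\<rho> (fst_occ A) = fst_occ A" "\<rho> (lst_occ A) = lst_occ A" "bl (fst_occ A) = 0" "bl (lst_occ A) = 0"
  using assms \<rho>(3)[of "fst_occ A"] \<rho>(3)[of "lst_occ A"] letter[of A] by auto

lemma B_letter:
  assumes "b \<in> B"
  shows "b \<in> letters W" "bl (fst_occ b) \<noteq> 0" "bl (lst_occ b) \<noteq> 0"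
    "w ! \<rho> (fst_occ b) = \<iota> b" "w ! \<rho> (lst_occ b) = \<iota> b" "\<rho> (fst_occ b) < n" "\<rho> (lst_occ b) < n" "\<rho> (fst_occ b) \<noteq> fst_occ b"
proof -
  show b: "b \<in> letters W" using assms B by auto
  show "bl (fst_occ b) \<noteq> 0" "bl (lst_occ b) \<noteq> 0"
    "w ! \<rho> (fst_occ b) = \<iota> b" "w ! \<rho> (lst_occ b) = \<iota> b" "\<rho> (fst_occ b) < n" "\<rho> (lst_occ b) < n" "\<rho> (fst_occ b) \<noteq> fst_occ b"
    using \<rho>(1,4)[of "fst_occ b"] \<rho>(1,4)[of "lst_occ b"] letter[OF b] assms by auto
qed

text \<open>Reversing a word that contains both occurrences exchanges their order. This exchange is
  what later negates the coefficient of \<open>\<iota> b\<close>.\<close>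

lemma occ_inner:
  assumes "b \<in> B" "inner b"
  shows "fst_occ (\<iota> b) = \<rho> (lst_occ b)" "lst_occ (\<iota> b) = \<rho> (fst_occ b)"
proof -
  note b = B_letter[OF assms(1)]
  have "\<rho> (lst_occ b) < \<rho> (fst_occ b)"
    using \<rho>(5)[OF letter(4)[OF b(1)] letter(3)[OF b(1)]] assms(2) b(2) by (simp add: inner_def)
  moreover have "count_list w (\<iota> b) = 2" using letter(1) B_letter(1)[OF \<iota>(1)[OF assms(1)]] by simp
  ultimately show "fst_occ (\<iota> b) = \<rho> (lst_occ b)" "lst_occ (\<iota> b) = \<rho> (fst_occ b)"
    using occ_unique[of w "\<iota> b"] b by auto
qed

lemma occ_not_inner:
  assumes "b \<in> B" "\<not> inner b"
  shows "fst_occ (\<iota> b) = \<rho> (fst_occ b)" "lst_occ (\<iota> b) = \<rho> (lst_occ b)"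
proof -
  note b = B_letter[OF assms(1)]
  have "\<rho> (fst_occ b) < \<rho> (lst_occ b)"
    using \<rho>(6)[OF letter(4)[OF b(1)] letter(3)[OF b(1)]] assms(2) by (simp add: inner_def)
  moreover have "count_list w (\<iota> b) = 2" using letter(1) B_letter(1)[OF \<iota>(1)[OF assms(1)]] by simp
  ultimately show "fst_occ (\<iota> b) = \<rho> (fst_occ b)" "lst_occ (\<iota> b) = \<rho> (lst_occ b)"
    using occ_unique[of w "\<iota> b"] b by auto
qed

lemma inner_\<iota>: "b \<in> B \<Longrightarrow> inner (\<iota> b) \<longleftrightarrow> inner b"
proof -
  assume b: "b \<in> B"
  note l = letter(2,3)[OF B_letter(1)[OF b]]
  show ?thesis
  proof (cases "inner b")
    case True
    then show ?thesis using occ_inner[OF b True] \<rho>(2)[OF l(1)] \<rho>(2)[OF l(2)] by (simp add: inner_def)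
  next
    case False
    then show ?thesis using occ_not_inner[OF b False] \<rho>(2)[OF l(1)] \<rho>(2)[OF l(2)] by (simp add: inner_def)
  qed
qed

text \<open>A fixed point of \<open>\<iota>\<close> that is not inner would sit in the middle of a word \<open>v\<^sub>r\<close>, whose length is even.\<close>

lemma fixed_inner: "b \<in> B \<Longrightarrow> \<iota> b = b \<Longrightarrow> inner b"
  using occ_not_inner(1)[of b] B_letter(8)[of b] by auto

lemma hgt_outer: "A \<in> letters W - B \<Longrightarrow> t < n \<Longrightarrow> hgt w (Some A) (\<rho> t) = hgt w (Some A) t"
  using S_\<rho>[of t "fst_occ A"] S_\<rho>[of t "lst_occ A"] outer_letter[of A] letter(2,3)[of A]
  by (simp add: hgt_S)

lemma hgt_inner_outside:
  assumes b: "b \<in> B" "inner b" and t: "t < n" "bl t \<noteq> bl (fst_occ b)"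
  shows "hgt w (Some b) t = 0"
proof -
  note bl = B_letter[OF b(1)]
  have "S (fst_occ b) t = S (lst_occ b) t"
    using b t bl letter(2,3)[OF bl(1)] by (intro S_block) (auto simp: inner_def)
  then show ?thesis unfolding hgt_S S_minus[of t] by simp
qed

text \<open>Inside the word, the reversal negates both signs in the height and also exchanges the
  two ends of the interval, and the effects cancel. Elsewhere both heights are 0, since the interval
  does not leave its word.\<close>

lemma hgt_inner:
  assumes b: "b \<in> B" "inner b" and t: "t < n"
  shows "hgt w (Some (\<iota> b)) (\<rho> t) = hgt w (Some b) t"
proof -
  note bl = B_letter[OF b(1)] and l = letter(2,3)[OF B_letter(1)[OF b(1)]]
  show ?thesis
  proof (cases "bl t = bl (fst_occ b)")
    case True
    then show ?thesis
      unfolding hgt_S occ_inner[OF b] S_\<rho>[OF t l(1)] S_\<rho>[OF t l(2)] using b(2) bl by (simp add: inner_def)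
  next
    case False
    have "bl (\<rho> t) \<noteq> bl (fst_occ (\<iota> b))"
      using False occ_inner[OF b] \<rho>(2)[OF t] \<rho>(2)[OF l(2)] b(2) by (simp add: inner_def)
    then show ?thesis
      using hgt_inner_outside[OF b t False] hgt_inner_outside[OF \<iota>(1)[OF b(1)], of "\<rho> t"] inner_\<iota>[OF b(1)] b(2) \<rho>(1)[OF t] by simp
  qed
qed

lemma hgt_not_inner_far:
  assumes b: "b \<in> B" "\<not> inner b" and t: "t < n" "bl t \<noteq> bl (fst_occ b)" "bl t \<noteq> bl (lst_occ b)"
  shows "hgt w (Some (\<iota> b)) (\<rho> t) = hgt w (Some b) t"
  using S_\<rho>[OF t(1) letter(2)[OF B_letter(1)[OF b(1)]]] S_\<rho>[OF t(1) letter(3)[OF B_letter(1)[OF b(1)]]] t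
  by (simp add: hgt_S occ_not_inner[OF b])

text \<open>Near one occurrence, the other occurrence contributes the constant 1 to the height, and
  the near one contributes a sign that the reversal flips. The height is thus reflected about 1,
  hence the 2.\<close>

lemma hgt_not_inner_near:
  assumes b: "b \<in> B" "\<not> inner b" and t: "t < n" "bl t = bl (fst_occ b) \<or> bl t = bl (lst_occ b)"
  shows "hgt w (Some (\<iota> b)) (\<rho> t) = 2 - hgt w (Some b) t"
proof -
  note bl = B_letter[OF b(1)] and l = letter(2,3,4)[OF B_letter(1)[OF b(1)]]
  have ne: "bl (fst_occ b) \<noteq> bl (lst_occ b)" using b(2) by (simp add: inner_def)
  from t(2) show ?thesis
  proof
    assume *: "bl t = bl (fst_occ b)"
    have "S t (lst_occ b) = S (fst_occ b) (lst_occ b)"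
      using * ne t l bl by (intro S_block) auto
    then have "S t (lst_occ b) = -1" using l(3) by (simp add: S_def)
    then show ?thesis
      unfolding hgt_S occ_not_inner[OF b] S_\<rho>[OF t(1) l(1)] S_\<rho>[OF t(1) l(2)] using * ne bl by simp
  next
    assume *: "bl t = bl (lst_occ b)"
    have "S t (fst_occ b) = S (lst_occ b) (fst_occ b)"
      using * ne t l bl by (intro S_block) auto
    then have "S t (fst_occ b) = 1" using l(3) by (simp add: S_def)
    then show ?thesis
      unfolding hgt_S occ_not_inner[OF b] S_\<rho>[OF t(1) l(1)] S_\<rho>[OF t(1) l(2)] using * ne bl by simp
  qed
qed

text \<open>The occurrences of \<open>b\<close> and \<open>\<iota> b\<close> lie in the same two
  words, and from a position outside of these words the two intervals look alike.\<close>

lemma hgt_not_inner_outside: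
  assumes b: "b \<in> B" "\<not> inner b" and t: "t < n" "bl t \<noteq> bl (fst_occ b)" "bl t \<noteq> bl (lst_occ b)"
  shows "hgt w (Some (\<iota> b)) t = hgt w (Some b) t"
proof (cases "bl t = 0")
  case True
  have "\<rho> t = t" using True \<rho>(3)[OF t(1)] \<rho>(4)[OF t(1)] by auto
  then show ?thesis using hgt_not_inner_far[OF b t] by simp
next
  \<comment> \<open>In a third word the position may be moved by \<open>\<rho>\<close>, which
    carries it past no occurrence of \<open>b\<close> or \<open>\<iota> b\<close>.\<close>
  case False
  note l = letter(2,3)[OF B_letter(1)[OF b(1)]] and l' = letter(2,3)[OF B_letter(1)[OF \<iota>(1)[OF b(1)]]]
  have "S t u = S (\<rho> t) u" if "u < n" "bl u \<noteq> bl t" for u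
    using False that t \<rho>(1,2)[OF t(1)] by (intro S_block) auto
  moreover have "bl (fst_occ (\<iota> b)) = bl (fst_occ b)" "bl (lst_occ (\<iota> b)) = bl (lst_occ b)"
    using occ_not_inner[OF b] \<rho>(2) l by simp_all
  ultimately have "hgt w (Some (\<iota> b)) t = hgt w (Some (\<iota> b)) (\<rho> t)"
    unfolding hgt_S using l' t by simp
  then show ?thesis using hgt_not_inner_far[OF b t] by simp
qed

text \<open>The coefficient of \<open>\<iota> b\<close> in the short vector of \<open>b\<close>. It
  is dictated by the projections: \<open>|\<iota> b|\<close> is \<open>|b|\<close> in the inner case
  and \<open>tau |b|\<close> otherwise. A fixed letter forms a vector by itself.\<close>

definition sg :: "'l \<Rightarrow> int" where
  "sg b = (if \<iota> b = b then 0 else if inner b then 1 else -1)"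

lemma sg_\<iota>: "b \<in> B \<Longrightarrow> sg (\<iota> b) = sg b"
  unfolding sg_def using \<iota>(2)[of b] inner_\<iota>[of b] by auto

text \<open>For inner letters the reversal exchanges the two heights, so their sum is invariant. For
  a letter in two words a height \<open>h\<close> may turn into 2 minus the height of the partner;
  the constants cancel in the difference of the two heights but would not in their sum.\<close>

lemma hgt_pair_invariant:
  assumes b: "b \<in> B" and t: "t < n"
  shows "hgt w (Some b) (\<rho> t) + sg b * hgt w (Some (\<iota> b)) (\<rho> t) = hgt w (Some b) t + sg b * hgt w (Some (\<iota> b)) t"
proof (cases "inner b")
  case True
  have "hgt w (Some (\<iota> b)) (\<rho> t) = hgt w (Some b) t" by (rule hgt_inner[OF b True t])
  moreover have "hgt w (Some b) (\<rho> t) = hgt w (Some (\<iota> b)) t"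
    using hgt_inner[OF \<iota>(1)[OF b] _ t] inner_\<iota>[OF b] True \<iota>(2)[OF b] by simp
  ultimately show ?thesis using True by (auto simp: sg_def)
next
  case False
  have sg: "sg b = -1" using False fixed_inner[OF b] by (auto simp: sg_def)
  have F': "\<iota> b \<in> B" "\<not> inner (\<iota> b)" "\<iota> (\<iota> b) = b" using \<iota> b inner_\<iota>[OF b] False by auto
  have bls: "bl (fst_occ (\<iota> b)) = bl (fst_occ b)" "bl (lst_occ (\<iota> b)) = bl (lst_occ b)"
    using occ_not_inner[OF b False] \<rho>(2) letter(2,3)[OF B_letter(1)[OF b]] by simp_all
  show ?thesis
  proof (cases "bl t = bl (fst_occ b) \<or> bl t = bl (lst_occ b)")
    case True
    then have "hgt w (Some (\<iota> b)) (\<rho> t) = 2 - hgt w (Some b) t" "hgt w (Some b) (\<rho> t) = 2 - hgt w (Some (\<iota> b)) t"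
      using hgt_not_inner_near[OF b False t] hgt_not_inner_near[OF F'(1,2) t] bls F'(3) by simp_all
    then show ?thesis unfolding sg by simp
  next
    case out: False
    have "hgt w (Some (\<iota> b)) t = hgt w (Some b) t" by (rule hgt_not_inner_outside[OF b False t]) (use out in auto)
    moreover have "hgt w (Some (\<iota> b)) (\<rho> t) = hgt w (Some b) (\<rho> t)"
      by (rule hgt_not_inner_outside[OF b False \<rho>(1)[OF t]]) (use out \<rho>(2)[OF t] in auto)
    ultimately show ?thesis unfolding sg by simp
  qed
qed

lemma hgt_pair_outside:
  assumes b: "b \<in> B" and t: "t < n" "bl t = 0"
  shows "hgt w (Some b) t + sg b * hgt w (Some (\<iota> b)) t = 0"
proof (cases "inner b")
  case True
  have "hgt w (Some b) t = 0"
    using B_letter[OF b] t by (intro hgt_inner_outside[OF b True]) auto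
  moreover have "hgt w (Some (\<iota> b)) t = 0"
    using B_letter[OF \<iota>(1)[OF b]] t inner_\<iota>[OF b] True by (intro hgt_inner_outside[OF \<iota>(1)[OF b]]) auto
  ultimately show ?thesis by simp
next
  case False
  have sg: "sg b = -1" using False fixed_inner[OF b] by (auto simp: sg_def)
  have "hgt w (Some (\<iota> b)) t = hgt w (Some b) t"
    by (rule hgt_not_inner_outside[OF b False t(1)]) (use B_letter[OF b] t in auto)
  then show ?thesis unfolding sg by simp
qed

text \<open>If both occurrences of \<open>b\<close> lie in one word, passing to
  \<open>\<iota> b\<close> exchanges them and negates the determinant, while \<open>|b|\<close>
  stays. Otherwise the determinant stays and \<open>|b|\<close> becomes \<open>tau |b|\<close>,
  which gives a multiple of a relator. A fixed letter is inner, so its integer coefficient equals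
  its own negative.\<close>

lemma coef_sum_rels:
  assumes x: "\<And>t. t < n \<Longrightarrow> hgt_vec W x (\<rho> t) = hgt_vec W x t"
    and y: "\<And>t. t < n \<Longrightarrow> hgt_vec W y (\<rho> t) = hgt_vec W y t"
  shows "(\<Sum>b\<in>B. frag_cmul (coef_vec W x y b) (frag_of (proj W b))) \<in> rels"
proof (rule rels_sum_involution[where \<iota> = \<iota>])
  show "finite B" using B nwordD(4)[OF nW(1)] finite_subset by blast
  have two: "2 * coef_vec W x y D = hgt_vec W x (fst_occ D) * hgt_vec W y (lst_occ D) - hgt_vec W y (fst_occ D) * hgt_vec W x (lst_occ D)"
    if "D \<in> letters W" for D
    by (rule two_coef_vec[OF nwordD(2)[OF nW(1)] that])
  have \<kappa>: "coef_vec W x y (\<iota> b) = (if inner b then - coef_vec W x y b else coef_vec W x y b)" if b: "b \<in> B" for b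
  proof -
    note l = letter(2,3)[OF B_letter(1)[OF b]]
    show ?thesis
      using two[OF B_letter(1)[OF b]] two[OF B_letter(1)[OF \<iota>(1)[OF b]]] x[OF l(1)] x[OF l(2)] y[OF l(1)] y[OF l(2)]
        occ_inner[OF b] occ_not_inner[OF b]
      by (cases "inner b") (simp_all add: mult.commute)
  qed
  fix b assume b: "b \<in> B"
  show "\<iota> b \<in> B" "\<iota> (\<iota> b) = b" using \<iota> b by auto
  have al: "proj W b \<in> al" using nwordD(1)[OF nW(1) B_letter(1)[OF b]] .
  show "frag_cmul (coef_vec W x y b) (frag_of (proj W b)) \<in> rels" if "\<iota> b = b"
  proof -
    have "coef_vec W x y b = 0" using \<kappa>[OF b] fixed_inner[OF b that] that by simp
    then show ?thesis using rels_zero by simp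
  qed
  show "frag_cmul (coef_vec W x y b) (frag_of (proj W b)) + frag_cmul (coef_vec W x y (\<iota> b)) (frag_of (proj W (\<iota> b))) \<in> rels"
  proof (cases "inner b")
    case True
    then have "proj W (\<iota> b) = proj W b" using pr[OF b] by (simp add: inner_def)
    then show ?thesis using \<kappa>[OF b] True rels_zero by (simp flip: frag_cmul_distrib)
  next
    case False
    then have "proj W (\<iota> b) = tau (proj W b)" using pr[OF b] by (simp add: inner_def)
    then show ?thesis
      using \<kappa>[OF b] False rels_cmul[OF rels_pair[OF al]] by (simp add: frag_cmul_distrib2)
  qed
qed

lemma surgery_cobordant: "npair W \<sim>\<^sub>p npair W'"
proof -
  let ?p = "npair W" and ?q = "npair W'"
  let ?P = "?p \<oplus>\<^sub>p Opp ?q" and ?C = "letters W - B"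
  define M where "M X = (case X of None \<Rightarrow> None
     | Some (Inl None) \<Rightarrow> None
     | Some (Inr None) \<Rightarrow> None
     | Some (Inl (Some A)) \<Rightarrow> if A \<in> B then Some (Inl (Some (\<iota> A))) else Some (Inr (Some A))
     | Some (Inr (Some A)) \<Rightarrow> Some (Inl (Some A)))" for X :: "('l option + 'l option) option"
  define C where "C X = (case X of Some (Inl (Some A)) \<Rightarrow> if A \<in> B then sg A else 1 | Some (Inr (Some A)) \<Rightarrow> 1 | _ \<Rightarrow> 0)"
    for X :: "('l option + 'l option) option"
  have M: "M None = None" "A \<in> B \<Longrightarrow> M (Some (Inl (Some A))) = Some (Inl (Some (\<iota> A)))"
      "A \<notin> B \<Longrightarrow> M (Some (Inl (Some A))) = Some (Inr (Some A))" "M (Some (Inr (Some A))) = Some (Inl (Some A))" for A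
    by (simp_all add: M_def)
  have C: "C None = 0" "A \<in> B \<Longrightarrow> C (Some (Inl (Some A))) = sg A"
      "A \<notin> B \<Longrightarrow> C (Some (Inl (Some A))) = 1" "C (Some (Inr (Some A))) = 1" for A
    by (simp_all add: C_def)
  have p: "pairing ?p" "pairing ?q" using pairing_nw nW by auto
  note fin = nwordD(4)[OF nW(1)] nwordD(4)[OF nW(2)]
  have cases: "X = None \<or> (\<exists>A\<in>?C. X = Some (Inl (Some A)) \<or> X = Some (Inr (Some A))) \<or> (\<exists>b\<in>B. X = Some (Inl (Some b)))"
    if "X \<in> pset ?P" for X
    using that W'(1) by auto
  have sg3: "sg b \<in> {-1, 0, 1}" "sg b = 0 \<longleftrightarrow> \<iota> b = b" "b \<in> B \<Longrightarrow> proj W (\<iota> b) = (if sg b = -1 then tau (proj W b) else proj W b)" for b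
    using pr[of b] by (auto simp: sg_def inner_def)
  have mat: "matching tau (pset ?P) (pbase ?P) (pproj ?P) M C"
  proof (rule matchingI)
    show "M (pbase ?P) = pbase ?P" "C (pbase ?P) = 0" by (simp_all add: M C)
    fix X assume X: "X \<in> pset ?P - {pbase ?P}"
    show "M X \<in> pset ?P - {pbase ?P} \<and> M (M X) = X \<and> C X \<in> {-1,0,1} \<and> (C X = 0 \<longleftrightarrow> M X = X)
       \<and> C (M X) = C X \<and> pproj ?P (M X) = (if C X = -1 then tau (pproj ?P X) else pproj ?P X)"
    proof -
      have "X \<in> pset ?P" "X \<noteq> None" using X by auto
      from cases[OF this(1)] show ?thesis
      proof (elim disjE bexE)
        assume "X = None"
        then show ?thesis using \<open>X \<noteq> None\<close> by simp
      next
        fix A assume "A \<in> ?C" "X = Some (Inl (Some A))"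
        then show ?thesis by (simp add: M C W')
      next
        fix A assume "A \<in> ?C" "X = Some (Inr (Some A))"
        then show ?thesis by (simp add: M C W')
      next
        fix b assume b: "b \<in> B" "X = Some (Inl (Some b))"
        then have "\<iota> b \<in> letters W" "\<iota> b \<in> B" "\<iota> (\<iota> b) = b" using \<iota> B by auto
        then show ?thesis using b sg3[of b] sg_\<iota>[of b] by (simp add: M C)
      qed
    qed
  qed
  let ?xl = "\<lambda>X A. match_vec M C X (p_inl ?p A)" and ?xr = "\<lambda>X A. match_vec M C X (p_inr (Opp ?q) A)"
  have vec: "(\<exists>Y\<in>insert None (Some ` ?C). ?xl X = unit_vec Y \<and> ?xr X = unit_vec Y) \<or>
      (\<exists>b\<in>B. ?xl X = (\<lambda>Z. unit_vec (Some b) Z + sg b * unit_vec (Some (\<iota> b)) Z) \<and> ?xr X = (\<lambda>Z. 0))"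
    if "X \<in> pset ?P" for X
    using cases[OF that]
  proof (elim disjE bexE)
    assume "X = None"
    then have "?xl X = unit_vec None \<and> ?xr X = unit_vec None"
      by (auto simp: fun_eq_iff match_vec_def unit_vec_def p_inl_def p_inr_def M C)
    then show ?thesis by (intro disjI1 bexI[of _ None]) simp_all
  next
    fix A assume A: "A \<in> ?C" "X = Some (Inl (Some A))"
    then have "?xl X = unit_vec (Some A) \<and> ?xr X = unit_vec (Some A)"
      by (auto simp: fun_eq_iff match_vec_def unit_vec_def p_inl_def p_inr_def M C)
    then show ?thesis using A(1) by (intro disjI1 bexI[of _ "Some A"]) simp_all
  next
    fix A assume A: "A \<in> ?C" "X = Some (Inr (Some A))"
    then have "?xl X = unit_vec (Some A) \<and> ?xr X = unit_vec (Some A)"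
      by (auto simp: fun_eq_iff match_vec_def unit_vec_def p_inl_def p_inr_def M C)
    then show ?thesis using A(1) by (intro disjI1 bexI[of _ "Some A"]) simp_all
  next
    fix b assume b: "b \<in> B" "X = Some (Inl (Some b))"
    then have "?xl X = (\<lambda>Z. unit_vec (Some b) Z + sg b * unit_vec (Some (\<iota> b)) Z) \<and> ?xr X = (\<lambda>Z. 0)"
      by (auto simp: fun_eq_iff match_vec_def unit_vec_def p_inl_def p_inr_def M C)
    then show ?thesis using b(1) by (intro disjI2 bexI[of _ b]) simp_all
  qed
  have inv: "hgt_vec W (?xl X) (\<rho> t) = hgt_vec W (?xl X) t" if X: "X \<in> pset ?P" and t: "t < n" for X t
    using vec[OF X]
  proof (elim disjE bexE conjE)
    fix Y assume Y: "Y \<in> insert None (Some ` ?C)" "?xl X = unit_vec Y"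
    have "hgt w Y (\<rho> t) = hgt w Y t"
      using Y(1) hgt_outer[OF _ t] by (auto simp: hgt_def[of _ None])
    moreover have "Y \<in> nset W" using Y(1) by auto
    ultimately show ?thesis unfolding Y(2) using hgt_vec_unit[OF fin(1)] by simp
  next
    fix b assume b: "b \<in> B" "?xl X = (\<lambda>Z. unit_vec (Some b) Z + sg b * unit_vec (Some (\<iota> b)) Z)"
    have "Some b \<in> nset W" "Some (\<iota> b) \<in> nset W"
      using b(1) \<iota>(1) B by auto
    then show ?thesis unfolding b(2) hgt_vec_add using hgt_vec_unit[OF fin(1)] hgt_pair_invariant[OF b(1) t] by simp
  qed
  \<comment> \<open>The vector of a removed letter restricts to zero on \<open>W'\<close>, so its
    height in \<open>W\<close> has to vanish at the occurrences of surviving letters;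
    \<open>hgt_pair_outside\<close> provides this.\<close>
  have out: "hgt_vec W' (?xr X) (occ_first (word W') D) = hgt_vec W (?xl X) (fst_occ D)"
       "hgt_vec W' (?xr X) (occ_last (word W') D) = hgt_vec W (?xl X) (lst_occ D)"
    if X: "X \<in> pset ?P" and D: "D \<in> ?C" for X D
  proof -
    have l: "fst_occ D < n" "lst_occ D < n" "bl (fst_occ D) = 0" "bl (lst_occ D) = 0"
      using letter(2,3)[of D] outer_letter(3,4)[OF D] D by auto
    have "hgt_vec W' (?xr X) (occ_first (word W') D) = hgt_vec W (?xl X) (fst_occ D) \<and>
       hgt_vec W' (?xr X) (occ_last (word W') D) = hgt_vec W (?xl X) (lst_occ D)"
      using vec[OF X]
    proof (elim disjE bexE conjE)
      fix Y assume Y: "Y \<in> insert None (Some ` ?C)" "?xl X = unit_vec Y" "?xr X = unit_vec Y"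
      have Y1: "Y \<in> nset W" "Y \<in> nset W'" using Y(1) W'(1) by auto
      have "hgt (word W') Y (occ_first (word W') D) = hgt w Y (fst_occ D)" "hgt (word W') Y (occ_last (word W') D) = hgt w Y (lst_occ D)"
        unfolding W'(3) by (rule hgt_filter[of ?C]; use letter(1) Y(1) D in auto)+
      then show ?thesis unfolding Y(2,3) hgt_vec_unit[OF fin(1) Y1(1)] hgt_vec_unit[OF fin(2) Y1(2)] by simp
    next
      fix b assume b: "b \<in> B" "?xl X = (\<lambda>Z. unit_vec (Some b) Z + sg b * unit_vec (Some (\<iota> b)) Z)" "?xr X = (\<lambda>Z. 0)"
      have "Some b \<in> nset W" "Some (\<iota> b) \<in> nset W"
        using b(1) \<iota>(1) B by auto
      then show ?thesis
        unfolding b(2,3) hgt_vec_add hgt_vec_zero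
        using hgt_vec_unit[OF fin(1)] hgt_pair_outside[OF b(1) l(1,3)] hgt_pair_outside[OF b(1) l(2,4)] by simp
    qed
    then show "hgt_vec W' (?xr X) (occ_first (word W') D) = hgt_vec W (?xl X) (fst_occ D)"
       "hgt_vec W' (?xr X) (occ_last (word W') D) = hgt_vec W (?xl X) (lst_occ D)" by blast+
  qed
  show ?thesis
    unfolding p_cobordant_def
  proof (rule matching_imp_hyperbolic[OF _ _ mat])
    show "pairing ?P" using p by (intro pairing_sum pairing_opposite)
    show "rep_form ?P (sum_form ?p (Opp ?q) (nw_form W) (\<lambda>A B. - nw_form W' A B))"
      by (intro rep_form_sum p pairing_opposite rep_form_opposite rep_form_nw nW)
    fix X Y assume XY: "X \<in> pset ?P" "Y \<in> pset ?P"
    \<comment> \<open>Hence the contributions of the surviving letters to the two forms cancel, and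
      only the sum over \<open>B\<close> is left.\<close>
    have eq: "coef_vec W' (?xr X) (?xr Y) D = coef_vec W (?xl X) (?xl Y) D" if D: "D \<in> ?C" for D
    proof -
      have "D \<in> letters W'" "D \<in> letters W" using D W'(1) by auto
      then have "2 * coef_vec W' (?xr X) (?xr Y) D = 2 * coef_vec W (?xl X) (?xl Y) D"
        by (simp only: two_coef_vec[OF nwordD(2)[OF nW(1)]] two_coef_vec[OF nwordD(2)[OF nW(2)]] out[OF XY(1) D] out[OF XY(2) D])
      then show ?thesis by simp
    qed
    have "bil (pset ?P) (sum_form ?p (Opp ?q) (nw_form W) (\<lambda>A B. - nw_form W' A B)) (match_vec M C X) (match_vec M C Y) =
       bil (pset ?p) (nw_form W) (?xl X) (?xl Y) + bil (pset (Opp ?q)) (\<lambda>A B. - nw_form W' A B) (?xr X) (?xr Y)"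
      by (rule bil_sum_form) (use fin in simp_all)
    also have "\<dots> = (\<Sum>D\<in>letters W. frag_cmul (coef_vec W (?xl X) (?xl Y) D) (frag_of (proj W D)))
        - (\<Sum>D\<in>letters W'. frag_cmul (coef_vec W' (?xr X) (?xr Y) D) (frag_of (proj W' D)))"
      by (simp only: bil_minus_form p_opposite_sel nw_pairing_sel bil_nw_form add_uminus_conv_diff)
    also have "(\<Sum>D\<in>letters W. frag_cmul (coef_vec W (?xl X) (?xl Y) D) (frag_of (proj W D))) =
       (\<Sum>D\<in>?C. frag_cmul (coef_vec W (?xl X) (?xl Y) D) (frag_of (proj W D))) +
       (\<Sum>D\<in>B. frag_cmul (coef_vec W (?xl X) (?xl Y) D) (frag_of (proj W D)))"
      by (rule sum.subset_diff[OF B fin(1)])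
    also have "(\<Sum>D\<in>letters W'. frag_cmul (coef_vec W' (?xr X) (?xr Y) D) (frag_of (proj W' D))) =
       (\<Sum>D\<in>?C. frag_cmul (coef_vec W (?xl X) (?xl Y) D) (frag_of (proj W D)))"
      unfolding W'(1,2) by (rule sum.cong) (simp_all only: eq)
    finally have "bil (pset ?P) (sum_form ?p (Opp ?q) (nw_form W) (\<lambda>A B. - nw_form W' A B)) (match_vec M C X) (match_vec M C Y) =
       (\<Sum>D\<in>B. frag_cmul (coef_vec W (?xl X) (?xl Y) D) (frag_of (proj W D)))" by simp
    then show "bil (pset ?P) (sum_form ?p (Opp ?q) (nw_form W) (\<lambda>A B. - nw_form W' A B)) (match_vec M C X) (match_vec M C Y) \<in> rels"
      using coef_sum_rels[OF inv[OF XY(1)] inv[OF XY(2)]] by simp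
  qed
qed

end

section \<open>Construction of the reversal from a factorisation of the word\<close>

lemma two_le_count_list: "2 \<le> count_list v b \<longleftrightarrow> (\<exists>u<length v. \<exists>t<u. v ! t = b \<and> v ! u = b)"
proof -
  let ?S = "{i. i < length v \<and> b = v ! i}"
  have "2 \<le> count_list v b \<longleftrightarrow> \<not> card ?S \<le> Suc 0"
    unfolding count_list_eq_length_filter length_filter_conv_card by auto
  also have "\<dots> \<longleftrightarrow> (\<exists>i\<in>?S. \<exists>j\<in>?S. i \<noteq> j)"
    by (subst card_le_Suc0_iff_eq) auto
  also have "\<dots> \<longleftrightarrow> (\<exists>u<length v. \<exists>t<u. v ! t = b \<and> v ! u = b)"
  proof
    assume "\<exists>i\<in>?S. \<exists>j\<in>?S. i \<noteq> j"
    then obtain i j where "i < length v" "j < length v" "v ! i = b" "v ! j = b" "i \<noteq> j" by auto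
    then show "\<exists>u<length v. \<exists>t<u. v ! t = b \<and> v ! u = b"
      by (cases "i < j") (auto simp: not_less_iff_gr_or_eq)
  next
    assume "\<exists>u<length v. \<exists>t<u. v ! t = b \<and> v ! u = b"
    then obtain u t where "u < length v" "t < u" "v ! t = b" "v ! u = b" by auto
    then show "\<exists>i\<in>?S. \<exists>j\<in>?S. i \<noteq> j"
      by (intro bexI[of _ t] bexI[of _ u]) auto
  qed
  finally show ?thesis .
qed

text \<open>The conditions on \<open>\<rho>\<close> and \<open>bl\<close> in a form that can be
  built up piece by piece. The last two clauses relate equal nonzero labels to words containing a
  letter twice. They count with \<open>2 \<le>\<close> because nothing bounds the number of
  occurrences by 2 in a single piece.\<close>

definition reversal ::
    "'l list \<Rightarrow> 'l list list \<Rightarrow> 'l set \<Rightarrow> ('l \<Rightarrow> 'l) \<Rightarrow> (nat \<Rightarrow> nat) \<Rightarrow> (nat \<Rightarrow> nat) \<Rightarrow> bool" where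
  "reversal w vs B \<iota> \<rho> bl \<longleftrightarrow>
    (\<forall>t<length w. \<rho> t < length w \<and> bl (\<rho> t) = bl t \<and> (w ! t \<notin> B \<longrightarrow> bl t = 0 \<and> \<rho> t = t) \<and>
       (w ! t \<in> B \<longrightarrow> bl t \<noteq> 0 \<and> \<rho> t \<noteq> t \<and> w ! \<rho> t = \<iota> (w ! t))) \<and>
    (\<forall>u<length w. \<forall>t<u. if bl t = bl u \<and> bl t \<noteq> 0 then \<rho> u < \<rho> t else \<rho> t < \<rho> u) \<and>
    (\<forall>v<length w. \<forall>u<v. \<forall>t<u. bl t = bl v \<and> bl t \<noteq> 0 \<longrightarrow> bl u = bl t) \<and>
    (\<forall>u<length w. \<forall>t<u. bl t = bl u \<and> bl t \<noteq> 0 \<and> w ! t = w ! u \<longrightarrow> (\<exists>v\<in>set vs. 2 \<le> count_list v (w ! t))) \<and>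
    (\<forall>v\<in>set vs. \<forall>b. 2 \<le> count_list v b \<longrightarrow>
       (\<exists>u<length w. \<exists>t<u. bl t = bl u \<and> bl t \<noteq> 0 \<and> w ! t = b \<and> w ! u = b))"

lemma reversalD:
  assumes "reversal w vs B \<iota> \<rho> bl"
  shows "t < length w \<Longrightarrow> \<rho> t < length w" "t < length w \<Longrightarrow> bl (\<rho> t) = bl t"
    "t < length w \<Longrightarrow> w ! t \<notin> B \<Longrightarrow> bl t = 0 \<and> \<rho> t = t"
    "t < length w \<Longrightarrow> w ! t \<in> B \<Longrightarrow> bl t \<noteq> 0 \<and> \<rho> t \<noteq> t \<and> w ! \<rho> t = \<iota> (w ! t)"
    "t < u \<Longrightarrow> u < length w \<Longrightarrow> if bl t = bl u \<and> bl t \<noteq> 0 then \<rho> u < \<rho> t else \<rho> t < \<rho> u"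
    "t < u \<Longrightarrow> u < k \<Longrightarrow> k < length w \<Longrightarrow> bl t = bl k \<Longrightarrow> bl t \<noteq> 0 \<Longrightarrow> bl u = bl t"
    "t < u \<Longrightarrow> u < length w \<Longrightarrow> bl t = bl u \<Longrightarrow> bl t \<noteq> 0 \<Longrightarrow> w ! t = w ! u \<Longrightarrow> \<exists>v\<in>set vs. 2 \<le> count_list v (w ! t)"
    "v \<in> set vs \<Longrightarrow> 2 \<le> count_list v b \<Longrightarrow>
       \<exists>u<length w. \<exists>t<u. bl t = bl u \<and> bl t \<noteq> 0 \<and> w ! t = b \<and> w ! u = b"
  using assms unfolding reversal_def by simp_all

lemma reversal_outer: "set x \<inter> B = {} \<Longrightarrow> reversal x [] B \<iota> (\<lambda>t. t) (\<lambda>t. 0)"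
  unfolding reversal_def by (auto dest: nth_mem)

lemma reversal_block:
  assumes "set v \<subseteq> B" "map \<iota> v = rev v" "even (length v)"
  shows "reversal v [v] B \<iota> (\<lambda>t. length v - 1 - t) (\<lambda>t. 1)"
proof -
  have 1: "v ! (length v - 1 - t) = \<iota> (v ! t)" if "t < length v" for t
    using arg_cong[OF assms(2), of "\<lambda>l. l ! t"] that by (simp add: rev_nth)
  \<comment> \<open>This is where evenness enters: a position fixed by the reversal would be the
    middle of a word of odd length.\<close>
  have 2: "length v - 1 - t \<noteq> t" if "t < length v" for t
  proof
    assume "length v - 1 - t = t"
    then have "length v = 2 * t + 1" using that by linarith
    then show False using assms(3) by simp
  qed
  have 3: "v ! t \<in> B" if "t < length v" for t
    using assms(1) that by (meson nth_mem subsetD)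
  show ?thesis
    unfolding reversal_def using 1 2 3 two_le_count_list[of v] by (fastforce simp: Bex_def)
qed

lemma reversal_append:
  assumes 1: "reversal w1 vs1 B \<iota> \<rho>1 bl1" and 2: "reversal w2 vs2 B \<iota> \<rho>2 bl2"
  shows "\<exists>\<rho> bl. reversal (w1 @ w2) (vs1 @ vs2) B \<iota> \<rho> bl"
proof -
  let ?a = "length w1"
  \<comment> \<open>An upper bound for the labels of \<open>w1\<close>, so that adding it to the
    nonzero labels of \<open>w2\<close> makes them new. The label 0 stays 0, because it marks the
    positions outside of all words.\<close>
  define N where "N = (\<Sum>t<?a. bl1 t)"
  define \<rho> where "\<rho> t = (if t < ?a then \<rho>1 t else ?a + \<rho>2 (t - ?a))" for t
  define bl where "bl t = (if t < ?a then bl1 t else if bl2 (t - ?a) = 0 then 0 else N + bl2 (t - ?a))" for t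
  have N: "bl1 t \<le> N" if "t < ?a" for t
    unfolding N_def using that by (intro member_le_sum) auto
  have p1: "\<rho> t = \<rho>1 t" "bl t = bl1 t" "(w1 @ w2) ! t = w1 ! t" if "t < ?a" for t
    using that by (simp_all add: \<rho>_def bl_def nth_append)
  have p2: "\<rho> (?a + t) = ?a + \<rho>2 t" "bl (?a + t) = (if bl2 t = 0 then 0 else N + bl2 t)" "(w1 @ w2) ! (?a + t) = w2 ! t" for t
    by (simp_all add: \<rho>_def bl_def nth_append)
  have a: "\<rho>1 t < ?a" "bl1 (\<rho>1 t) = bl1 t" "w1 ! t \<notin> B \<Longrightarrow> bl1 t = 0 \<and> \<rho>1 t = t"
     "w1 ! t \<in> B \<Longrightarrow> bl1 t \<noteq> 0 \<and> \<rho>1 t \<noteq> t \<and> w1 ! \<rho>1 t = \<iota> (w1 ! t)" if "t < ?a" for t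
    using reversalD(1-4)[OF 1 that] by blast+
  have b: "\<rho>2 t < length w2" "bl2 (\<rho>2 t) = bl2 t" "w2 ! t \<notin> B \<Longrightarrow> bl2 t = 0 \<and> \<rho>2 t = t"
     "w2 ! t \<in> B \<Longrightarrow> bl2 t \<noteq> 0 \<and> \<rho>2 t \<noteq> t \<and> w2 ! \<rho>2 t = \<iota> (w2 ! t)" if "t < length w2" for t
    using reversalD(1-4)[OF 2 that] by blast+
  have split: "t < ?a \<or> (\<exists>t'. t = ?a + t' \<and> t' < length w2)" if "t < length (w1 @ w2)" for t
    using that by (cases "t < ?a") (auto intro!: exI[of _ "t - ?a"])
  have sep: "\<not> (bl t = bl (?a + u) \<and> bl t \<noteq> 0)" if "t < ?a" for t u
    using N[OF that] p1(2)[OF that] p2(2)[of u] by auto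
  have "reversal (w1 @ w2) (vs1 @ vs2) B \<iota> \<rho> bl"
    unfolding reversal_def
  proof (intro conjI)
    show "\<forall>t<length (w1 @ w2). \<rho> t < length (w1 @ w2) \<and> bl (\<rho> t) = bl t \<and> ((w1 @ w2) ! t \<notin> B \<longrightarrow> bl t = 0 \<and> \<rho> t = t) \<and>
       ((w1 @ w2) ! t \<in> B \<longrightarrow> bl t \<noteq> 0 \<and> \<rho> t \<noteq> t \<and> (w1 @ w2) ! \<rho> t = \<iota> ((w1 @ w2) ! t))"
    proof (intro allI impI)
      fix t assume "t < length (w1 @ w2)"
      from split[OF this] show "\<rho> t < length (w1 @ w2) \<and> bl (\<rho> t) = bl t \<and> ((w1 @ w2) ! t \<notin> B \<longrightarrow> bl t = 0 \<and> \<rho> t = t) \<and>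
       ((w1 @ w2) ! t \<in> B \<longrightarrow> bl t \<noteq> 0 \<and> \<rho> t \<noteq> t \<and> (w1 @ w2) ! \<rho> t = \<iota> ((w1 @ w2) ! t))"
      proof
        assume t: "t < ?a"
        then show ?thesis using a[OF t] p1[OF t] p1[OF a(1)[OF t]] by simp
      next
        assume "\<exists>t'. t = ?a + t' \<and> t' < length w2"
        then obtain t' where t: "t = ?a + t'" "t' < length w2" by blast
        then show ?thesis using b[OF t(2)] by (cases "w2 ! t' \<in> B") (simp_all add: p2)
      qed
    qed
    show "\<forall>u<length (w1 @ w2). \<forall>t<u. if bl t = bl u \<and> bl t \<noteq> 0 then \<rho> u < \<rho> t else \<rho> t < \<rho> u"
    proof (intro allI impI)
      fix u t assume u: "u < length (w1 @ w2)" and t: "t < u"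
      from split[OF u] show "if bl t = bl u \<and> bl t \<noteq> 0 then \<rho> u < \<rho> t else \<rho> t < \<rho> u"
      proof
        assume u: "u < ?a"
        then have t': "t < ?a" using t by simp
        show ?thesis unfolding p1[OF u] p1[OF t'] by (rule reversalD(5)[OF 1 t u])
      next
        assume "\<exists>t'. u = ?a + t' \<and> t' < length w2"
        then obtain u' where u': "u = ?a + u'" "u' < length w2" by blast
        show ?thesis
        proof (cases "t < ?a")
          case True
          then show ?thesis using sep[OF True, of u'] a(1)[OF True] u' by (auto simp: p1(1)[OF True] p2(1))
        next
          case False
          then obtain t' where t': "t = ?a + t'" "t' < u'" using t u' by (metis le_add_diff_inverse linorder_not_less nat_add_left_cancel_less)
          have "if bl2 t' = bl2 u' \<and> bl2 t' \<noteq> 0 then \<rho>2 u' < \<rho>2 t' else \<rho>2 t' < \<rho>2 u'"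
            by (rule reversalD(5)[OF 2 t'(2) u'(2)])
          then show ?thesis unfolding t' u' p2 by (auto split: if_splits)
        qed
      qed
    qed
    show "\<forall>v<length (w1 @ w2). \<forall>u<v. \<forall>t<u. bl t = bl v \<and> bl t \<noteq> 0 \<longrightarrow> bl u = bl t"
    proof (intro allI impI)
      fix v u t assume v: "v < length (w1 @ w2)" and ut: "u < v" "t < u" and e: "bl t = bl v \<and> bl t \<noteq> 0"
      from split[OF v] show "bl u = bl t"
      proof
        assume v: "v < ?a"
        then have "u < ?a" "t < ?a" using ut by auto
        then show ?thesis
          using reversalD(6)[OF 1 ut(2,1) v] e unfolding p1(2)[OF v] p1(2)[OF \<open>u < ?a\<close>] p1(2)[OF \<open>t < ?a\<close>] by simp
      next
        assume "\<exists>t'. v = ?a + t' \<and> t' < length w2"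
        then obtain v' where v': "v = ?a + v'" "v' < length w2" by blast
        have nt: "\<not> t < ?a" using sep[of t v'] e v' by auto
        then obtain t' where t': "t = ?a + t'" by (metis le_add_diff_inverse linorder_not_less)
        obtain u' where u': "u = ?a + u'" using nt ut by (metis le_add_diff_inverse linorder_not_less order_less_trans)
        have c: "u' < v'" "t' < u'" using ut t' u' v' by auto
        have "bl2 t' = bl2 v' \<and> bl2 t' \<noteq> 0" using e unfolding t' v' p2 by (auto split: if_splits)
        then have "bl2 u' = bl2 t'" using reversalD(6)[OF 2 c(2,1) v'(2)] by simp
        then show ?thesis unfolding t' u' p2 by simp
      qed
    qed
    show "\<forall>u<length (w1 @ w2). \<forall>t<u. bl t = bl u \<and> bl t \<noteq> 0 \<and> (w1 @ w2) ! t = (w1 @ w2) ! u \<longrightarrow>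
        (\<exists>v\<in>set (vs1 @ vs2). 2 \<le> count_list v ((w1 @ w2) ! t))"
    proof (intro allI impI)
      fix u t assume u: "u < length (w1 @ w2)" and t: "t < u"
        and e: "bl t = bl u \<and> bl t \<noteq> 0 \<and> (w1 @ w2) ! t = (w1 @ w2) ! u"
      from split[OF u] show "\<exists>v\<in>set (vs1 @ vs2). 2 \<le> count_list v ((w1 @ w2) ! t)"
      proof
        assume u: "u < ?a"
        then have t': "t < ?a" using t by simp
        have "\<exists>v\<in>set vs1. 2 \<le> count_list v (w1 ! t)"
          using reversalD(7)[OF 1 t u] e unfolding p1[OF u] p1[OF t'] by simp
        then show ?thesis unfolding p1[OF t'] by auto
      next
        assume "\<exists>t'. u = ?a + t' \<and> t' < length w2"
        then obtain u' where u': "u = ?a + u'" "u' < length w2" by blast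
        have nt: "\<not> t < ?a" using sep[of t u'] e u' by auto
        then obtain t' where t': "t = ?a + t'" by (metis le_add_diff_inverse linorder_not_less)
        have "bl2 t' = bl2 u' \<and> bl2 t' \<noteq> 0" using e unfolding t' u' p2 by (auto split: if_splits)
        moreover have "w2 ! t' = w2 ! u'" using e unfolding t' u' p2 by simp
        moreover have "t' < u'" using t t' u' by simp
        ultimately have "\<exists>v\<in>set vs2. 2 \<le> count_list v (w2 ! t')"
          using reversalD(7)[OF 2 _ u'(2)] by simp
        then show ?thesis unfolding t' p2 by auto
      qed
    qed
    show "\<forall>v\<in>set (vs1 @ vs2). \<forall>b. 2 \<le> count_list v b \<longrightarrow>
       (\<exists>u<length (w1 @ w2). \<exists>t<u. bl t = bl u \<and> bl t \<noteq> 0 \<and> (w1 @ w2) ! t = b \<and> (w1 @ w2) ! u = b)"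
    proof (intro ballI allI impI)
      fix v b assume v: "v \<in> set (vs1 @ vs2)" and c: "2 \<le> count_list v b"
      from v consider "v \<in> set vs1" | "v \<in> set vs2" by auto
      then show "\<exists>u<length (w1 @ w2). \<exists>t<u. bl t = bl u \<and> bl t \<noteq> 0 \<and> (w1 @ w2) ! t = b \<and> (w1 @ w2) ! u = b"
      proof cases
        case v: 1
        obtain u t where ut: "u < length w1" "t < u" "bl1 t = bl1 u" "bl1 t \<noteq> 0" "w1 ! t = b" "w1 ! u = b"
          using reversalD(8)[OF 1 v c] by (elim exE conjE)
        then have "t < ?a" by simp
        then show ?thesis using ut p1[OF ut(1)] p1[OF \<open>t < ?a\<close>] by (intro exI[of _ u] conjI exI[of _ t]) auto
      next
        case v: 2
        obtain u t where "u < length w2" "t < u" "bl2 t = bl2 u" "bl2 t \<noteq> 0" "w2 ! t = b" "w2 ! u = b"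
          using reversalD(8)[OF 2 v c] by (elim exE conjE)
        then show ?thesis by (intro exI[of _ "?a + u"] conjI exI[of _ "?a + t"]) (auto simp: p2)
      qed
    qed
  qed
  then show ?thesis by blast
qed

lemma reversal_exists:
  assumes "length xs = length vs" "set (concat xs @ y) \<inter> B = {}"
    "\<And>v. v \<in> set vs \<Longrightarrow> set v \<subseteq> B \<and> map \<iota> v = rev v \<and> even (length v)"
  shows "\<exists>\<rho> bl. reversal (concat (map2 (@) xs vs) @ y) vs B \<iota> \<rho> bl"
  using assms
proof (induction xs vs rule: list_induct2)
  case Nil
  then show ?case using reversal_outer[of y B \<iota>] by auto
next
  case (Cons x xs v vs)
  obtain \<rho> bl where 1: "reversal (concat (map2 (@) xs vs) @ y) vs B \<iota> \<rho> bl"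
    using Cons by auto
  obtain \<rho>' bl' where 2: "reversal (v @ (concat (map2 (@) xs vs) @ y)) ([v] @ vs) B \<iota> \<rho>' bl'"
    using reversal_append[OF reversal_block 1] Cons.prems by (metis list.set_intros(1))
  have "set x \<inter> B = {}" using Cons.prems by auto
  from reversal_append[OF reversal_outer[OF this] 2] show ?case by simp
qed

lemma filter_interleave:
  assumes "length xs = length vs" "set (concat xs @ y) \<inter> B = {}" "set (concat vs) \<subseteq> B"
  shows "filter (\<lambda>A. A \<notin> B) (concat (map2 (@) xs vs) @ y) = concat xs @ y"
  using assms
proof (induction xs vs rule: list_induct2)
  case Nil
  then show ?case by (auto simp: filter_id_conv)
next
  case (Cons x xs v vs)
  have "filter (\<lambda>A. A \<notin> B) x = x" "filter (\<lambda>A. A \<notin> B) v = []"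
    using Cons.prems by (auto simp: filter_id_conv filter_empty_conv)
  then show ?case using Cons by (auto simp: Int_Un_distrib2)
qed

lemma count_list_concat: "v \<in> set vs \<Longrightarrow> count_list v b \<le> count_list (concat vs) b"
  by (induction vs) (auto simp: trans_le_add2)

context inv_set
begin

lemma cob_surgery:
  assumes nW: "nword W" "nword W'" and surg: "surgery al tau W W'"
  shows "npair W \<sim>\<^sub>p npair W'"
proof -
  obtain B vs xs y where B: "B \<subseteq> letters W" and phrase: "is_nanophrase al (proj W) B vs"
    and ev: "even_phrase vs" and sym: "symmetric_phrase tau (proj W) B vs"
    and xs: "length xs = length vs" "set (concat xs @ y) \<subseteq> letters W - B"
    and word: "word W = concat (map2 (@) xs vs) @ y"
    and W': "W' = \<lparr>letters = letters W - B, proj = proj W, word = concat xs @ y\<rparr>"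
    using surg unfolding surgery_def by metis
  obtain \<iota> where bij: "bij_betw \<iota> B B" and rev: "\<And>v. v \<in> set vs \<Longrightarrow> map \<iota> v = rev v"
    and proj: "\<And>b. b \<in> B \<Longrightarrow> proj W (\<iota> b) = (tau ^^ phrase_eps vs b) (proj W b)"
    using sym unfolding symmetric_phrase_def by metis
  have vsB: "set (concat vs) \<subseteq> B" and c2: "\<And>b. b \<in> B \<Longrightarrow> count_list (concat vs) b = 2"
    using phrase by (auto simp: is_nanophrase_def)
  have disj: "set (concat xs @ y) \<inter> B = {}" using xs by auto
  have "\<exists>\<rho> bl. reversal (word W) vs B \<iota> \<rho> bl"
    unfolding word by (rule reversal_exists[OF xs(1) disj]) (use vsB rev ev in \<open>auto simp: even_phrase_def\<close>)
  then obtain \<rho> bl where R: "reversal (word W) vs B \<iota> \<rho> bl" by blast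
  have \<iota>B: "\<iota> b \<in> B" if "b \<in> B" for b using bij that by (auto simp: bij_betw_def)
  \<comment> \<open>A symmetry is given as a bijection. It is an involution because reversing a word
    twice restores it and every letter of \<open>B\<close> occurs in some word.\<close>
  have \<iota>\<iota>: "\<iota> (\<iota> b) = b" if b: "b \<in> B" for b
  proof -
    have "b \<in> set (concat vs)" using c2[OF b] count_notin[of b "concat vs"] by fastforce
    then obtain v where v: "v \<in> set vs" "b \<in> set v" by auto
    have "map (\<lambda>b. \<iota> (\<iota> b)) v = map \<iota> (map \<iota> v)" by simp
    also have "\<dots> = map id v" by (simp add: rev[OF v(1)] rev_map[symmetric])
    finally show ?thesis using v(2) unfolding map_eq_conv by auto
  qed
  \<comment> \<open>Connects the labels with \<open>phrase_eps\<close>, which decides between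
    \<open>|b|\<close> and \<open>tau |b|\<close>.\<close>
  have inner: "bl (occ_first (word W) b) = bl (occ_last (word W) b) \<longleftrightarrow> (\<exists>v\<in>set vs. count_list v b = 2)" if b: "b \<in> B" for b
  proof
    have bW: "b \<in> letters W" using B b by auto
    note occ = occ_props[OF nwordD(2)[OF nW(1) bW]]
    assume "bl (occ_first (word W) b) = bl (occ_last (word W) b)"
    moreover have "bl (occ_first (word W) b) \<noteq> 0" using reversalD(4)[OF R, of "occ_first (word W) b"] b occ(1-3) by simp
    ultimately have "\<exists>v\<in>set vs. 2 \<le> count_list v (word W ! occ_first (word W) b)"
      using reversalD(7)[OF R occ(1,2)] occ(3,4) by simp
    then obtain v where "v \<in> set vs" "2 \<le> count_list v b" using occ(3) by auto
    then show "\<exists>v\<in>set vs. count_list v b = 2" using count_list_concat[of v vs b] c2[OF b] by force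
  next
    have bW: "b \<in> letters W" using B b by auto
    assume "\<exists>v\<in>set vs. count_list v b = 2"
    then obtain v where "v \<in> set vs" "2 \<le> count_list v b" by force
    then obtain u t where ut: "u < length (word W)" "t < u" "bl t = bl u" "word W ! t = b" "word W ! u = b"
      using reversalD(8)[OF R] by metis
    show "bl (occ_first (word W) b) = bl (occ_last (word W) b)"
      using occ_unique[OF nwordD(2)[OF nW(1) bW] ut(2,1,4,5)] ut(3) by simp
  qed
  have "surgery_data al tau W W' B \<iota> \<rho> bl"
  proof (unfold_locales)
    show "is_nanoword al W" "is_nanoword al W'" by (fact nW)+
    show "letters W' = letters W - B" "proj W' = proj W" unfolding W' by simp_all
    show "word W' = filter (\<lambda>A. A \<notin> B) (word W)"
      unfolding word W' using filter_interleave[OF xs(1) disj vsB] by simp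
    show "B \<subseteq> letters W" by (fact B)
    show "\<And>b. b \<in> B \<Longrightarrow> \<iota> b \<in> B" "\<And>b. b \<in> B \<Longrightarrow> \<iota> (\<iota> b) = b" by (fact \<iota>B \<iota>\<iota>)+
    show "proj W (\<iota> b) = (if bl (occ_first (word W) b) = bl (occ_last (word W) b) then proj W b else tau (proj W b))"
      if "b \<in> B" for b
      unfolding inner[OF that] proj[OF that] phrase_eps_def by simp
  qed (use reversalD(1-4,6)[OF R] reversalD(5)[OF R, unfolded if_bool_eq_conj] in \<open>simp_all\<close>)
  then show ?thesis by (rule surgery_data.surgery_cobordant)
qed

end

text \<open>\<open>AA\<close> is a factor with one word, which has length two and equals its own
  reverse. The identity is a symmetry of it, with \<open>phrase_eps\<close> equal to 0.\<close>

lemma move1_surgery: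
  assumes W: "is_nanoword al W" and "move1 W W'"
  shows "surgery al tau W W'"
proof -
  obtain x y A where w: "word W = x @ [A, A] @ y" "W' = \<lparr>letters = letters W - {A}, proj = proj W, word = x @ y\<rparr>"
    using assms(2) unfolding move1_def by blast
  have A: "A \<in> letters W" "proj W A \<in> al" "count_list (word W) A = 2" "set (word W) \<subseteq> letters W"
    using W w by (auto simp: is_nanoword_def)
  then have nA: "A \<notin> set x" "A \<notin> set y"
    using w(1) by (auto simp: count_list_0_iff)
  show ?thesis
    unfolding surgery_def
  proof (intro exI conjI)
    show "is_nanophrase al (proj W) {A} [[A, A]]" using A by (simp add: is_nanophrase_def)
    show "even_phrase [[A, A]]" by (simp add: even_phrase_def)
    show "symmetric_phrase tau (proj W) {A} [[A, A]]"
      unfolding symmetric_phrase_def by (intro exI[of _ id]) (simp add: phrase_eps_def)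
    show "length [x] = length [[A, A]]" by simp
    show "set (concat [x] @ y) \<subseteq> letters W - {A}" using A nA w by auto
  qed (use A w in simp_all)
qed

text \<open>The factor consists of the two words \<open>AB\<close> and \<open>BA\<close>, and the
  symmetry exchanges \<open>A\<close> and \<open>B\<close>. Each letter occurs in both words, so
  \<open>phrase_eps\<close> is 1 and symmetry asks for \<open>|B| = tau |A|\<close> and
  \<open>|A| = tau |B|\<close>.\<close>

lemma move2_surgery:
  assumes W: "is_nanoword al W" and inv: "involution_on al tau" and "move2 tau W W'"
  shows "surgery al tau W W'"
proof -
  obtain x y z A B where w: "word W = x @ [A, B] @ y @ [B, A] @ z" "proj W B = tau (proj W A)"
     "W' = \<lparr>letters = letters W - {A, B}, proj = proj W, word = x @ y @ z\<rparr>"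
    using assms(3) unfolding move2_def by blast
  have A: "A \<in> letters W" "proj W A \<in> al" "count_list (word W) A = 2" "set (word W) \<subseteq> letters W"
      "B \<in> letters W" "proj W B \<in> al" "count_list (word W) B = 2"
    using W w by (auto simp: is_nanoword_def)
  have "A \<noteq> B" using A(3) w(1) by auto
  then have nA: "A \<notin> set x" "A \<notin> set y" "A \<notin> set z" "B \<notin> set x" "B \<notin> set y" "B \<notin> set z"
    using w(1) A(3,7) by (auto simp: count_list_0_iff)
  have tt: "tau (proj W B) = proj W A" using inv A w by (simp add: involution_on_def)
  let ?\<iota> = "\<lambda>C. if C = A then B else A"
  show ?thesis
    unfolding surgery_def
  proof (intro exI conjI)
    show "is_nanophrase al (proj W) {A, B} [[A, B], [B, A]]" using A \<open>A \<noteq> B\<close> by (simp add: is_nanophrase_def)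
    show "even_phrase [[A, B], [B, A]]" by (simp add: even_phrase_def)
    have "bij_betw ?\<iota> {A, B} {A, B}" using \<open>A \<noteq> B\<close> by (auto simp: bij_betw_def inj_on_def)
    then show "symmetric_phrase tau (proj W) {A, B} [[A, B], [B, A]]"
      unfolding symmetric_phrase_def using \<open>A \<noteq> B\<close> tt w(2) by (intro exI[of _ ?\<iota>]) (simp add: phrase_eps_def)
    show "length [x, y] = length [[A, B], [B, A]]" by simp
    show "set (concat [x, y] @ z) \<subseteq> letters W - {A, B}" using A nA w by auto
  qed (use A w in simp_all)
qed

section \<open>Isomorphisms, the third move and concatenation\<close>

context inv_set
begin

lemma pform_nw: "nword W \<Longrightarrow> X \<in> nset W \<Longrightarrow> Y \<in> nset W \<Longrightarrow>
    pform (npair W) X Y = cls (nw_form W X Y)"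
  using rep_formD(2)[OF rep_form_nw] by simp

lemma nw_pairing_cob_iso:
  assumes nW: "nword W" "nword W'" and f: "bij_betw f (letters W) (letters W')"
    "\<And>A. A \<in> letters W \<Longrightarrow> proj W' (f A) = proj W A"
    "\<And>X Y. X \<in> nset W \<Longrightarrow> Y \<in> nset W \<Longrightarrow>
       nw_form W' (map_option f X) (map_option f Y) = nw_form W X Y"
  shows "npair W \<sim>\<^sub>p npair W'"
proof (rule cob_iso[OF pairing_nw[OF nW(1)] pairing_nw[OF nW(2)]])
  have im: "f ` letters W = letters W'" "inj_on f (letters W)" using f(1) by (auto simp: bij_betw_def)
  show "p_iso (map_option f) (npair W) (npair W')"
    unfolding p_iso_def
  proof (intro conjI ballI)
    have "map_option f ` Some ` letters W = Some ` letters W'"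
      unfolding im(1)[symmetric] by (simp add: image_image)
    moreover have "inj_on (map_option f) (nset W)"
      using im(2) by (auto simp: inj_on_def)
    ultimately show "bij_betw (map_option f) (pset (npair W)) (pset (npair W'))"
      unfolding bij_betw_def nw_pairing_sel by simp
    show "map_option f (pbase (npair W)) = pbase (npair W')" by simp
    show "pproj (npair W') (map_option f A) = pproj (npair W) A"
      if "A \<in> pcirc (npair W)" for A
      using that f(2) by auto
    fix X Y assume XY: "X \<in> pset (npair W)" "Y \<in> pset (npair W)"
    have "map_option f Z \<in> nset W'" if "Z \<in> pset (npair W)" for Z
      using that im(1) by auto
    then show "pform (npair W') (map_option f X) (map_option f Y) = pform (npair W) X Y"
      using XY by (simp only: pform_nw[OF nW(2)] pform_nw[OF nW(1)] f(3) nw_pairing_sel)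
  qed
qed

lemma cob_isomorphic:
  assumes nW: "nword W" "nword W'" and "nw_isomorphic W W'"
  shows "npair W \<sim>\<^sub>p npair W'"
proof -
  obtain f where f: "bij_betw f (letters W) (letters W')" "\<And>A. A \<in> letters W \<Longrightarrow> proj W' (f A) = proj W A"
     "word W' = map f (word W)"
    using assms(3) unfolding nw_isomorphic_def by metis
  have fl: "f A \<in> letters W'" if "A \<in> letters W" for A using f(1) that by (auto simp: bij_betw_def)
  have occ: "occ_first (word W') (f A) = occ_first (word W) A" "occ_last (word W') (f A) = occ_last (word W) A"
    if A: "A \<in> letters W" for A
  proof -
    note o = occ_props[OF nwordD(2)[OF nW(1) A]]
    have l: "occ_first (word W) A < length (word W)" using o(1,2) by simp
    show "occ_first (word W') (f A) = occ_first (word W) A" "occ_last (word W') (f A) = occ_last (word W) A"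
      using occ_unique[OF nwordD(2)[OF nW(2) fl[OF A]] o(1)] o(2-4) l unfolding f(3) by simp_all
  qed
  have hgt: "hgt (word W') (map_option f X) t = hgt (word W) X t" if "X \<in> nset W" for X t
    using that occ by (auto simp: hgt_def)
  show ?thesis
  proof (rule nw_pairing_cob_iso[OF nW f(1,2)])
    fix X Y assume XY: "X \<in> nset W" "Y \<in> nset W"
    have "nw_form W' (map_option f X) (map_option f Y) =
        (\<Sum>D\<in>letters W. frag_cmul (coef (word W') (map_option f X) (map_option f Y) (f D)) (frag_of (proj W' (f D))))"
      unfolding nw_form_def by (rule sum.reindex_bij_betw[OF f(1), symmetric])
    also have "\<dots> = nw_form W X Y"
      unfolding nw_form_def coef_def by (rule sum.cong) (simp_all only: hgt[OF XY(1)] hgt[OF XY(2)] occ f(2))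
    finally show "nw_form W' (map_option f X) (map_option f Y) = nw_form W X Y" .
  qed
qed

text \<open>The move exchanges the entries at three pairs of adjacent positions. The coefficients of
  all other letters stay the same. Those of \<open>A\<close>, \<open>B\<close>, \<open>C\<close> can
  change, but since the three projections agree only their sum enters the form, and this sum is
  invariant.\<close>

lemma cob_move3:
  fixes W W' :: "('l, 'a) nanoword"
  assumes nW: "nword W" "nword W'" and "move3 W W'"
  shows "npair W \<sim>\<^sub>p npair W'"
proof -
  obtain x y z t A B C where d: "distinct [A, B, C]" and pr: "proj W A = proj W B" "proj W B = proj W C"
    and w: "word W = x @ [A, B] @ y @ [A, C] @ z @ [B, C] @ t"
    and W': "W' = \<lparr>letters = letters W, proj = proj W, word = x @ [B, A] @ y @ [C, A] @ z @ [C, B] @ t\<rparr>"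
    using assms(3) unfolding move3_def by blast
  define p1 p3 p5 where p: "p1 = length x" "p3 = p1 + 2 + length y" "p5 = p3 + 2 + length z"
  let ?w = "word W" and ?w' = "word W'"
  have w': "?w' = x @ [B, A] @ y @ [C, A] @ z @ [C, B] @ t" unfolding W' by simp
  have L: "letters W' = letters W" "proj W' = proj W" unfolding W' by simp_all
  have ABC: "A \<in> letters W" "B \<in> letters W" "C \<in> letters W"
    using nwordD(3)[OF nW(1)] w by auto
  have c: "count_list ?w D = 2" "count_list ?w' D = 2" if "D \<in> letters W" for D
    using nwordD(2)[OF nW(1) that] nwordD(2)[OF nW(2)] that L by auto
  have lt: "p1 + 1 < p3" "p3 + 1 < p5" "p5 + 1 < length ?w" "length ?w' = length ?w"
    unfolding w w' p by simp_all
  have nth: "?w ! p1 = A" "?w ! (p1 + 1) = B" "?w ! p3 = A" "?w ! (p3 + 1) = C" "?w ! p5 = B" "?w ! (p5 + 1) = C"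
    "?w' ! p1 = B" "?w' ! (p1 + 1) = A" "?w' ! p3 = C" "?w' ! (p3 + 1) = A" "?w' ! p5 = C" "?w' ! (p5 + 1) = B"
    unfolding w w' p by (simp_all add: nth_append)
  have same: "?w' ! k = ?w ! k" if k: "k \<notin> {p1, p1 + 1, p3, p3 + 1, p5, p5 + 1}" for k
  proof -
    have "k < p1 \<or> (p1 + 2 \<le> k \<and> k < p3) \<or> (p3 + 2 \<le> k \<and> k < p5) \<or> p5 + 2 \<le> k"
      using k lt by auto
    then consider "k < p1" | "p1 + 2 \<le> k" "k < p3" | "p3 + 2 \<le> k" "k < p5" | "p5 + 2 \<le> k"
      by blast
    then show ?thesis
    proof cases
      case 1 then show ?thesis unfolding w w' p by (simp add: nth_append)
    next
      case 2
      then obtain i where "k = p1 + 2 + i" by (metis le_Suc_ex)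
      then show ?thesis using 2 unfolding w w' p by (simp add: nth_append)
    next
      case 3
      then obtain i where "k = p3 + 2 + i" by (metis le_Suc_ex)
      then show ?thesis using 3 unfolding w w' p by (simp add: nth_append)
    next
      case 4
      then obtain i where "k = p5 + 2 + i" by (metis le_Suc_ex)
      then show ?thesis using 4 unfolding w w' p by (simp add: nth_append)
    qed
  qed
  have oA: "occ_first ?w A = p1" "occ_last ?w A = p3" by (rule occ_unique[OF c(1)[OF ABC(1)]]; use lt nth in simp)+
  have oB: "occ_first ?w B = p1 + 1" "occ_last ?w B = p5" by (rule occ_unique[OF c(1)[OF ABC(2)]]; use lt nth in simp)+
  have oC: "occ_first ?w C = p3 + 1" "occ_last ?w C = p5 + 1" by (rule occ_unique[OF c(1)[OF ABC(3)]]; use lt nth in simp)+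
  have oA': "occ_first ?w' A = p1 + 1" "occ_last ?w' A = p3 + 1" by (rule occ_unique[OF c(2)[OF ABC(1)]]; use lt nth in simp)+
  have oB': "occ_first ?w' B = p1" "occ_last ?w' B = p5 + 1" by (rule occ_unique[OF c(2)[OF ABC(2)]]; use lt nth in simp)+
  have oC': "occ_first ?w' C = p3" "occ_last ?w' C = p5" by (rule occ_unique[OF c(2)[OF ABC(3)]]; use lt nth in simp)+
  have far: "k \<notin> {p1, p1 + 1, p3, p3 + 1, p5, p5 + 1}" if "?w ! k = D" "D \<notin> {A, B, C}" for k D
    using that nth by auto
  have oD: "occ_first ?w' D = occ_first ?w D" "occ_last ?w' D = occ_last ?w D"
       "occ_first ?w D \<notin> {p1, p1 + 1, p3, p3 + 1, p5, p5 + 1}" "occ_last ?w D \<notin> {p1, p1 + 1, p3, p3 + 1, p5, p5 + 1}"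
    if D: "D \<in> letters W" "D \<notin> {A, B, C}" for D
  proof -
    note o = occ_props[OF c(1)[OF D(1)]]
    show f: "occ_first ?w D \<notin> {p1, p1 + 1, p3, p3 + 1, p5, p5 + 1}" "occ_last ?w D \<notin> {p1, p1 + 1, p3, p3 + 1, p5, p5 + 1}"
      using far[OF o(3) D(2)] far[OF o(4) D(2)] by auto
    have "?w' ! occ_first ?w D = D" "?w' ! occ_last ?w D = D" using same[OF f(1)] same[OF f(2)] o(3,4) by simp_all
    then show "occ_first ?w' D = occ_first ?w D" "occ_last ?w' D = occ_last ?w D"
      using occ_unique[OF c(2)[OF D(1)] o(1)] o(2) lt(4) by auto
  qed
  \<comment> \<open>Shifting an end of an interval by one is visible only at the two positions
    involved.\<close>
  have sgS: "sgn (int k - (1 + int q)) = sgn (int k - int q)" if "k \<noteq> q" "k \<noteq> Suc q" for k q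
    using that by (auto simp: sgn_if)
  have hgt_far: "hgt ?w' X k = hgt ?w X k" if "X \<in> nset W" "k \<notin> {p1, p1 + 1, p3, p3 + 1, p5, p5 + 1}" for X k
  proof -
    consider "X = None" | "X = Some A" | "X = Some B" | "X = Some C" | D where "X = Some D" "D \<in> letters W" "D \<notin> {A, B, C}"
      using \<open>X \<in> _\<close> by auto
    then show ?thesis
      by cases (use that(2) in \<open>simp_all add: hgt_def oA oB oC oA' oB' oC' oD sgS\<close>)
  qed
  \<comment> \<open>The heights at the six positions of the move. For the base element and for
    letters other than \<open>A\<close>, \<open>B\<close>, \<open>C\<close>, adjacent positions look
    the same; these three letters have explicit rows. The invariance of the sum is then checked on
    all pairs of rows.\<close>
  define vals where "vals u X = (hgt u X p1, hgt u X (p1 + 1), hgt u X p3, hgt u X (p3 + 1), hgt u X p5, hgt u X (p5 + 1))" for u :: "'l list" and X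
  have vals: "(\<exists>a b c. vals ?w X = (a, a, b, b, c, c) \<and> vals ?w' X = (a, a, b, b, c, c)) \<or>
      (vals ?w X = (1, 2, 1, 0, 0, 0) \<and> vals ?w' X = (0, 1, 2, 1, 0, 0)) \<or>
      (vals ?w X = (0, 1, 2, 2, 1, 0) \<and> vals ?w' X = (1, 2, 2, 2, 2, 1)) \<or>
      (vals ?w X = (0, 0, 0, 1, 2, 1) \<and> vals ?w' X = (0, 0, 1, 2, 1, 0))"
    if "X \<in> nset W" for X
  proof -
    consider "X = None" | "X = Some A" | "X = Some B" | "X = Some C" | D where "X = Some D" "D \<in> letters W" "D \<notin> {A, B, C}"
      using \<open>X \<in> _\<close> by auto
    then show ?thesis
    proof cases
      case 1 then show ?thesis by (simp add: vals_def hgt_def)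
    next
      case 2 then show ?thesis using lt by (simp add: vals_def hgt_def oA oA')
    next
      case 3 then show ?thesis using lt by (simp add: vals_def hgt_def oB oB')
    next
      case 4 then show ?thesis using lt by (simp add: vals_def hgt_def oC oC')
    next
      case 5
      have "sgn (1 + int q - int k) = sgn (int q - int k)" if "k \<noteq> q" "k \<noteq> Suc q" for k q
        using that by (auto simp: sgn_if)
      then show ?thesis using oD[OF 5(2,3)] by (intro disjI1) (simp add: vals_def hgt_def 5(1))
    qed
  qed
  have sum3: "coef ?w' X Y A + coef ?w' X Y B + coef ?w' X Y C = coef ?w X Y A + coef ?w X Y B + coef ?w X Y C"
    if XY: "X \<in> nset W" "Y \<in> nset W" for X Y
  proof -
    have two: "2 * coef ?w X Y D = hgt ?w X (occ_first ?w D) * hgt ?w Y (occ_last ?w D) - hgt ?w Y (occ_first ?w D) * hgt ?w X (occ_last ?w D)"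
        "2 * coef ?w' X Y D = hgt ?w' X (occ_first ?w' D) * hgt ?w' Y (occ_last ?w' D) - hgt ?w' Y (occ_first ?w' D) * hgt ?w' X (occ_last ?w' D)"
      if "D \<in> letters W" for D
      by (rule two_coef; use XY that c in auto)+
    have "2 * (coef ?w' X Y A + coef ?w' X Y B + coef ?w' X Y C) = 2 * (coef ?w X Y A + coef ?w X Y B + coef ?w X Y C)"
      unfolding distrib_left two[OF ABC(1)] two[OF ABC(2)] two[OF ABC(3)] oA oB oC oA' oB' oC'
      using vals[OF XY(1)] vals[OF XY(2)] unfolding vals_def
      by (elim disjE exE conjE) (simp_all add: algebra_simps)
    then show ?thesis by simp
  qed
  show ?thesis
  proof (rule nw_pairing_cob_iso[OF nW, of id])
    show "bij_betw id (letters W) (letters W')" unfolding L by simp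
    show "proj W' (id A) = proj W A" for A unfolding L by simp
    fix X Y assume XY: "X \<in> nset W" "Y \<in> nset W"
    have sub: "{A, B, C} \<subseteq> letters W" using ABC by simp
    have split: "(\<Sum>D\<in>letters W. frag_cmul (k D) (frag_of (proj W D))) =
       (\<Sum>D\<in>letters W - {A, B, C}. frag_cmul (k D) (frag_of (proj W D))) + frag_cmul (k A + k B + k C) (frag_of (proj W A))" for k
      using sum.subset_diff[OF sub nwordD(4)[OF nW(1)], of "\<lambda>D. frag_cmul (k D) (frag_of (proj W D))"] d pr
      by (simp add: frag_cmul_distrib add.assoc)
    have "nw_form W' X Y = nw_form W X Y"
      unfolding nw_form_def L split sum3[OF XY]
    proof (rule arg_cong2[where f = "(+)"], rule sum.cong)
      fix D assume "D \<in> letters W - {A, B, C}"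
      then have D: "D \<in> letters W" "D \<notin> {A, B, C}" by auto
      show "frag_cmul (coef ?w' X Y D) (frag_of (proj W D)) = frag_cmul (coef ?w X Y D) (frag_of (proj W D))"
        unfolding coef_def oD(1,2)[OF D] hgt_far[OF XY(1) oD(3)[OF D]] hgt_far[OF XY(1) oD(4)[OF D]]
          hgt_far[OF XY(2) oD(3)[OF D]] hgt_far[OF XY(2) oD(4)[OF D]] ..
    qed simp_all
    then show "nw_form W' (map_option id X) (map_option id Y) = nw_form W X Y" by (simp add: option.map_id)
  qed
qed

section \<open>Concatenation of nanowords and the sum of pairings\<close>

lemma nword_concat:
  assumes "nword U" "nword V" "letters U \<inter> letters V = {}"
  shows "nword (nw_concat U V)"
proof -
  have "count_list (word U) A = 0" if "A \<in> letters V" for A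
    using that assms(3) nwordD(3)[OF assms(1)] by (auto simp: count_list_0_iff)
  moreover have "count_list (word V) A = 0" if "A \<in> letters U" for A
    using that assms(3) nwordD(3)[OF assms(2)] by (auto simp: count_list_0_iff)
  ultimately show ?thesis
    using nwordD[OF assms(1)] nwordD[OF assms(2)] by (auto simp: is_nanoword_def nw_concat_def)
qed

lemma concat_occ:
  assumes U: "nword U" and V: "nword V" and disj: "letters U \<inter> letters V = {}"
  shows "A \<in> letters U \<Longrightarrow> occ_first (word U @ word V) A = occ_first (word U) A"
    "A \<in> letters U \<Longrightarrow> occ_last (word U @ word V) A = occ_last (word U) A"
    "A \<in> letters V \<Longrightarrow> occ_first (word U @ word V) A = length (word U) + occ_first (word V) A"
    "A \<in> letters V \<Longrightarrow> occ_last (word U @ word V) A = length (word U) + occ_last (word V) A"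
proof -
  have c: "count_list (word U @ word V) A = 2" if "A \<in> letters U \<union> letters V" for A
    using nwordD(2)[OF nword_concat[OF U V disj], of A] that by (simp add: nw_concat_def)
  show "occ_first (word U @ word V) A = occ_first (word U) A" "occ_last (word U @ word V) A = occ_last (word U) A"
    if A: "A \<in> letters U" for A
  proof -
    note o = occ_props[OF nwordD(2)[OF U A]]
    have "count_list (word U @ word V) A = 2" using c A by simp
    note u = occ_unique[OF this o(1)]
    show "occ_first (word U @ word V) A = occ_first (word U) A" "occ_last (word U @ word V) A = occ_last (word U) A"
      by (rule u; use o(1-4) in \<open>simp add: nth_append\<close>)+
  qed
  show "occ_first (word U @ word V) A = length (word U) + occ_first (word V) A"
    "occ_last (word U @ word V) A = length (word U) + occ_last (word V) A" if A: "A \<in> letters V" for A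
  proof -
    note o = occ_props[OF nwordD(2)[OF V A]]
    have cc: "count_list (word U @ word V) A = 2" using c A by simp
    have n: "(word U @ word V) ! (length (word U) + occ_first (word V) A) = A"
      "(word U @ word V) ! (length (word U) + occ_last (word V) A) = A"
      using o(3,4) by simp_all
    have l: "length (word U) + occ_first (word V) A < length (word U) + occ_last (word V) A"
      "length (word U) + occ_last (word V) A < length (word U @ word V)"
      using o(1,2) by simp_all
    show "occ_first (word U @ word V) A = length (word U) + occ_first (word V) A"
      "occ_last (word U @ word V) A = length (word U) + occ_last (word V) A"
      by (fact occ_unique[OF cc l n])+
  qed
qed

text \<open>A letter of \<open>V\<close> has height 0 at all positions of \<open>U\<close>, and
  conversely. So the determinant for a letter \<open>D\<close> of \<open>U\<close> sees only letters
  of \<open>U\<close> and the base element, and the form of the concatenation is the sum of the two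
  forms extended by zero.\<close>

lemma cob_concat:
  fixes U V :: "('l, 'a) nanoword"
  assumes U: "nword U" and V: "nword V" and disj: "letters U \<inter> letters V = {}"
  shows "npair (nw_concat U V) \<sim>\<^sub>p npair U \<oplus>\<^sub>p npair V"
proof -
  let ?W = "nw_concat U V" and ?w = "word U @ word V"
  let ?p = "npair U" and ?q = "npair V"
  have W: "nword ?W" by (rule nword_concat[OF U V disj])
  have sel: "letters ?W = letters U \<union> letters V" "word ?W = ?w" by (simp_all add: nw_concat_def)
  have prj: "A \<in> letters U \<Longrightarrow> proj ?W A = proj U A" "A \<in> letters V \<Longrightarrow> proj ?W A = proj V A" for A
    using disj by (auto simp: nw_concat_def)
  define g where "g X = (case X of None \<Rightarrow> None | Some A \<Rightarrow> if A \<in> letters U then Some (Inl (Some A)) else Some (Inr (Some A)))"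
    for X :: "'l option"
  have g: "g None = None" "A \<in> letters U \<Longrightarrow> g (Some A) = Some (Inl (Some A))" "A \<in> letters V \<Longrightarrow> g (Some A) = Some (Inr (Some A))" for A
    using disj by (auto simp: g_def)
  note occ = concat_occ[OF U V disj]
  have oU: "occ_first (word U) D < length (word U)" "occ_last (word U) D < length (word U)" if "D \<in> letters U" for D
    using occ_props(1,2)[OF nwordD(2)[OF U that]] by auto
  have hU: "hgt ?w X t = (case sum_left ?p (g X) of None \<Rightarrow> 0 | Some Z \<Rightarrow> hgt (word U) Z t)"
    if X: "X \<in> nset ?W" and t: "t < length (word U)" for X t
  proof -
    consider "X = None" | A where "X = Some A" "A \<in> letters U" | A where "X = Some A" "A \<in> letters V" "A \<notin> letters U"
      using X unfolding sel(1) by blast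
    then show ?thesis
      by cases (use t in \<open>simp_all add: g sum_left_def hgt_def occ sgn_if\<close>)
  qed
  have hV: "hgt ?w X (length (word U) + t) = (case sum_right ?q (g X) of None \<Rightarrow> 0 | Some Z \<Rightarrow> hgt (word V) Z t)"
    if X: "X \<in> nset ?W" for X t
  proof -
    consider "X = None" | A where "X = Some A" "A \<in> letters U" | A where "X = Some A" "A \<in> letters V" "A \<notin> letters U"
      using X unfolding sel(1) by blast
    then show ?thesis
    proof cases
      case 2
      then show ?thesis using oU[OF 2(2)] by (simp add: g sum_right_def hgt_def occ sgn_if)
    qed (simp_all add: g sum_right_def hgt_def occ)
  qed
  have form: "nw_form ?W X Y = sum_form ?p ?q (nw_form U) (nw_form V) (g X) (g Y)"
    if XY: "X \<in> nset ?W" "Y \<in> nset ?W" for X Y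
  proof -
    have "(\<Sum>D\<in>letters U. frag_cmul (coef ?w X Y D) (frag_of (proj ?W D))) = ext_form (nw_form U) (sum_left ?p (g X)) (sum_left ?p (g Y))"
    proof (cases "sum_left ?p (g X) = None \<or> sum_left ?p (g Y) = None")
      case True
      then have "coef ?w X Y D = 0" if "D \<in> letters U" for D
        unfolding coef_def using hU[OF XY(1)] hU[OF XY(2)] oU[OF that] by (auto simp: occ that)
      then show ?thesis using True by (auto simp: ext_form_def split: option.splits)
    next
      case False
      then obtain X' Y' where XY': "sum_left ?p (g X) = Some X'" "sum_left ?p (g Y) = Some Y'" by auto
      have "coef ?w X Y D = coef (word U) X' Y' D" if "D \<in> letters U" for D
        unfolding coef_def using hU[OF XY(1)] hU[OF XY(2)] oU[OF that] XY' by (simp add: occ that)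
      then show ?thesis unfolding XY' nw_form_def by (simp add: ext_form_def prj)
    qed
    moreover have "(\<Sum>D\<in>letters V. frag_cmul (coef ?w X Y D) (frag_of (proj ?W D))) = ext_form (nw_form V) (sum_right ?q (g X)) (sum_right ?q (g Y))"
    proof (cases "sum_right ?q (g X) = None \<or> sum_right ?q (g Y) = None")
      case True
      then have "coef ?w X Y D = 0" if "D \<in> letters V" for D
        unfolding coef_def using hV[OF XY(1)] hV[OF XY(2)] by (auto simp: occ that)
      then show ?thesis using True by (auto simp: ext_form_def split: option.splits)
    next
      case False
      then obtain X' Y' where XY': "sum_right ?q (g X) = Some X'" "sum_right ?q (g Y) = Some Y'" by auto
      have "coef ?w X Y D = coef (word V) X' Y' D" if "D \<in> letters V" for D
        unfolding coef_def using hV[OF XY(1)] hV[OF XY(2)] XY' by (simp add: occ that)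
      then show ?thesis unfolding XY' nw_form_def by (simp add: ext_form_def prj)
    qed
    ultimately show ?thesis
      unfolding nw_form_def[of ?W] sel sum_form_def
      by (simp add: sum.union_disjoint[OF nwordD(4)[OF U] nwordD(4)[OF V] disj])
  qed
  have rep: "rep_form (?p \<oplus>\<^sub>p ?q) (sum_form ?p ?q (nw_form U) (nw_form V))"
    by (intro rep_form_sum pairing_nw rep_form_nw U V)
  have gin: "g X \<in> pset (?p \<oplus>\<^sub>p ?q)" if "X \<in> nset ?W" for X
    using that unfolding sel(1) by (auto simp: g)
  have "p_iso g (npair ?W) (?p \<oplus>\<^sub>p ?q)"
    unfolding p_iso_def
  proof (intro conjI ballI)
    have "(\<lambda>A. g (Some A)) ` letters U = (\<lambda>A. Some (Inl (Some A))) ` letters U"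
      "(\<lambda>A. g (Some A)) ` letters V = (\<lambda>A. Some (Inr (Some A))) ` letters V"
      by (intro image_cong refl g; assumption)+
    then have "g ` Some ` letters ?W = Some ` (Inl ` Some ` letters U \<union> Inr ` Some ` letters V)"
      unfolding sel image_Un image_image by (simp only:)
    moreover have "inj_on g (nset ?W)"
    proof (rule inj_onI)
      fix X Y assume "g X = g Y"
      then show "X = Y" by (cases X; cases Y) (simp_all add: g_def split: if_splits)
    qed
    ultimately show "bij_betw g (pset (npair ?W)) (pset (?p \<oplus>\<^sub>p ?q))"
      unfolding bij_betw_def nw_pairing_sel p_sum_sel image_insert g(1) by simp
    show "g (pbase (npair ?W)) = pbase (?p \<oplus>\<^sub>p ?q)" by (simp add: g_def)
    show "pproj (?p \<oplus>\<^sub>p ?q) (g A) = pproj (npair ?W) A" if "A \<in> pcirc (npair ?W)" for A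
      using that unfolding nw_pairing_sel sel(1) by (auto simp: g prj)
    fix X Y assume "X \<in> pset (npair ?W)" "Y \<in> pset (npair ?W)"
    then have XY: "X \<in> nset ?W" "Y \<in> nset ?W" by simp_all
    show "pform (?p \<oplus>\<^sub>p ?q) (g X) (g Y) = pform (npair ?W) X Y"
      unfolding pform_nw[OF W XY] form[OF XY] by (rule rep_formD(2)[OF rep gin[OF XY(1)] gin[OF XY(2)]])
  qed
  then show ?thesis
    by (rule cob_iso[OF pairing_nw[OF W] pairing_sum[OF pairing_nw[OF U] pairing_nw[OF V]]])
qed

section \<open>Cobordant nanowords have cobordant pairings\<close>

lemma cob_step:
  assumes "nw_step al tau W W'"
  shows "npair W \<sim>\<^sub>p npair W'"
  using assms cob_isomorphic cob_move3 cob_surgery move1_surgery move2_surgery[OF _ involution]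
  unfolding nw_step_def by metis

text \<open>The induction carries along that the current word is a nanoword, as transitivity for
  pairings is applied to its pairing.\<close>

lemma cob_nw_cobordant:
  assumes "nword W" "nw_cobordant al tau W W'"
  shows "nword W' \<and> npair W \<sim>\<^sub>p npair W'"
  using assms(2) unfolding nw_cobordant_def
proof (induction rule: equivclp_induct)
  case base
  show ?case using assms(1) cob_refl[OF pairing_nw] by simp
next
  case (step Y Z)
  have n: "nword Y" "nword Z" using step(2) by (auto simp: nw_step_def)
  have "npair Y \<sim>\<^sub>p npair Z"
    using step(2) cob_step cob_sym[OF pairing_nw[OF n(2)] pairing_nw[OF n(1)]] by blast
  then show ?case
    using cob_trans[OF pairing_nw[OF assms(1)] pairing_nw[OF n(1)] pairing_nw[OF n(2)]] step(3) n by blast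
qed

end

section \<open>The group of nanowords\<close>

text \<open>Equality up to the values of \<open>proj\<close> outside of the letters, in which the
  results of moves and of concatenations can differ.\<close>

definition nw_agree :: "('l, 'a) nanoword \<Rightarrow> ('l, 'a) nanoword \<Rightarrow> bool" where
  "nw_agree U V \<longleftrightarrow> letters U = letters V \<and> word U = word V \<and> (\<forall>A\<in>letters U. proj U A = proj V A)"

lemma nw_agree_isomorphic: "nw_agree U V \<Longrightarrow> nw_isomorphic U V"
  unfolding nw_agree_def nw_isomorphic_def by (intro exI[of _ id]) simp

lemma is_nanoword_agree: "nw_agree U V \<Longrightarrow> is_nanoword al U \<Longrightarrow> is_nanoword al V"
  unfolding nw_agree_def is_nanoword_def by auto

context inv_set
begin

section \<open>Compatibility of concatenation with cobordism\<close>

abbreviation ncob (infix \<open>\<sim>\<^sub>w\<close> 50) where "ncob \<equiv> nw_cobordant al tau"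

lemma ncob_refl: "W \<sim>\<^sub>w W"
  by (simp add: nw_cobordant_def)

lemma ncob_sym: "U \<sim>\<^sub>w V \<Longrightarrow> V \<sim>\<^sub>w U"
  unfolding nw_cobordant_def by (rule equivclp_sym)

lemma ncob_trans [trans]: "U \<sim>\<^sub>w V \<Longrightarrow> V \<sim>\<^sub>w W \<Longrightarrow> U \<sim>\<^sub>w W"
  unfolding nw_cobordant_def by (rule equivclp_trans)

lemma ncob_step: "nw_step al tau U V \<Longrightarrow> U \<sim>\<^sub>w V"
  unfolding nw_cobordant_def by (rule r_into_equivclp)

lemma ncob_iso: "nword U \<Longrightarrow> nword V \<Longrightarrow> nw_isomorphic U V \<Longrightarrow> U \<sim>\<^sub>w V"
  by (rule ncob_step) (simp add: nw_step_def)

lemma ncob_nword: "U \<sim>\<^sub>w V \<Longrightarrow> nword U \<Longrightarrow> nword V"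
  using cob_nw_cobordant by blast

lemma nword_iso:
  assumes "nword U" "nw_isomorphic U V"
  shows "nword V"
proof -
  obtain f where f: "bij_betw f (letters U) (letters V)" "\<And>A. A \<in> letters U \<Longrightarrow> proj V (f A) = proj U A"
     "word V = map f (word U)"
    using assms(2) unfolding nw_isomorphic_def by metis
  have im: "f ` letters U = letters V" and inj: "inj_on f (letters U)" using f(1) by (auto simp: bij_betw_def)
  have "count_list (map f (word U)) (f A) = 2" if "A \<in> letters U" for A
  proof -
    have "filter (\<lambda>x. f A = f x) (word U) = filter (\<lambda>x. A = x) (word U)"
      using inj that nwordD(3)[OF assms(1)] by (intro filter_cong) (auto dest: inj_onD)
    then show ?thesis
      using nwordD(2)[OF assms(1) that] by (simp add: count_list_eq_length_filter filter_map comp_def)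
  qed
  moreover have "proj V ` letters V \<subseteq> al" unfolding im[symmetric] using f(2) nwordD(1)[OF assms(1)] by auto
  moreover have "set (word V) \<subseteq> letters V" unfolding f(3) im[symmetric] using nwordD(3)[OF assms(1)] by auto
  ultimately show ?thesis unfolding is_nanoword_def im[symmetric] f(3) by auto
qed

lemma concat_isomorphic:
  assumes "nw_isomorphic U U'" "nw_isomorphic V V'" "nword U" "nword V"
    "letters U \<inter> letters V = {}" "letters U' \<inter> letters V' = {}"
  shows "nw_isomorphic (nw_concat U V) (nw_concat U' V')"
proof -
  obtain f where f: "bij_betw f (letters U) (letters U')" "\<And>A. A \<in> letters U \<Longrightarrow> proj U' (f A) = proj U A"
     "word U' = map f (word U)"
    using assms(1) unfolding nw_isomorphic_def by metis
  obtain g where g: "bij_betw g (letters V) (letters V')" "\<And>A. A \<in> letters V \<Longrightarrow> proj V' (g A) = proj V A"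
     "word V' = map g (word V)"
    using assms(2) unfolding nw_isomorphic_def by metis
  define h where "h A = (if A \<in> letters U then f A else g A)" for A
  have hU: "h A = f A" if "A \<in> letters U" for A using that by (simp add: h_def)
  have hV: "h A = g A" if "A \<in> letters V" for A using that assms(5) by (auto simp: h_def)
  have "bij_betw h (letters U) (letters U')" using f(1) hU by (simp cong: bij_betw_cong)
  moreover have "bij_betw h (letters V) (letters V')" using g(1) hV by (simp cong: bij_betw_cong)
  ultimately have "bij_betw h (letters U \<union> letters V) (letters U' \<union> letters V')"
    using assms(6) by (rule bij_betw_combine)
  moreover have "map h (word U) = map f (word U)" "map h (word V) = map g (word V)"
    using hU hV nwordD(3)[OF assms(3)] nwordD(3)[OF assms(4)] by auto
  moreover have "f A \<in> letters U'" if "A \<in> letters U" for A using f(1) that by (auto simp: bij_betw_def)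
  moreover have "g A \<in> letters V'" if "A \<in> letters V" for A using g(1) that by (auto simp: bij_betw_def)
  ultimately show ?thesis
    unfolding nw_isomorphic_def nw_concat_def using f(2,3) g(2,3) hU hV assms(5,6)
    by (intro exI[of _ h]) (auto simp: disjoint_iff)
qed

lemma fresh_copy:
  fixes V :: "('l::infinite, 'a) nanoword"
  assumes "nword V" "finite F"
  obtains V' where "nw_isomorphic V V'" "nword V'" "letters V' \<inter> F = {}"
proof -
  have "infinite (UNIV - F :: 'l set)" using assms(2) infinite_UNIV by simp
  then obtain T :: "'l set" where T: "finite T" "card T = card (letters V)" "T \<subseteq> UNIV - F"
    using infinite_arbitrarily_large by blast
  then obtain f where f: "bij_betw f (letters V) T"
    using nwordD(4)[OF assms(1)] finite_same_card_bij by metis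
  let ?V = "\<lparr>letters = T, proj = (\<lambda>A. proj V (inv_into (letters V) f A)), word = map f (word V)\<rparr>"
  have "nw_isomorphic V ?V"
    unfolding nw_isomorphic_def using f by (intro exI[of _ f]) (auto simp: bij_betw_def)
  then show ?thesis using that nword_iso[OF assms(1)] T(3) by (metis Diff_disjoint Int_commute disjoint_iff nanoword.select_convs(1) subsetD DiffD2)
qed

text \<open>With \<open>P\<close> empty this describes concatenation with \<open>W\<close> on the
  right, with \<open>Q\<close> empty on the left, so one argument covers both sides.\<close>

definition nw_insert :: "'l list \<Rightarrow> 'l list \<Rightarrow> ('l, 'a) nanoword \<Rightarrow> ('l, 'a) nanoword \<Rightarrow> ('l, 'a) nanoword" where
  "nw_insert P Q W U =
     \<lparr>letters = letters U \<union> letters W,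
      proj = (\<lambda>A. if A \<in> letters U then proj U A else proj W A),
      word = P @ word U @ Q\<rparr>"

text \<open>Both kinds of steps are local: the surroundings of the affected part are arbitrary, so
  \<open>P\<close> and \<open>Q\<close> can be absorbed into them. The first two moves fall under
  surgeries.\<close>

lemma insert_move:
  assumes U: "nword U" "nword U'" and move: "move3 U U' \<or> surgery al tau U U'"
    and W: "letters U \<inter> letters W = {}" "set P \<subseteq> letters W" "set Q \<subseteq> letters W"
    and n: "nword (nw_insert P Q W U)" "nword (nw_insert P Q W U')"
  shows "nw_insert P Q W U \<sim>\<^sub>w nw_insert P Q W U'"
proof -
  let ?I = "nw_insert P Q W U"
  have sel: "letters ?I = letters U \<union> letters W" "word ?I = P @ word U @ Q"
    and prU: "\<And>A. A \<in> letters U \<Longrightarrow> proj ?I A = proj U A"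
    by (simp_all add: nw_insert_def)
  have "\<exists>K u. K \<subseteq> letters U \<and> U' = \<lparr>letters = letters U - K, proj = proj U, word = u\<rparr> \<and>
      (\<forall>Z. Z = \<lparr>letters = letters ?I - K, proj = proj ?I, word = P @ u @ Q\<rparr> \<longrightarrow> move3 ?I Z \<or> surgery al tau ?I Z)"
    using move
  proof
    assume "move3 U U'"
    then obtain x y z t A B C where d: "distinct [A, B, C]" "proj U A = proj U B" "proj U B = proj U C"
        and w: "word U = x @ [A, B] @ y @ [A, C] @ z @ [B, C] @ t"
        "U' = \<lparr>letters = letters U, proj = proj U, word = x @ [B, A] @ y @ [C, A] @ z @ [C, B] @ t\<rparr>"
      unfolding move3_def by blast
    have ABC: "A \<in> letters U" "B \<in> letters U" "C \<in> letters U" using nwordD(3)[OF U(1)] w(1) by auto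
    have "move3 ?I \<lparr>letters = letters ?I, proj = proj ?I, word = P @ (x @ [B, A] @ y @ [C, A] @ z @ [C, B] @ t) @ Q\<rparr>"
      by (unfold move3_def, rule exI[of _ "P @ x"], rule exI[of _ y], rule exI[of _ z], rule exI[of _ "t @ Q"],
          intro exI[of _ A] exI[of _ B] exI[of _ C])
        (use ABC d in \<open>simp add: sel w(1) prU\<close>)
    then show ?thesis using w(2) by (intro exI[of _ "{}"] exI conjI) auto
  next
    assume "surgery al tau U U'"
    then obtain B vs xs y where B: "B \<subseteq> letters U" and phrase: "is_nanophrase al (proj U) B vs"
      and ev: "even_phrase vs" and sym: "symmetric_phrase tau (proj U) B vs"
      and xs: "length xs = length vs" "set (concat xs @ y) \<subseteq> letters U - B"
      and word: "word U = concat (map2 (@) xs vs) @ y"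
      and U': "U' = \<lparr>letters = letters U - B, proj = proj U, word = concat xs @ y\<rparr>"
      unfolding surgery_def by metis
    have phrase': "is_nanophrase al (proj ?I) B vs"
      using phrase prU B unfolding is_nanophrase_def by (auto simp: image_subset_iff subset_iff)
    obtain \<iota> where \<iota>: "bij_betw \<iota> B B" "\<forall>v\<in>set vs. map \<iota> v = rev v" "\<forall>b\<in>B. proj U (\<iota> b) = (tau ^^ phrase_eps vs b) (proj U b)"
      using sym unfolding symmetric_phrase_def by blast
    have "proj ?I b = proj U b" "proj ?I (\<iota> b) = proj U (\<iota> b)" if "b \<in> B" for b
      using prU \<iota>(1) B that by (auto simp: bij_betw_def)
    then have "\<forall>b\<in>B. proj ?I (\<iota> b) = (tau ^^ phrase_eps vs b) (proj ?I b)" using \<iota>(3) by simp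
    then have sym': "symmetric_phrase tau (proj ?I) B vs" unfolding symmetric_phrase_def using \<iota>(1,2) by blast
    \<comment> \<open>\<open>P\<close> is joined to the first gap and \<open>Q\<close> to the last
      one. Without any words there is a single gap, which takes both.\<close>
    have "\<exists>xs' y'. length xs' = length vs \<and> concat xs' @ y' = P @ (concat xs @ y) @ Q \<and>
        concat (map2 (@) xs' vs) @ y' = P @ (concat (map2 (@) xs vs) @ y) @ Q"
    proof (cases xs)
      case Nil
      then show ?thesis using xs(1) by (intro exI[of _ "[]"] exI[of _ "P @ y @ Q"]) simp
    next
      case (Cons x1 xs1)
      then obtain v1 vs1 where "vs = v1 # vs1" using xs(1) by (cases vs) auto
      then show ?thesis using xs(1) Cons by (intro exI[of _ "(P @ x1) # xs1"] exI[of _ "y @ Q"]) simp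
    qed
    then obtain xs' y' where xs': "length xs' = length vs" "concat xs' @ y' = P @ (concat xs @ y) @ Q"
        "concat (map2 (@) xs' vs) @ y' = P @ (concat (map2 (@) xs vs) @ y) @ Q" by blast
    have "surgery al tau ?I \<lparr>letters = letters ?I - B, proj = proj ?I, word = P @ (concat xs @ y) @ Q\<rparr>"
      unfolding surgery_def
    proof (intro exI conjI)
      show "word ?I = concat (map2 (@) xs' vs) @ y'" unfolding sel word xs'(3) ..
      show "set (concat xs' @ y') \<subseteq> letters ?I - B" unfolding sel xs'(2) using xs(2) W B by auto
      show "B \<subseteq> letters ?I" unfolding sel using B by auto
    qed (use phrase' sym' ev xs' in auto)
    then show ?thesis using B U' by blast
  qed
  then obtain K u where K: "K \<subseteq> letters U" "U' = \<lparr>letters = letters U - K, proj = proj U, word = u\<rparr>"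
    and Z: "move3 ?I \<lparr>letters = letters ?I - K, proj = proj ?I, word = P @ u @ Q\<rparr> \<or>
      surgery al tau ?I \<lparr>letters = letters ?I - K, proj = proj ?I, word = P @ u @ Q\<rparr>"
    by blast
  let ?Z = "\<lparr>letters = letters ?I - K, proj = proj ?I, word = P @ u @ Q\<rparr>"
  \<comment> \<open>On the removed letters \<open>K\<close> the two projections can differ, but
    these are letters of neither word.\<close>
  have agree: "nw_agree (nw_insert P Q W U') ?Z"
    unfolding nw_agree_def nw_insert_def K(2) using K(1) W(1) by auto
  have nZ: "nword ?Z" by (rule is_nanoword_agree[OF agree n(2)])
  have "nw_step al tau ?I ?Z" unfolding nw_step_def using n(1) nZ Z by blast
  from ncob_step[OF this] show ?thesis using ncob_iso[OF n(2) nZ nw_agree_isomorphic[OF agree]] ncob_sym ncob_trans by blast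
qed

lemma concat_step:
  assumes step: "nw_step al tau U U'" and W: "nword W" "letters U \<inter> letters W = {}" "letters U' \<inter> letters W = {}"
  shows "nw_concat U W \<sim>\<^sub>w nw_concat U' W" "nw_concat W U \<sim>\<^sub>w nw_concat W U'"
proof -
  have U: "nword U" "nword U'" using step by (auto simp: nw_step_def)
  have disj: "letters W \<inter> letters U = {}" "letters W \<inter> letters U' = {}" using W by auto
  note n = nword_concat[OF U(1) W(1,2)] nword_concat[OF U(2) W(1,3)]
    nword_concat[OF W(1) U(1) disj(1)] nword_concat[OF W(1) U(2) disj(2)]
  have "nw_concat U W \<sim>\<^sub>w nw_concat U' W \<and> nw_concat W U \<sim>\<^sub>w nw_concat W U'"
  proof (cases "nw_isomorphic U U'")
    case True
    have r: "nw_isomorphic W W" by (rule nw_agree_isomorphic) (simp add: nw_agree_def)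
    show ?thesis
      using concat_isomorphic[OF True r U(1) W(1) W(2,3)] concat_isomorphic[OF r True W(1) U(1) disj] n
      by (auto intro: ncob_iso)
  next
    case False
    have move: "move3 U U' \<or> surgery al tau U U'"
      using step False move1_surgery[OF U(1)] move2_surgery[OF U(1) involution] unfolding nw_step_def by blast
    have r: "nw_concat V W = nw_insert [] (word W) W V" for V
      by (simp add: nw_concat_def nw_insert_def)
    have l: "nw_agree (nw_concat W V) (nw_insert (word W) [] W V)" if "letters W \<inter> letters V = {}" for V
      using that by (auto simp: nw_agree_def nw_concat_def nw_insert_def)
    have nl: "nword (nw_insert (word W) [] W U)" "nword (nw_insert (word W) [] W U')"
      by (rule is_nanoword_agree[OF l[OF disj(1)] n(3)], rule is_nanoword_agree[OF l[OF disj(2)] n(4)])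
    have sW: "set (word W) \<subseteq> letters W" "set [] \<subseteq> letters W" using nwordD(3)[OF W(1)] by auto
    have "nw_concat U W \<sim>\<^sub>w nw_concat U' W"
      unfolding r by (rule insert_move[OF U move W(2) sW(2,1) n(1,2)[unfolded r]])
    moreover have "nw_concat W U \<sim>\<^sub>w nw_concat W U'"
      using ncob_iso[OF n(3) nl(1) nw_agree_isomorphic[OF l[OF disj(1)]]]
        insert_move[OF U move W(2) sW nl]
        ncob_sym[OF ncob_iso[OF n(4) nl(2) nw_agree_isomorphic[OF l[OF disj(2)]]]] ncob_trans by blast
    ultimately show ?thesis ..
  qed
  then show "nw_concat U W \<sim>\<^sub>w nw_concat U' W" "nw_concat W U \<sim>\<^sub>w nw_concat W U'" by blast+
qed

lemma nw_isomorphic_sym: "nw_isomorphic U V \<Longrightarrow> nword U \<Longrightarrow> nw_isomorphic V U"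
proof -
  assume "nw_isomorphic U V" and U: "nword U"
  then obtain f where f: "bij_betw f (letters U) (letters V)" "\<And>A. A \<in> letters U \<Longrightarrow> proj V (f A) = proj U A"
     "word V = map f (word U)"
    unfolding nw_isomorphic_def by metis
  let ?g = "inv_into (letters U) f"
  have g: "?g (f A) = A" if "A \<in> letters U" for A using f(1) that by (simp add: bij_betw_def)
  have gV: "proj U (?g B) = proj V B" if "B \<in> letters V" for B
    using f(2)[of "?g B"] f(1) that by (auto simp: bij_betw_def inv_into_into f_inv_into_f)
  have "map ?g (word V) = word U" unfolding f(3) map_map using g nwordD(3)[OF U] by (intro map_idI) simp
  then show ?thesis
    unfolding nw_isomorphic_def using bij_betw_inv_into[OF f(1)] gV by (intro exI[of _ ?g]) simp
qed

lemma nw_isomorphic_trans: "nw_isomorphic U V \<Longrightarrow> nw_isomorphic V W \<Longrightarrow> nw_isomorphic U W"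
proof -
  assume "nw_isomorphic U V" "nw_isomorphic V W"
  then obtain f g where f: "bij_betw f (letters U) (letters V)" "\<forall>A\<in>letters U. proj V (f A) = proj U A" "word V = map f (word U)"
    and g: "bij_betw g (letters V) (letters W)" "\<forall>A\<in>letters V. proj W (g A) = proj V A" "word W = map g (word V)"
    unfolding nw_isomorphic_def by blast
  have "f A \<in> letters V" if "A \<in> letters U" for A using f(1) that by (auto simp: bij_betw_def)
  then show ?thesis
    unfolding nw_isomorphic_def using f g bij_betw_trans[OF f(1) g(1)] by (intro exI[of _ "g \<circ> f"]) simp
qed

lemma concat_iso_cob:
  assumes "nw_isomorphic U U'" "nw_isomorphic V V'" "nword U" "nword V"
    "letters U \<inter> letters V = {}" "letters U' \<inter> letters V' = {}"
  shows "nw_concat U V \<sim>\<^sub>w nw_concat U' V'"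
  by (rule ncob_iso[OF nword_concat[OF assms(3,4,5)]
        nword_concat[OF nword_iso[OF assms(3,1)] nword_iso[OF assms(4,2)] assms(6)] concat_isomorphic[OF assms]])

text \<open>An intermediate word of the chain may use letters of \<open>V\<close>. The claim is
  therefore made for all copies \<open>V1\<close> of \<open>V\<close> that avoid the letters of the
  current word, and each step passes through a copy that avoids both of its words.\<close>

lemma concat_chain:
  fixes U U' V :: "('l::infinite, 'a) nanoword"
  assumes "U \<sim>\<^sub>w U'" and U: "nword U" and V: "nword V" and V0: "nw_isomorphic V V0" "letters U \<inter> letters V0 = {}"
  shows "nw_isomorphic V V1 \<Longrightarrow> letters U' \<inter> letters V1 = {} \<Longrightarrow>
    nw_concat U V0 \<sim>\<^sub>w nw_concat U' V1 \<and> nw_concat V0 U \<sim>\<^sub>w nw_concat V1 U'"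
  using assms(1)[unfolded nw_cobordant_def]
proof (induction arbitrary: V1 rule: equivclp_induct)
  case base
  have r: "nw_isomorphic U U" by (rule nw_agree_isomorphic) (simp add: nw_agree_def)
  have i: "nw_isomorphic V0 V1" "nword V0"
    using nw_isomorphic_trans[OF nw_isomorphic_sym[OF V0(1) V] base(1)] nword_iso[OF V V0(1)] by auto
  show ?case
    using concat_iso_cob[OF r i(1) U i(2) V0(2) base(2)] concat_iso_cob[OF i(1) r i(2) U] V0(2) base(2) by (simp add: Int_commute)
next
  case (step Y Z)
  have n: "nword Y" "nword Z" using step(2) by (auto simp: nw_step_def)
  obtain V2 where V2: "nw_isomorphic V V2" "nword V2" "letters V2 \<inter> (letters Y \<union> letters Z) = {}"
    using fresh_copy[OF V, of "letters Y \<union> letters Z"] nwordD(4)[OF n(1)] nwordD(4)[OF n(2)] by blast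
  have d: "letters Y \<inter> letters V2 = {}" "letters Z \<inter> letters V2 = {}" "letters V2 \<inter> letters Z = {}" "letters V1 \<inter> letters Z = {}"
    using V2(3) step(5) by auto
  have 1: "nw_concat U V0 \<sim>\<^sub>w nw_concat Y V2" "nw_concat V0 U \<sim>\<^sub>w nw_concat V2 Y"
    using step(3)[OF V2(1) d(1)] by auto
  have 2: "nw_concat Y V2 \<sim>\<^sub>w nw_concat Z V2" "nw_concat V2 Y \<sim>\<^sub>w nw_concat V2 Z"
    using step(2) concat_step[of Y Z V2, OF _ V2(2) d(1,2)] concat_step[of Z Y V2, OF _ V2(2) d(2,1)] ncob_sym by blast+
  have r: "nw_isomorphic Z Z" by (rule nw_agree_isomorphic) (simp add: nw_agree_def)
  have i: "nw_isomorphic V2 V1"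
    by (rule nw_isomorphic_trans[OF nw_isomorphic_sym[OF V2(1) V] step(4)])
  have 3: "nw_concat Z V2 \<sim>\<^sub>w nw_concat Z V1" "nw_concat V2 Z \<sim>\<^sub>w nw_concat V1 Z"
    by (rule concat_iso_cob[OF r i n(2) V2(2) d(2) step(5)], rule concat_iso_cob[OF i r V2(2) n(2) d(3,4)])
  show ?case using 1 2 3 ncob_trans by blast
qed

text \<open>The factors are changed one after the other, first \<open>U\<close> and then
  \<open>V\<close>. In between, \<open>U'\<close> may share letters with \<open>V\<close>, so the
  middle product uses the copy \<open>V2\<close>.\<close>

lemma concat_cob:
  fixes U U' V V' :: "('l::infinite, 'a) nanoword"
  assumes cob: "U \<sim>\<^sub>w U'" "V \<sim>\<^sub>w V'" and n: "nword U" "nword V"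
    and d: "letters U \<inter> letters V = {}" "letters U' \<inter> letters V' = {}"
  shows "nw_concat U V \<sim>\<^sub>w nw_concat U' V'"
proof -
  have n': "nword U'" "nword V'" using ncob_nword cob n by auto
  obtain V2 where V2: "nw_isomorphic V V2" "nword V2" "letters V2 \<inter> letters U' = {}"
    using fresh_copy[OF n(2) nwordD(4)[OF n'(1)]] by blast
  have r: "nw_isomorphic X X" for X :: "('l, 'a) nanoword" by (rule nw_agree_isomorphic) (simp add: nw_agree_def)
  have d2: "letters U' \<inter> letters V2 = {}" using V2(3) by auto
  have 1: "nw_concat U V \<sim>\<^sub>w nw_concat U' V2"
    using concat_chain[OF cob(1) n r d(1) V2(1) d2] by blast
  have "V2 \<sim>\<^sub>w V'"
    using ncob_trans[OF ncob_sym[OF ncob_iso[OF n(2) V2(2,1)]] cob(2)] .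
  then have "nw_concat U' V2 \<sim>\<^sub>w nw_concat U' V'"
    using concat_chain[OF _ V2(2) n'(1) r V2(3) r, of V'] d(2) by (simp add: Int_commute)
  then show ?thesis using 1 ncob_trans by blast
qed

section \<open>The group of classes of nanowords\<close>

abbreviation "nclass \<equiv> nw_class al tau"

lemma nclass_eq_iff: "nword U \<Longrightarrow> nword V \<Longrightarrow> nclass U = nclass V \<longleftrightarrow> U \<sim>\<^sub>w V"
  unfolding nw_class_def using ncob_refl ncob_sym ncob_trans by blast

lemma nclass_carrier: "nword U \<Longrightarrow> nclass U \<in> carrier (nw_group al tau)"
  by (auto simp: nw_group_def)

lemma nclass_carrierE:
  fixes X :: "('l, 'a) nanoword set"
  assumes "X \<in> carrier (nw_group al tau)"
  obtains U :: "('l, 'a) nanoword" where "nword U" "X = nclass U"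
  using assms by (auto simp: nw_group_def)

text \<open>The product of two classes ranges over all representatives and all disjoint copies of
  them; \<open>concat_cob\<close> makes these choices equivalent.\<close>

lemma nclass_mult:
  fixes U V :: "('l::infinite, 'a) nanoword"
  assumes n: "nword U" "nword V" and d: "letters U \<inter> letters V = {}"
  shows "nclass U \<otimes>\<^bsub>nw_group al tau\<^esub> nclass V = nclass (nw_concat U V)"
proof -
  have "nw_concat U V \<sim>\<^sub>w W"
    if "U1 \<in> nclass U" "V1 \<in> nclass V" "nw_isomorphic U1 U'" "nw_isomorphic V1 V'" "letters U' \<inter> letters V' = {}"
      "nw_concat U' V' \<sim>\<^sub>w W" for W U1 V1 U' V'
  proof -
    have c: "U \<sim>\<^sub>w U1" "V \<sim>\<^sub>w V1" "nword U1" "nword V1" using that by (auto simp: nw_class_def)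
    have "U \<sim>\<^sub>w U'" "V \<sim>\<^sub>w V'"
      using ncob_trans[OF c(1) ncob_iso[OF c(3) nword_iso[OF c(3) that(3)] that(3)]]
        ncob_trans[OF c(2) ncob_iso[OF c(4) nword_iso[OF c(4) that(4)] that(4)]] .
    then show ?thesis using concat_cob[OF _ _ n d that(5)] that(6) ncob_trans by blast
  qed
  moreover have "\<exists>U1\<in>nclass U. \<exists>V1\<in>nclass V. \<exists>U' V'. nw_isomorphic U1 U' \<and> nw_isomorphic V1 V' \<and>
      letters U' \<inter> letters V' = {} \<and> nw_concat U' V' \<sim>\<^sub>w W" if "nw_concat U V \<sim>\<^sub>w W" for W
  proof -
    have r: "nw_isomorphic X X" for X :: "('l, 'a) nanoword" by (rule nw_agree_isomorphic) (simp add: nw_agree_def)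
    have m: "U \<in> nclass U" "V \<in> nclass V" using n ncob_refl by (auto simp: nw_class_def)
    show ?thesis using r d that by (intro bexI[OF _ m(1)] bexI[OF _ m(2)]) blast
  qed
  ultimately show ?thesis
    unfolding nw_group_def nw_class_def[of _ _ "nw_concat U V"] monoid.select_convs
    by (intro Collect_cong conj_cong refl iffI) (elim bexE exE conjE, blast+)
qed

lemma nword_empty: "nword empty_nanoword"
  by (simp add: is_nanoword_def empty_nanoword_def)

lemma nword_reverse: "nword U \<Longrightarrow> nword (U\<lparr>word := rev (word U)\<rparr>)"
  by (simp add: is_nanoword_def)

text \<open>The phrase with the single word \<open>w\<^sup>- w\<close> is symmetric and has even length.\<close>

lemma concat_reverse_cob:
  assumes U: "nword U" and V: "nw_isomorphic (U\<lparr>word := rev (word U)\<rparr>) V" and d: "letters V \<inter> letters U = {}"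
  shows "nw_concat V U \<sim>\<^sub>w empty_nanoword"
proof -
  obtain f where f: "bij_betw f (letters U) (letters V)" "\<And>A. A \<in> letters U \<Longrightarrow> proj V (f A) = proj U A"
     "word V = map f (rev (word U))"
    using V unfolding nw_isomorphic_def by auto
  let ?W = "nw_concat V U" and ?g = "inv_into (letters U) f"
  have nV: "nword V" by (rule nword_iso[OF nword_reverse[OF U] V])
  have W: "nword ?W" by (rule nword_concat[OF nV U d])
  have sel: "letters ?W = letters V \<union> letters U" "word ?W = word V @ word U" by (simp_all add: nw_concat_def)
  have fV: "f A \<in> letters V" "f A \<notin> letters U" "?g (f A) = A" if "A \<in> letters U" for A
    using f(1) that d by (auto simp: bij_betw_def)
  have gV: "?g B \<in> letters U" "f (?g B) = B" if "B \<in> letters V" for B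
    using f(1) that by (auto simp: bij_betw_def inv_into_into f_inv_into_f)
  define \<iota> where "\<iota> A = (if A \<in> letters U then f A else ?g A)" for A
  have iU: "\<iota> A = f A" if "A \<in> letters U" for A using that by (simp add: \<iota>_def)
  have iV: "\<iota> A = ?g A" if "A \<in> letters V" for A using that d by (auto simp: \<iota>_def)
  have \<iota>: "\<iota> A \<in> letters ?W" "\<iota> (\<iota> A) = A" "proj ?W (\<iota> A) = proj ?W A" if "A \<in> letters ?W" for A
  proof -
    have "\<iota> A \<in> letters ?W \<and> \<iota> (\<iota> A) = A \<and> proj ?W (\<iota> A) = proj ?W A"
    proof (cases "A \<in> letters U")
      case True
      then show ?thesis using fV[OF True] iU[OF True] iV[OF fV(1)[OF True]] f(2)[OF True] d
        by (auto simp: nw_concat_def)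
    next
      case False
      then have A: "A \<in> letters V" using that sel by auto
      show ?thesis using gV[OF A] iV[OF A] iU[OF gV(1)[OF A]] f(2)[OF gV(1)[OF A]] d A
        by (auto simp: nw_concat_def)
    qed
    then show "\<iota> A \<in> letters ?W" "\<iota> (\<iota> A) = A" "proj ?W (\<iota> A) = proj ?W A" by blast+
  qed
  have bij: "bij_betw \<iota> (letters ?W) (letters ?W)"
    by (rule bij_betwI[where g = \<iota>]) (use \<iota> in auto)
  have "map \<iota> (word U) = map f (word U)" using iU nwordD(3)[OF U] by simp
  moreover have "map \<iota> (word V) = rev (word U)"
  proof -
    have "map \<iota> (word V) = map (\<lambda>A. \<iota> (f A)) (rev (word U))" unfolding f(3) by simp
    also have "\<dots> = map id (rev (word U))" using iV fV nwordD(3)[OF U] by (intro map_cong) auto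
    finally show ?thesis by simp
  qed
  ultimately have mrev: "map \<iota> (word ?W) = rev (word ?W)" unfolding sel f(3) by (simp add: rev_map)
  have eps: "phrase_eps [word ?W] b = 0" if "b \<in> letters ?W" for b
    using nwordD(2)[OF W that] by (simp add: phrase_eps_def)
  let ?Z = "\<lparr>letters = {}, proj = proj ?W, word = []\<rparr>"
  have "surgery al tau ?W ?Z"
    unfolding surgery_def
  proof (intro exI conjI)
    show "letters ?W \<subseteq> letters ?W" ..
    show "is_nanophrase al (proj ?W) (letters ?W) [word ?W]"
      unfolding is_nanophrase_def using nwordD[OF W] by auto
    show "even_phrase [word ?W]" unfolding even_phrase_def sel f(3) by simp
    show "symmetric_phrase tau (proj ?W) (letters ?W) [word ?W]"
      unfolding symmetric_phrase_def using bij mrev eps \<iota>(3) by (intro exI[of _ \<iota>]) simp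
    show "length [[]] = length [word ?W]" by simp
  qed simp_all
  moreover have Z: "nword ?Z" by (simp add: is_nanoword_def)
  ultimately have "?W \<sim>\<^sub>w ?Z" using W by (intro ncob_step) (simp add: nw_step_def)
  also have "?Z \<sim>\<^sub>w empty_nanoword"
    by (rule ncob_iso[OF Z nword_empty nw_agree_isomorphic]) (simp add: nw_agree_def empty_nanoword_def)
  finally show ?thesis .
qed

lemma group_nw: "group (nw_group al tau :: ('l::infinite, 'a) nanoword set monoid)"
proof (rule groupI)
  let ?G = "nw_group al tau :: ('l, 'a) nanoword set monoid"
  have one: "\<one>\<^bsub>?G\<^esub> = nclass empty_nanoword" by (simp add: nw_group_def)
  show "\<one>\<^bsub>?G\<^esub> \<in> carrier ?G" unfolding one by (rule nclass_carrier[OF nword_empty])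
  fix x assume "x \<in> carrier ?G"
  then obtain U :: "('l, 'a) nanoword" where U: "nword U" "x = nclass U" by (rule nclass_carrierE)
  have "nw_concat empty_nanoword U = U" by (cases U) (simp add: nw_concat_def empty_nanoword_def)
  moreover have "letters (empty_nanoword :: ('l, 'a) nanoword) \<inter> letters U = {}" by (simp add: empty_nanoword_def)
  ultimately show "\<one>\<^bsub>?G\<^esub> \<otimes>\<^bsub>?G\<^esub> x = x"
    unfolding one U(2) using nclass_mult[OF nword_empty U(1)] by simp
  obtain V where V: "nw_isomorphic (U\<lparr>word := rev (word U)\<rparr>) V" "nword V" "letters V \<inter> letters U = {}"
    using fresh_copy[OF nword_reverse[OF U(1)] nwordD(4)[OF U(1)]] by blast
  show "\<exists>y\<in>carrier ?G. y \<otimes>\<^bsub>?G\<^esub> x = \<one>\<^bsub>?G\<^esub>"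
  proof
    show "nclass V \<in> carrier ?G" by (rule nclass_carrier[OF V(2)])
    show "nclass V \<otimes>\<^bsub>?G\<^esub> x = \<one>\<^bsub>?G\<^esub>"
      unfolding one U(2) nclass_mult[OF V(2) U(1) V(3)]
      using nclass_eq_iff[OF nword_concat[OF V(2) U(1) V(3)] nword_empty] concat_reverse_cob[OF U(1) V(1,3)] by simp
  qed
  have copy: "\<exists>V'. nword V' \<and> nclass V = nclass V' \<and> letters V' \<inter> F = {}" if "nword V" "finite F" for V :: "('l, 'a) nanoword" and F
    using fresh_copy[OF that] nclass_eq_iff[OF that(1)] ncob_iso[OF that(1)] by metis
  fix y assume "y \<in> carrier ?G"
  then obtain V0 :: "('l, 'a) nanoword" where V0: "nword V0" "y = nclass V0" by (rule nclass_carrierE)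
  then obtain V where V: "nword V" "y = nclass V" "letters V \<inter> letters U = {}"
    using copy[OF V0(1) nwordD(4)[OF U(1)]] by auto
  have dUV: "letters U \<inter> letters V = {}" using V(3) by auto
  note nUV = nword_concat[OF U(1) V(1) dUV]
  show "x \<otimes>\<^bsub>?G\<^esub> y \<in> carrier ?G"
    unfolding U(2) V(2) nclass_mult[OF U(1) V(1) dUV] by (rule nclass_carrier[OF nUV])
  fix z assume "z \<in> carrier ?G"
  then obtain W0 :: "('l, 'a) nanoword" where W0: "nword W0" "z = nclass W0" by (rule nclass_carrierE)
  then obtain W where W: "nword W" "z = nclass W" "letters W \<inter> (letters U \<union> letters V) = {}"
    using copy[OF W0(1), of "letters U \<union> letters V"] nwordD(4)[OF U(1)] nwordD(4)[OF V(1)] by auto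
  have dVW: "letters V \<inter> letters W = {}" and dUVW: "letters (nw_concat U V) \<inter> letters W = {}"
    and dU: "letters U \<inter> letters (nw_concat V W) = {}"
    using W(3) dUV by (auto simp: nw_concat_def)
  have "nw_concat (nw_concat U V) W = nw_concat U (nw_concat V W)"
    by (auto simp: nw_concat_def fun_eq_iff)
  then show "x \<otimes>\<^bsub>?G\<^esub> y \<otimes>\<^bsub>?G\<^esub> z = x \<otimes>\<^bsub>?G\<^esub> (y \<otimes>\<^bsub>?G\<^esub> z)"
    unfolding U(2) V(2) W(2) nclass_mult[OF U(1) V(1) dUV] nclass_mult[OF V(1) W(1) dVW]
      nclass_mult[OF nUV W(1) dUVW] nclass_mult[OF U(1) nword_concat[OF V(1) W(1) dVW] dU] by simp
qed

section \<open>The homomorphism\<close>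

lemma nw_pairing_hom:
  "\<exists>h :: ('l::infinite, 'a) nanoword set \<Rightarrow> ('s::infinite, 'a) pairing set.
     group_hom (nw_group al tau) (psk_group al tau) h \<and>
     (\<forall>W. nword W \<longrightarrow> h (nclass W) = pclass (npair W))"
proof -
  \<comment> \<open>The value on a class uses a chosen nanoword in it; cobordism invariance of the
    pairing makes the class of the result independent of this choice.\<close>
  define h :: "('l, 'a) nanoword set \<Rightarrow> ('s, 'a) pairing set" where
    "h X = pclass (npair (SOME W. nword W \<and> X = nclass W))" for X
  have h: "h (nclass W) = pclass (npair W)" if W: "nword W" for W
  proof -
    define V where "V = (SOME V. nword V \<and> nclass W = nclass V)"
    have V: "nword V \<and> nclass W = nclass V"
      unfolding V_def by (rule someI[of _ W]) (use W in simp)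
    have "W \<sim>\<^sub>w V" using nclass_eq_iff[OF W, of V] V by simp
    then have "npair W \<sim>\<^sub>p npair V" using cob_nw_cobordant[OF W] by blast
    then have "(pclass (npair W) :: ('s, 'a) pairing set) = pclass (npair V)"
      by (rule pclass_eqI[OF pairing_nw[OF W] pairing_nw[OF conjunct1[OF V]]])
    then show ?thesis unfolding h_def V_def[symmetric] by simp
  qed
  have "h \<in> hom (nw_group al tau) (psk_group al tau)"
  proof (rule homI)
    fix x :: "('l, 'a) nanoword set" assume "x \<in> carrier (nw_group al tau)"
    then obtain U :: "('l, 'a) nanoword" where U: "nword U" "x = nclass U" by (rule nclass_carrierE)
    show "h x \<in> carrier (psk_group al tau)"
      unfolding U(2) h[OF U(1)] by (rule pclass_carrier[OF pairing_nw[OF U(1)] skew_nw[OF U(1)]])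
    fix y :: "('l, 'a) nanoword set" assume "y \<in> carrier (nw_group al tau)"
    then obtain V0 :: "('l, 'a) nanoword" where V0: "nword V0" "y = nclass V0" by (rule nclass_carrierE)
    \<comment> \<open>A representative with letters disjoint from those of \<open>U\<close>, so that
      the product of the classes is the class of a concatenation.\<close>
    obtain V where V: "nw_isomorphic V0 V" "nword V" "letters V \<inter> letters U = {}"
      using fresh_copy[OF V0(1) nwordD(4)[OF U(1)]] by blast
    have y: "y = nclass V" unfolding V0(2) nclass_eq_iff[OF V0(1) V(2)] by (rule ncob_iso[OF V0(1) V(2,1)])
    have d: "letters U \<inter> letters V = {}" using V(3) by auto
    note n = nword_concat[OF U(1) V(2) d]
    show "h (x \<otimes>\<^bsub>nw_group al tau\<^esub> y) = h x \<otimes>\<^bsub>psk_group al tau\<^esub> h y"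
      unfolding U(2) y nclass_mult[OF U(1) V(2) d] h[OF U(1)] h[OF V(2)] h[OF n]
        pclass_mult[OF pairing_nw[OF U(1)] pairing_nw[OF V(2)]]
      by (rule pclass_eqI[OF pairing_nw[OF n] pairing_sum[OF pairing_nw[OF U(1)] pairing_nw[OF V(2)]] cob_concat[OF U(1) V(2) d]])
  qed
  then have "group_hom (nw_group al tau) (psk_group al tau) h"
    using group_nw group_psk by (simp add: group_hom_def group_hom_axioms_def)
  then show ?thesis using h by blast
qed

end

theorem theorem7p3p1:
  fixes al :: "'a set" and tau :: "'a \<Rightarrow> 'a"
  assumes "involution_on al tau"
  shows "(\<forall>W :: ('l::infinite, 'a) nanoword. is_nanoword al W \<longrightarrow>
            is_pairing al tau (nw_pairing al tau W) \<and> skew_symmetric al tau (nw_pairing al tau W)) \<and>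
         (\<forall>W W' :: ('l, 'a) nanoword. is_nanoword al W \<and> is_nanoword al W' \<and> nw_cobordant al tau W W' \<longrightarrow>
            p_cobordant al tau (nw_pairing al tau W) (nw_pairing al tau W')) \<and>
         (\<exists>h :: ('l, 'a) nanoword set \<Rightarrow> ('s::infinite, 'a) pairing set.
            group_hom (nw_group al tau) (psk_group al tau) h \<and>
            (\<forall>W. is_nanoword al W \<longrightarrow> h (nw_class al tau W) = p_class al tau (nw_pairing al tau W)))"
proof -
  interpret inv_set al tau by unfold_locales (rule assms)
  show ?thesis
    using pairing_nw skew_nw cob_nw_cobordant nw_pairing_hom by blast
qed

end
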